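(* Let $m\ge 1$, let $(P,M,T)$ be a connected $(m+2)$-angulation of a disc $P$ with set of marked points $M\subset\partial P$, and let $\Lambda=kQ_T/I_T$ be the associated algebra. Then the AG-invariant of $\Lambda$ is $$\mathrm{AG}(\Lambda)=(a,b)^*+t\,(0,m+2)^*,$$ where $t$ is the number of internal $(m+2)$-gons in $(P,M,T)$ and $$a=\#M_T,\qquad b=\sum_{\mathfrak b\in\mathfrak B}\bigl(m-w(\mathfrak b)\bigr).$$
   Context: $k$ is an algebraically closed field. Paths are composed left to right: $\alpha\beta$ means first $\alpha$, then $\beta$, with $t(\alpha)=s(\beta)$. **$(m+2)$-angulations of a disc.** $P$ is a disc and $M\subset\partial P$ is a finite set of marked points, so $(P,M)$ is a polygon with $\#M$ edges. An $m$-allowable diagonal is a chord joining two non-adjacent points of $M$ that divides $(P,M)$ into two polygons each of which can be divided into $(m+2)$-gons by non-crossing chords. $(P,M,T)$ is an $(m+2)$-angulation if $T$ is a maximal collection of pairwise non-crossing $m$-allowable diagonals. An $(m+2)$-gon of $(P,M,T)$ is internal if all its sides belong to $T$. **Quiver.** The vertices of $Q_T$ are the elements of $T$. There is an arrow $x\to y$ for each $(m+2)$-gon $\triangle$ and each corner of $\triangle$ at which two sides $\tau_x,\tau_y\in T$ of $\triangle$ meet, with $\tau_y$ following $\tau_x$ in the counter-clockwise walk around the boundary of $\triangle$. The ideal $I_T$ is generated by the paths $\alpha\beta$ of length 2 such that $\alpha,\beta$ come from two neighbouring corners of the same $(m+2)$-gon. The $(m+2)$-angulation is connected if $Q_T$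 is connected. **Boundary data.** $M_T$ is the set of $p\in M$ incident to $T$. $\mathfrak B$ is the set of pieces $\mathfrak b$ of the boundary demarcated by $M_T$: the endpoints of $\mathfrak b$ are in $M_T$ and $\mathfrak b$ contains no other points of $M_T$. $w(\mathfrak b)=\#((M\cap\mathfrak b)\setminus M_T)$. For $(a,b)\in\mathbb N^2$, $(a,b)^*\colon\mathbb N^2\to\mathbb N$ is the function with value $1$ at $(a,b)$ and $0$ elsewhere. **Threads** of a gentle algebra $\Lambda=kQ/I$. A permitted path is a path not in $I$; a non-trivial permitted thread is a permitted path $H$ of positive length such that for no arrow $\beta$ is $\beta H$ or $H\beta$ a permitted path. A forbidden path is a path $\alpha_1\cdots\alpha_n$ with pairwise distinct arrows and $\alpha_i\alpha_{i+1}\in I$ for all $i<n$; a non-trivial forbidden thread is a forbidden path $F$ of positive length such that for no arrow $\beta$ is $\beta F$ or $F\beta$ a forbidden path (oriented cycles in which every two cyclically consecutive arrows form a relation are not counted as forbidden threads). Let $x\in Q_0$ have at most one incoming and at most one outgoing arrow. The constant path $e_x$ is a trivial permitted thread $h_x$ if, whenever arrows $\beta,\gamma$ with $t(\beta)=x=s(\gamma)$ exist, $\beta\gamma\notin I$; it is a trivial forbidden thread $p_x$ if, whenever such arrows exist, $\beta\gamma\in I$. **Sign functions.** Fix a choice of functions $\sigma,\varepsilon\colon Q_1\to\{-1,1\}$ such that: (1) distinct arrows with the same source have opposite $\sigma$; (2) distinct arrows with the same target have opposite $\varepsilon$; (3) if $s(\beta)=t(\alpha)$ and $\alpha\beta\notin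 I$ then $\sigma(\beta)=-\varepsilon(\alpha)$. For a path, $\sigma(\alpha_1\cdots\alpha_n)=\sigma(\alpha_1)$ and $\varepsilon(\alpha_1\cdots\alpha_n)=\varepsilon(\alpha_n)$. For trivial threads: $\sigma(h_x)=-\varepsilon(h_x)=-\sigma(\alpha)$ if $s(\alpha)=x$, or $\sigma(h_x)=-\varepsilon(h_x)=\varepsilon(\beta)$ if $t(\beta)=x$; $\sigma(p_y)=\varepsilon(p_y)=-\sigma(\gamma)$ if $s(\gamma)=y$, or $\sigma(p_y)=\varepsilon(p_y)=-\varepsilon(\delta)$ if $t(\delta)=y$. **AG-invariant.** (1) Start with a permitted thread $H_0$. To $H_i$ associate $F_i$, the forbidden thread ending at $t(H_i)$ with $\varepsilon(F_i)=-\varepsilon(H_i)$; to $F_i$ associate $H_{i+1}$, the permitted thread starting at $s(F_i)$ with $\sigma(H_{i+1})=-\sigma(F_i)$. Stop when $H_n=H_0$ for some natural number $n\ge 1$, and record the pair $(n,q)$ with $q=\sum_{i=1}^{n}\ell(F_i)$ (where $F_n=F_0$), $\ell$ denoting length. (2) Repeat until all permitted threads have occurred. (3) For each oriented cycle in which each pair of consecutive arrows forms a relation, record $(0,n)$, $n$ the length of the cycle. $\mathrm{AG}(\Lambda)\colon\mathbb N^2\to\mathbb N$ sends $(n,q)$ to the number of times the pair $(n,q)$ is recorded. *)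

theory Defs
  imports
    "HOL-Analysis.Analysis"
    "HOL-Computational_Algebra.Polynomial"
    "HOL-Algebra.Ideal"
    "Graph_Theory.Digraph_Component"
    "Graph_Theory.Arc_Walk"
begin

section \<open>Polygons inscribed in the unit disc\<close>

text \<open>
  The disc is the closed unit disc of the complex plane and the marked points form a finite subset
  of the unit circle. A polygon is given by its set of corners \<open>S\<close>, and a side or a chord by the
  set of its two endpoints.
\<close>

text \<open>The closed arc of the unit circle traversed counter-clockwise from \<open>p\<close> to \<open>q\<close>.\<close>

definition ccw_arc :: "complex \<Rightarrow> complex \<Rightarrow> complex set" where
  "ccw_arc p q = {z \<in> sphere 0 1. Arg2pi (z / p) \<le> Arg2pi (q / p)}"

text \<open>\<open>q\<close> follows \<open>p\<close> in the counter-clockwise walk through the points of \<open>S\<close>.\<close>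

definition ccw_next :: "complex set \<Rightarrow> complex \<Rightarrow> complex \<Rightarrow> bool" where
  "ccw_next S p q \<longleftrightarrow> p \<in> S \<and> q \<in> S \<and> p \<noteq> q \<and> S \<inter> ccw_arc p q = {p, q}"

definition sides :: "complex set \<Rightarrow> complex set set" where
  "sides S = {{p, q} | p q. ccw_next S p q}"

definition diagonals :: "complex set \<Rightarrow> complex set set" where
  "diagonals S = {{p, q} | p q. p \<in> S \<and> q \<in> S \<and> p \<noteq> q} - sides S"

text \<open>
  A point of a chord lies in the open disc unless it is an endpoint of the chord.
\<close>

definition crosses :: "complex set \<Rightarrow> complex set \<Rightarrow> bool" where
  "crosses d e \<longleftrightarrow> convex hull d \<inter> convex hull e \<inter> ball 0 1 \<noteq> {}"

definition noncrossing :: "complex set set \<Rightarrow> bool" where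
  "noncrossing D \<longleftrightarrow> pairwise (\<lambda>d e. \<not> crosses d e) D"

text \<open>
  The polygons into which a set \<open>D\<close> of pairwise non-crossing diagonals cuts the polygon \<open>S\<close>:
  their sides are chords in \<open>D\<close> or sides of \<open>S\<close>, and they are not cut any further.
\<close>

definition regions :: "complex set \<Rightarrow> complex set set \<Rightarrow> complex set set" where
  "regions S D = {R. R \<subseteq> S \<and> 3 \<le> card R \<and> sides R \<subseteq> D \<union> sides S \<and> diagonals R \<inter> D = {}}"

definition divisible_into_gons :: "nat \<Rightarrow> complex set \<Rightarrow> bool" where
  "divisible_into_gons n S \<longleftrightarrow>
     (\<exists>D. D \<subseteq> diagonals S \<and> noncrossing D \<and> (\<forall>R \<in> regions S D. card R = n))"

definition allowable_diagonals :: "nat \<Rightarrow> complex set \<Rightarrow> complex set set" where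
  "allowable_diagonals m M = {{p, q} | p q. {p, q} \<in> diagonals M \<and>
     divisible_into_gons (m + 2) (M \<inter> ccw_arc p q) \<and>
     divisible_into_gons (m + 2) (M \<inter> ccw_arc q p)}"

definition angulation :: "nat \<Rightarrow> complex set \<Rightarrow> complex set set \<Rightarrow> bool" where
  "angulation m M T \<longleftrightarrow> T \<subseteq> allowable_diagonals m M \<and> noncrossing T \<and>
     (\<forall>T'. T \<subseteq> T' \<and> T' \<subseteq> allowable_diagonals m M \<and> noncrossing T' \<longrightarrow> T' = T)"

definition gons :: "nat \<Rightarrow> complex set \<Rightarrow> complex set set \<Rightarrow> complex set set" where
  "gons m M T = {R \<in> regions M T. card R = m + 2}"

definition internal_gons :: "nat \<Rightarrow> complex set \<Rightarrow> complex set set \<Rightarrow> complex set set" where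
  "internal_gons m M T = {R \<in> gons m M T. sides R \<subseteq> T}"

definition incident_points :: "complex set \<Rightarrow> complex set set \<Rightarrow> complex set" where
  "incident_points M T = M \<inter> \<Union>T"

definition boundary_pieces :: "complex set \<Rightarrow> complex set set \<Rightarrow> complex set set" where
  "boundary_pieces M T = {ccw_arc p q | p q. ccw_next (incident_points M T) p q}"

definition piece_weight :: "complex set \<Rightarrow> complex set set \<Rightarrow> complex set \<Rightarrow> nat" where
  "piece_weight M T \<bb> = card ((M \<inter> \<bb>) - incident_points M T)"


section \<open>Path algebras\<close>

text \<open>
  A path is a pair \<open>(u, p)\<close> of its starting vertex and its list of arrows, composed left to right;
  \<open>(u, [])\<close> is the constant path at \<open>u\<close>. An element of the path algebra is the family of its
  coefficients.
\<close>

definition is_path :: "('v, 'a) pre_digraph \<Rightarrow> 'v \<times> 'a list \<Rightarrow> bool" where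
  "is_path Q = (\<lambda>(u, p). \<exists>v. pre_digraph.awalk Q u p v)"

definition path_end :: "('v, 'a) pre_digraph \<Rightarrow> 'v \<Rightarrow> 'a list \<Rightarrow> 'v" where
  "path_end Q u p = (if p = [] then u else head Q (last p))"

definition path_algebra :: "('v, 'a) pre_digraph \<Rightarrow> ('v \<times> 'a list \<Rightarrow> 'k::field) ring" where
  "path_algebra Q = \<lparr>
     carrier = {f. finite {x. f x \<noteq> 0} \<and> (\<forall>x. f x \<noteq> 0 \<longrightarrow> is_path Q x)},
     mult = (\<lambda>f g (u, p). \<Sum>i\<le>length p.
               f (u, take i p) * g (path_end Q u (take i p), drop i p)),
     one = (\<lambda>(u, p). if u \<in> verts Q \<and> p = [] then 1 else 0),
     zero = (\<lambda>x. 0),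
     add = (\<lambda>f g x. f x + g x)\<rparr>"

definition path_elem :: "'v \<times> 'a list \<Rightarrow> 'v \<times> 'a list \<Rightarrow> 'k::field" where
  "path_elem x = (\<lambda>y. if y = x then 1 else 0)"


section \<open>The quiver with relations of an angulation\<close>

text \<open>
  The tuple \<open>(R, u, p, v)\<close> is the corner \<open>p\<close> of the polygon \<open>R\<close>, with the neighbouring
  corners \<open>u\<close> and \<open>v\<close> before and after it in the counter-clockwise walk around \<open>R\<close>.
\<close>

type_synonym corner = "complex set \<times> complex \<times> complex \<times> complex"

definition angulation_quiver ::
  "nat \<Rightarrow> complex set \<Rightarrow> complex set set \<Rightarrow> (complex set, corner) pre_digraph" where
  "angulation_quiver m M T = \<lparr>
     verts = T,
     arcs = {(R, u, p, v). R \<in> gons m M T \<and> ccw_next R u p \<and> ccw_next R p v \<and>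
               {u, p} \<in> T \<and> {p, v} \<in> T},
     tail = (\<lambda>(R, u, p, v). {u, p}),
     head = (\<lambda>(R, u, p, v). {p, v})\<rparr>"

definition neighbouring_corners :: "corner \<Rightarrow> corner \<Rightarrow> bool" where
  "neighbouring_corners = (\<lambda>(R, u, p, v) (R', u', p', v'). R = R' \<and> {p, p'} \<in> sides R)"

definition angulation_ideal ::
  "nat \<Rightarrow> complex set \<Rightarrow> complex set set \<Rightarrow> (complex set \<times> corner list \<Rightarrow> 'k::field) set" where
  "angulation_ideal m M T =
     (let Q = angulation_quiver m M T in
      genideal (path_algebra Q)
        {path_elem (tail Q \<alpha>, [\<alpha>, \<beta>]) | \<alpha> \<beta>.
           \<alpha> \<in> arcs Q \<and> \<beta> \<in> arcs Q \<and> head Q \<alpha> = tail Q \<beta> \<and> neighbouring_corners \<alpha> \<beta>})"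


section \<open>Threads\<close>

text \<open>
  In this and the next section \<open>I\<close> is an ideal of the path algebra of \<open>Q\<close>, and a path of
  positive length is given by its list of arrows.
\<close>

definition relation ::
  "('v, 'a) pre_digraph \<Rightarrow> ('v \<times> 'a list \<Rightarrow> 'k::field) set \<Rightarrow> 'a \<Rightarrow> 'a \<Rightarrow> bool" where
  "relation Q I \<alpha> \<beta> \<longleftrightarrow> path_elem (tail Q \<alpha>, [\<alpha>, \<beta>]) \<in> I"

definition permitted_path ::
  "('v, 'a) pre_digraph \<Rightarrow> ('v \<times> 'a list \<Rightarrow> 'k::field) set \<Rightarrow> 'a list \<Rightarrow> bool" where
  "permitted_path Q I p \<longleftrightarrow>
     p \<noteq> [] \<and> is_path Q (tail Q (hd p), p) \<and> path_elem (tail Q (hd p), p) \<notin> I"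

definition forbidden_path ::
  "('v, 'a) pre_digraph \<Rightarrow> ('v \<times> 'a list \<Rightarrow> 'k::field) set \<Rightarrow> 'a list \<Rightarrow> bool" where
  "forbidden_path Q I p \<longleftrightarrow>
     p \<noteq> [] \<and> is_path Q (tail Q (hd p), p) \<and> distinct p \<and>
     (\<forall>i. Suc i < length p \<longrightarrow> relation Q I (p ! i) (p ! Suc i))"

definition relation_cycle ::
  "('v, 'a) pre_digraph \<Rightarrow> ('v \<times> 'a list \<Rightarrow> 'k::field) set \<Rightarrow> 'a list \<Rightarrow> bool" where
  "relation_cycle Q I p \<longleftrightarrow>
     forbidden_path Q I p \<and> head Q (last p) = tail Q (hd p) \<and> relation Q I (last p) (hd p)"

definition nontrivial_permitted_thread ::
  "('v, 'a) pre_digraph \<Rightarrow> ('v \<times> 'a list \<Rightarrow> 'k::field) set \<Rightarrow> 'a list \<Rightarrow> bool" where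
  "nontrivial_permitted_thread Q I p \<longleftrightarrow> permitted_path Q I p \<and>
     \<not> (\<exists>\<beta> \<in> arcs Q. permitted_path Q I (\<beta> # p) \<or> permitted_path Q I (p @ [\<beta>]))"

definition nontrivial_forbidden_thread ::
  "('v, 'a) pre_digraph \<Rightarrow> ('v \<times> 'a list \<Rightarrow> 'k::field) set \<Rightarrow> 'a list \<Rightarrow> bool" where
  "nontrivial_forbidden_thread Q I p \<longleftrightarrow> forbidden_path Q I p \<and>
     \<not> (\<exists>\<beta> \<in> arcs Q. forbidden_path Q I (\<beta> # p) \<or> forbidden_path Q I (p @ [\<beta>])) \<and>
     \<not> relation_cycle Q I p"

definition trivial_permitted_at ::
  "('v, 'a) pre_digraph \<Rightarrow> ('v \<times> 'a list \<Rightarrow> 'k::field) set \<Rightarrow> 'v \<Rightarrow> bool" where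
  "trivial_permitted_at Q I x \<longleftrightarrow>
     x \<in> verts Q \<and> card (in_arcs Q x) \<le> 1 \<and> card (out_arcs Q x) \<le> 1 \<and>
     (\<forall>\<beta> \<in> in_arcs Q x. \<forall>\<gamma> \<in> out_arcs Q x. \<not> relation Q I \<beta> \<gamma>)"

definition trivial_forbidden_at ::
  "('v, 'a) pre_digraph \<Rightarrow> ('v \<times> 'a list \<Rightarrow> 'k::field) set \<Rightarrow> 'v \<Rightarrow> bool" where
  "trivial_forbidden_at Q I x \<longleftrightarrow>
     x \<in> verts Q \<and> card (in_arcs Q x) \<le> 1 \<and> card (out_arcs Q x) \<le> 1 \<and>
     (\<forall>\<beta> \<in> in_arcs Q x. \<forall>\<gamma> \<in> out_arcs Q x. relation Q I \<beta> \<gamma>)"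

text \<open>
  The sign of a trivial forbidden thread at \<open>y\<close> is prescribed both by the arrow ending at \<open>y\<close> and by
  the arrow starting at \<open>y\<close>. The preceding clauses do not force the two prescriptions to agree, so
  the last clause asks for it. For trivial permitted threads the agreement follows from the clause
  on compositions that are not relations.
\<close>

definition sign_functions ::
  "('v, 'a) pre_digraph \<Rightarrow> ('v \<times> 'a list \<Rightarrow> 'k::field) set \<Rightarrow> ('a \<Rightarrow> int) \<Rightarrow> ('a \<Rightarrow> int) \<Rightarrow> bool"
  where
  "sign_functions Q I \<sigma> \<epsilon> \<longleftrightarrow>
     (\<forall>\<alpha> \<in> arcs Q. \<sigma> \<alpha> \<in> {-1, 1} \<and> \<epsilon> \<alpha> \<in> {-1, 1}) \<and>
     (\<forall>\<alpha> \<in> arcs Q. \<forall>\<beta> \<in> arcs Q. \<alpha> \<noteq> \<beta> \<and> tail Q \<alpha> = tail Q \<beta> \<longrightarrow> \<sigma> \<alpha> = - \<sigma> \<beta>) \<and>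
     (\<forall>\<alpha> \<in> arcs Q. \<forall>\<beta> \<in> arcs Q. \<alpha> \<noteq> \<beta> \<and> head Q \<alpha> = head Q \<beta> \<longrightarrow> \<epsilon> \<alpha> = - \<epsilon> \<beta>) \<and>
     (\<forall>\<alpha> \<in> arcs Q. \<forall>\<beta> \<in> arcs Q.
        tail Q \<beta> = head Q \<alpha> \<and> \<not> relation Q I \<alpha> \<beta> \<longrightarrow> \<sigma> \<beta> = - \<epsilon> \<alpha>) \<and>
     (\<forall>y. trivial_forbidden_at Q I y \<longrightarrow>
        (\<forall>\<delta> \<in> in_arcs Q y. \<forall>\<gamma> \<in> out_arcs Q y. - \<sigma> \<gamma> = - \<epsilon> \<delta>))"

text \<open>
  A trivial thread carries its vertex and its sign \<open>\<sigma>\<close>. The sign is determined by the arrows at the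
  vertex; at a vertex without arrows nothing is prescribed and both signs occur, so that such a
  vertex has two trivial permitted and two trivial forbidden threads.
\<close>

datatype ('v, 'a) "thread" = Trivial 'v int | Nontrivial "'a list"

fun permitted_thread ::
  "('v, 'a) pre_digraph \<Rightarrow> ('v \<times> 'a list \<Rightarrow> 'k::field) set \<Rightarrow> ('a \<Rightarrow> int) \<Rightarrow> ('a \<Rightarrow> int) \<Rightarrow>
   ('v, 'a) thread \<Rightarrow> bool" where
  "permitted_thread Q I \<sigma> \<epsilon> (Nontrivial p) \<longleftrightarrow> nontrivial_permitted_thread Q I p"
| "permitted_thread Q I \<sigma> \<epsilon> (Trivial x s) \<longleftrightarrow> trivial_permitted_at Q I x \<and> s \<in> {-1, 1} \<and>
     (\<forall>\<alpha> \<in> out_arcs Q x. s = - \<sigma> \<alpha>) \<and> (\<forall>\<beta> \<in> in_arcs Q x. s = \<epsilon> \<beta>)"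

fun forbidden_thread ::
  "('v, 'a) pre_digraph \<Rightarrow> ('v \<times> 'a list \<Rightarrow> 'k::field) set \<Rightarrow> ('a \<Rightarrow> int) \<Rightarrow> ('a \<Rightarrow> int) \<Rightarrow>
   ('v, 'a) thread \<Rightarrow> bool" where
  "forbidden_thread Q I \<sigma> \<epsilon> (Nontrivial p) \<longleftrightarrow> nontrivial_forbidden_thread Q I p"
| "forbidden_thread Q I \<sigma> \<epsilon> (Trivial y s) \<longleftrightarrow> trivial_forbidden_at Q I y \<and> s \<in> {-1, 1} \<and>
     (\<forall>\<gamma> \<in> out_arcs Q y. s = - \<sigma> \<gamma>) \<and> (\<forall>\<delta> \<in> in_arcs Q y. s = - \<epsilon> \<delta>)"

fun thread_start :: "('v, 'a) pre_digraph \<Rightarrow> ('v, 'a) thread \<Rightarrow> 'v" where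
  "thread_start Q (Nontrivial p) = tail Q (hd p)"
| "thread_start Q (Trivial x s) = x"

fun thread_end :: "('v, 'a) pre_digraph \<Rightarrow> ('v, 'a) thread \<Rightarrow> 'v" where
  "thread_end Q (Nontrivial p) = head Q (last p)"
| "thread_end Q (Trivial x s) = x"

fun thread_length :: "('v, 'a) thread \<Rightarrow> nat" where
  "thread_length (Nontrivial p) = length p"
| "thread_length (Trivial x s) = 0"

fun thread_sigma :: "('a \<Rightarrow> int) \<Rightarrow> ('v, 'a) thread \<Rightarrow> int" where
  "thread_sigma \<sigma> (Nontrivial p) = \<sigma> (hd p)"
| "thread_sigma \<sigma> (Trivial x s) = s"

fun permitted_epsilon :: "('a \<Rightarrow> int) \<Rightarrow> ('v, 'a) thread \<Rightarrow> int" where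
  "permitted_epsilon \<epsilon> (Nontrivial p) = \<epsilon> (last p)"
| "permitted_epsilon \<epsilon> (Trivial x s) = - s"

fun forbidden_epsilon :: "('a \<Rightarrow> int) \<Rightarrow> ('v, 'a) thread \<Rightarrow> int" where
  "forbidden_epsilon \<epsilon> (Nontrivial p) = \<epsilon> (last p)"
| "forbidden_epsilon \<epsilon> (Trivial x s) = s"


section \<open>The AG-invariant\<close>

definition ag_run ::
  "('v, 'a) pre_digraph \<Rightarrow> ('v \<times> 'a list \<Rightarrow> 'k::field) set \<Rightarrow> ('a \<Rightarrow> int) \<Rightarrow> ('a \<Rightarrow> int) \<Rightarrow>
   nat \<Rightarrow> (nat \<Rightarrow> ('v, 'a) thread) \<Rightarrow> (nat \<Rightarrow> ('v, 'a) thread) \<Rightarrow> bool" where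
  "ag_run Q I \<sigma> \<epsilon> n H F \<longleftrightarrow>
     1 \<le> n \<and> permitted_thread Q I \<sigma> \<epsilon> (H 0) \<and>
     (\<forall>i<n.
        forbidden_thread Q I \<sigma> \<epsilon> (F i) \<and>
        thread_end Q (F i) = thread_end Q (H i) \<and>
        forbidden_epsilon \<epsilon> (F i) = - permitted_epsilon \<epsilon> (H i) \<and>
        permitted_thread Q I \<sigma> \<epsilon> (H (Suc i)) \<and>
        thread_start Q (H (Suc i)) = thread_start Q (F i) \<and>
        thread_sigma \<sigma> (H (Suc i)) = - thread_sigma \<sigma> (F i)) \<and>
     H n = H 0 \<and> (\<forall>i. 0 < i \<and> i < n \<longrightarrow> H i \<noteq> H 0) \<and> F n = F 0"

text \<open>
  Runs through the same set \<open>X\<close> of permitted threads differ only in the thread at which they start,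
  and only one of them is performed. So pairs are counted once for each such \<open>X\<close>, and oriented
  cycles are counted up to rotation.
\<close>

definition ag_recorded ::
  "('v, 'a) pre_digraph \<Rightarrow> ('v \<times> 'a list \<Rightarrow> 'k::field) set \<Rightarrow> ('a \<Rightarrow> int) \<Rightarrow> ('a \<Rightarrow> int) \<Rightarrow>
   nat \<Rightarrow> nat \<Rightarrow> ('v, 'a) thread set \<Rightarrow> bool" where
  "ag_recorded Q I \<sigma> \<epsilon> n q X \<longleftrightarrow>
     (\<exists>H F. ag_run Q I \<sigma> \<epsilon> n H F \<and> X = H ` {..<n} \<and> q = (\<Sum>i = 1..n. thread_length (F i)))"

definition relation_cycle_classes ::
  "('v, 'a) pre_digraph \<Rightarrow> ('v \<times> 'a list \<Rightarrow> 'k::field) set \<Rightarrow> nat \<Rightarrow> 'a list set set" where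
  "relation_cycle_classes Q I n =
     {range (\<lambda>i. rotate i p) | p. relation_cycle Q I p \<and> length p = n}"

definition AG ::
  "('v, 'a) pre_digraph \<Rightarrow> ('v \<times> 'a list \<Rightarrow> 'k::field) set \<Rightarrow> ('a \<Rightarrow> int) \<Rightarrow> ('a \<Rightarrow> int) \<Rightarrow>
   nat \<times> nat \<Rightarrow> nat" where
  "AG Q I \<sigma> \<epsilon> = (\<lambda>(n, q). card {X. ag_recorded Q I \<sigma> \<epsilon> n q X} +
     (if n = 0 then card (relation_cycle_classes Q I q) else 0))"

end

theory Submission
  imports Defs
begin

text \<open>
  Arrows of the quiver are corners of the \<open>(m + 2)\<close>-gons. Two composable arrows either lie in the same
  polygon at consecutive corners, which is a relation, or are corners at the same point of \<open>M\<close>, which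
  is not. So permitted threads are the fans of diagonals at the points of \<open>M\<^sub>T\<close> (a trivial thread being
  a fan with one diagonal), and forbidden threads are runs of consecutive diagonals along the boundary
  of one polygon. The sign functions amount to one function \<open>\<tau>\<close> on directed diagonals with
  \<open>\<tau> q p = - \<tau> p q\<close>, and the sign conditions of the algorithm make the forbidden thread that follows
  the fan at \<open>p\<close> run in the polygon on the other side of the last diagonal of the fan. Connectedness
  forces the sides of this polygon that are not diagonals to be consecutive, starting at \<open>p\<close> and ending
  at the next point \<open>a\<close> of \<open>M\<^sub>T\<close>. Hence the thread has length \<open>m - w\<close>, where \<open>w\<close> is the weight of the
  boundary piece from \<open>p\<close> to \<open>a\<close>, and the next permitted thread is the fan at \<open>a\<close>. The algorithm thus
  makes a single round trip through \<open>M\<^sub>T\<close>. The relation cycles are the walks around the internal polygons.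
\<close>

section \<open>Cyclic order and crossing chords\<close>

text \<open>The definitions speak of convex hulls, of maximality among allowable diagonals and of an
  ideal in a path algebra, and each has to be made combinatorial. Crossing becomes a condition on
  the cyclic order of four points. Allowability becomes a congruence: a polygon with
  \<open>n >= 3\<close> corners can be cut into \<open>(m + 2)\<close>-gons exactly if
  \<open>m\<close> divides \<open>n - 2\<close>; together with maximality this forces every polygon
  of the angulation to have \<open>m + 2\<close> corners. A path lies in the ideal exactly if it
  contains a generating composition. The constant \<open>m - w\<close> is then a count: of the
  \<open>m + 2\<close> corners of the polygon at a boundary piece of weight \<open>w\<close>, two
  are the ends of the piece and \<open>w\<close> lie inside it, and each remaining corner carries
  one arrow of the forbidden thread. So \<open>m - w\<close> is never negative, and a sum of
  integers yields a natural number \<open>b\<close>. The delicate point about signs is a diagonal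
  with few arrows, where a trivial thread must still know to which end of the diagonal it belongs; a
  sign attached to the directed diagonal settles this uniformly for trivial and non-trivial
  threads.\<close>

abbreviation piece :: "complex set \<Rightarrow> complex \<Rightarrow> complex \<Rightarrow> complex set" where
  "piece S a b \<equiv> S \<inter> ccw_arc a b"

text \<open>The strict counter-clockwise cyclic order of three points, written through the linear
  order of their arguments, so that most facts about it become inequalities between arguments after
  unfolding.\<close>

definition btw :: "complex \<Rightarrow> complex \<Rightarrow> complex \<Rightarrow> bool" where
  "btw a b c \<longleftrightarrow> Arg2pi a < Arg2pi b \<and> Arg2pi b < Arg2pi c \<or>
     Arg2pi b < Arg2pi c \<and> Arg2pi c < Arg2pi a \<or> Arg2pi c < Arg2pi a \<and> Arg2pi a < Arg2pi b"

lemma btw_distinct: "btw a b c \<Longrightarrow> a \<noteq> b \<and> b \<noteq> c \<and> a \<noteq> c"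
  by (auto simp: btw_def)

lemma btw_rotate: "btw a b c \<longleftrightarrow> btw b c a"
  by (auto simp: btw_def)

lemma btw_asym: "btw a b c \<Longrightarrow> \<not> btw c b a"
  by (auto simp: btw_def)

lemma Arg2pi_inj_sphere:
  assumes "x \<in> sphere 0 1" "y \<in> sphere 0 1" "Arg2pi x = Arg2pi y"
  shows "x = y"
  using assms Arg2pi_eq[of x] Arg2pi_eq[of y] by simp

lemma btw_total:
  assumes "{a, b, c} \<subseteq> sphere 0 1" "a \<noteq> b" "b \<noteq> c" "a \<noteq> c" "\<not> btw a b c"
  shows "btw c b a"
  using assms Arg2pi_inj_sphere[of a b] Arg2pi_inj_sphere[of b c] Arg2pi_inj_sphere[of a c]
  unfolding btw_def by (smt (verit) insert_subset)

text \<open>The two cases record whether the counter-clockwise turn from \<open>p\<close> to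
  \<open>z\<close> passes the positive real axis, where the argument drops by
  \<open>2 * pi\<close>.\<close>

lemma Arg2pi_quotient:
  assumes "p \<in> sphere 0 1" "z \<in> sphere 0 1"
  shows "Arg2pi (z / p) =
    (if Arg2pi p \<le> Arg2pi z then Arg2pi z - Arg2pi p else Arg2pi z - Arg2pi p + 2 * pi)"
proof -
  have nz: "p \<noteq> 0" "z \<noteq> 0" using assms by auto
  show ?thesis
  proof (cases "Arg2pi p \<le> Arg2pi z")
    case True
    then show ?thesis using nz by (simp add: Arg2pi_divide)
  next
    case False
    then have "Arg2pi (p / z) = Arg2pi p - Arg2pi z" using nz by (simp add: Arg2pi_divide)
    moreover have "Arg2pi (z / p) = (if p / z \<in> \<real> then Arg2pi (p / z) else 2 * pi - Arg2pi (p / z))"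
      using Arg2pi_inverse[of "p / z"] by simp
    \<comment> \<open>A real quotient has argument 0 or \<open>pi\<close>, and here the argument is
      positive because \<open>z\<close> has the smaller one.\<close>
    moreover have "Arg2pi (p / z) = pi" if "p / z \<in> \<real>"
      using that False calculation(1) Arg2pi_eq_0_pi by force
    ultimately show ?thesis using False by auto
  qed
qed

lemma btw_Arg2pi:
  assumes "p \<in> sphere 0 1" "x \<in> sphere 0 1" "y \<in> sphere 0 1"
  shows "btw p x y \<longleftrightarrow> 0 < Arg2pi (x / p) \<and> Arg2pi (x / p) < Arg2pi (y / p)"
  using Arg2pi_lt_2pi[of x] Arg2pi_lt_2pi[of y] Arg2pi_lt_2pi[of p]
    Arg2pi_ge_0[of x] Arg2pi_ge_0[of y] Arg2pi_ge_0[of p]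
  unfolding btw_def Arg2pi_quotient[OF assms(1,2)] Arg2pi_quotient[OF assms(1,3)]
  by (auto split: if_splits)

lemma ccw_arc_btw:
  assumes "p \<in> sphere 0 1" "q \<in> sphere 0 1" "p \<noteq> q"
  shows "z \<in> ccw_arc p q \<longleftrightarrow> z \<in> sphere 0 1 \<and> (z = p \<or> z = q \<or> btw p z q)"
proof (cases "z \<in> sphere 0 1")
  case True
  consider "z = p" | "z = q" | "Arg2pi z \<noteq> Arg2pi p" "Arg2pi z \<noteq> Arg2pi q" "z \<noteq> p" "z \<noteq> q"
    using Arg2pi_inj_sphere[OF True] assms by metis
  then have "Arg2pi (z / p) \<le> Arg2pi (q / p) \<longleftrightarrow> z = p \<or> z = q \<or> btw p z q"
  proof cases
    case 1
    then have "Arg2pi (z / p) = 0" using True by (auto simp: Arg2pi_eq_0)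
    then show ?thesis using 1 Arg2pi_ge_0 by simp
  next
    case 2
    then show ?thesis by simp
  next
    case 3
    then show ?thesis
      using Arg2pi_lt_2pi[of q] Arg2pi_lt_2pi[of z] Arg2pi_lt_2pi[of p]
        Arg2pi_ge_0[of q] Arg2pi_ge_0[of z] Arg2pi_ge_0[of p]
      unfolding btw_def Arg2pi_quotient[OF assms(1,2)] Arg2pi_quotient[OF assms(1) True]
      by (auto split: if_splits)
  qed
  then show ?thesis using True by (simp add: ccw_arc_def)
qed (simp add: ccw_arc_def)

lemma ccw_next_btw:
  assumes "S \<subseteq> sphere 0 1"
  shows "ccw_next S p q \<longleftrightarrow> p \<in> S \<and> q \<in> S \<and> p \<noteq> q \<and> (\<forall>z\<in>S. \<not> btw p z q)"
proof (cases "p \<in> S \<and> q \<in> S \<and> p \<noteq> q")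
  case True
  then have "p \<in> sphere 0 1" "q \<in> sphere 0 1" "p \<noteq> q" using assms by auto
  note arc = ccw_arc_btw[OF this]
  have "piece S p q = {p, q} \<union> {z \<in> S. btw p z q}"
    using True assms unfolding set_eq_iff Int_iff arc by auto
  moreover have "z \<notin> {p, q}" if "btw p z q" for z using btw_distinct[OF that] by auto
  ultimately have "piece S p q = {p, q} \<longleftrightarrow> (\<forall>z\<in>S. \<not> btw p z q)" by fast
  then show ?thesis using True by (simp add: ccw_next_def)
qed (auto simp: ccw_next_def)

lemma ccw_next_neq: "ccw_next S p q \<Longrightarrow> p \<in> S \<and> q \<in> S \<and> p \<noteq> q"
  by (simp add: ccw_next_def)

lemma ex_min_on:
  fixes f :: "'a \<Rightarrow> 'b::linorder"
  assumes "finite A" "A \<noteq> {}"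
  shows "\<exists>a\<in>A. \<forall>z\<in>A. f a \<le> f z"
proof -
  have "Min (f ` A) \<in> f ` A" using assms by (intro Min_in) auto
  then obtain a where "a \<in> A" "f a = Min (f ` A)" by auto
  then show ?thesis using assms by (intro bexI[of _ a]) auto
qed

lemma ex_max_on:
  fixes f :: "'a \<Rightarrow> 'b::linorder"
  assumes "finite A" "A \<noteq> {}"
  shows "\<exists>a\<in>A. \<forall>z\<in>A. f z \<le> f a"
proof -
  have "Max (f ` A) \<in> f ` A" using assms by (intro Max_in) auto
  then obtain a where "a \<in> A" "f a = Max (f ` A)" by auto
  then show ?thesis using assms by (intro bexI[of _ a]) auto
qed

text \<open>The minimum is taken over angles measured from \<open>p\<close>. If \<open>p\<close>
  were in \<open>A\<close> it would be the minimum itself, so the applications use sets that do not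
  contain \<open>p\<close>.\<close>

lemma ex_first_ccw:
  assumes "finite A" "A \<noteq> {}" "A \<subseteq> sphere 0 1" "p \<in> sphere 0 1"
  shows "\<exists>a\<in>A. \<forall>z\<in>A. \<not> btw p z a"
proof -
  obtain a where a: "a \<in> A" "\<forall>z\<in>A. Arg2pi (a / p) \<le> Arg2pi (z / p)"
    using ex_min_on[OF assms(1,2), of "\<lambda>z. Arg2pi (z / p)"] by blast
  have "\<not> btw p z a" if "z \<in> A" for z
    using a that assms(3,4) by (subst btw_Arg2pi) auto
  then show ?thesis using a by blast
qed

lemma ex_last_ccw:
  assumes "finite A" "A \<noteq> {}" "A \<subseteq> sphere 0 1" "p \<in> sphere 0 1"
  shows "\<exists>a\<in>A. \<forall>z\<in>A. \<not> btw p a z"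
proof -
  obtain a where a: "a \<in> A" "\<forall>z\<in>A. Arg2pi (z / p) \<le> Arg2pi (a / p)"
    using ex_max_on[OF assms(1,2), of "\<lambda>z. Arg2pi (z / p)"] by blast
  have "\<not> btw p a z" if "z \<in> A" for z
    using a that assms(3,4) by (subst btw_Arg2pi) auto
  then show ?thesis using a by blast
qed

lemma ex_other:
  assumes "2 \<le> card S"
  shows "S - {p} \<noteq> {}"
proof
  assume "S - {p} = {}"
  then have "S \<subseteq> {p}" by blast
  then have "card S \<le> card {p}" by (intro card_mono) auto
  then show False using assms by simp
qed

lemma ex_ccw_next:
  assumes "finite S" "S \<subseteq> sphere 0 1" "2 \<le> card S" "p \<in> S"
  shows "\<exists>q. ccw_next S p q"
proof -
  have "p \<in> sphere 0 1" "S - {p} \<subseteq> sphere 0 1" "finite (S - {p})" using assms by auto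
  from ex_first_ccw[OF this(3) ex_other[OF assms(3)] this(2,1)]
  obtain a where a: "a \<in> S - {p}" "\<forall>z\<in>S - {p}. \<not> btw p z a" by blast
  then have "\<forall>z\<in>S. \<not> btw p z a" using btw_distinct by blast
  then have "ccw_next S p a" using a(1) assms(4) unfolding ccw_next_btw[OF assms(2)] by auto
  then show ?thesis ..
qed

lemma ex_ccw_prev:
  assumes "finite S" "S \<subseteq> sphere 0 1" "2 \<le> card S" "p \<in> S"
  shows "\<exists>q. ccw_next S q p"
proof -
  have "p \<in> sphere 0 1" "S - {p} \<subseteq> sphere 0 1" "finite (S - {p})" using assms by auto
  from ex_last_ccw[OF this(3) ex_other[OF assms(3)] this(2,1)]
  obtain a where a: "a \<in> S - {p}" "\<forall>z\<in>S - {p}. \<not> btw p a z" by blast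
  then have "\<forall>z\<in>S. \<not> btw p a z" using btw_distinct by blast
  then have "\<forall>z\<in>S. \<not> btw a z p" unfolding btw_def by blast
  then have "ccw_next S a p" using a(1) assms(4) unfolding ccw_next_btw[OF assms(2)] by auto
  then show ?thesis ..
qed

lemma ccw_next_unique:
  assumes "S \<subseteq> sphere 0 1" "ccw_next S p q" "ccw_next S p q'"
  shows "q = q'"
proof (rule ccontr)
  assume "q \<noteq> q'"
  moreover have "{p, q, q'} \<subseteq> sphere 0 1" "p \<noteq> q" "p \<noteq> q'" "\<not> btw p q q'" "\<not> btw p q' q"
    using assms(2,3) assms(1) unfolding ccw_next_btw[OF assms(1)] by auto
  moreover have "btw q' q p \<Longrightarrow> btw p q' q" by (auto simp: btw_def)
  ultimately show False using btw_total[of p q q'] by blast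
qed

lemma ccw_prev_unique:
  assumes "S \<subseteq> sphere 0 1" "ccw_next S q p" "ccw_next S q' p"
  shows "q = q'"
proof (rule ccontr)
  assume "q \<noteq> q'"
  moreover have "{q, q', p} \<subseteq> sphere 0 1" "q' \<noteq> p" "q \<noteq> p" "\<not> btw q q' p" "\<not> btw q' q p"
    using assms(2,3) assms(1) unfolding ccw_next_btw[OF assms(1)] by auto
  moreover have "btw p q' q \<Longrightarrow> btw q' q p" by (auto simp: btw_def)
  ultimately show False using btw_total[of q q' p] by blast
qed

text \<open>For two points each is the successor of the other, but a third point lies strictly
  inside one of the two arcs. This gives every side of a polygon a definite direction.\<close>

lemma ccw_next_asym:
  assumes "S \<subseteq> sphere 0 1" "3 \<le> card S" "ccw_next S p q"
  shows "\<not> ccw_next S q p"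
proof
  assume qp: "ccw_next S q p"
  have "S \<subseteq> {p, q}"
  proof
    fix z assume "z \<in> S"
    then have "\<not> btw p z q" "\<not> btw q z p" "{p, z, q} \<subseteq> sphere 0 1" "p \<noteq> q"
      using qp assms(1,3) unfolding ccw_next_btw[OF assms(1)] by auto
    then show "z \<in> {p, q}" using btw_total[of p z q] by blast
  qed
  then have "card S \<le> card {p, q}" by (intro card_mono) auto
  also have "\<dots> \<le> 2" by (simp add: card_insert_if)
  finally show False using assms(2) by simp
qed

text \<open>The side in question ends at the first corner met from \<open>z\<close>. Arguments about
  points that are not corners of a region start from the side behind which the point lies.\<close>

lemma ex_ccw_gap:
  assumes "finite R" "R \<subseteq> sphere 0 1" "2 \<le> card R" "z \<in> sphere 0 1" "z \<notin> R"
  shows "\<exists>c d. ccw_next R c d \<and> btw c z d"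
proof -
  have "R \<noteq> {}" using assms(3) by auto
  then obtain d where d: "d \<in> R" "\<forall>y\<in>R. \<not> btw z y d"
    using ex_first_ccw[OF assms(1) _ assms(2,4)] by blast
  obtain c where c: "ccw_next R c d" using ex_ccw_prev[OF assms(1-3) d(1)] by blast
  then have cd: "c \<noteq> d" "c \<in> R" "\<not> btw z c d" using d by (auto dest: ccw_next_neq)
  then have "c \<noteq> z" "z \<noteq> d" "{z, c, d} \<subseteq> sphere 0 1" using d assms by auto
  then have "btw d c z" using cd btw_total[of z c d] by blast
  then have "btw c z d" by (auto simp: btw_def)
  then show ?thesis using c by blast
qed

text \<open>The cross product of \<open>b - a\<close> and \<open>z - a\<close>: positive to the left
  of the line directed from \<open>a\<close> to \<open>b\<close>, negative to the right. It is
  affine in \<open>z\<close>, so its signs at the ends of another chord tell whether that chord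
  meets the line.\<close>

definition chord_side :: "complex \<Rightarrow> complex \<Rightarrow> complex \<Rightarrow> real" where
  "chord_side a b z = Im ((z - a) * cnj (b - a))"

lemma chord_side_affine:
  "chord_side a b ((1 - t) *\<^sub>R c + t *\<^sub>R d) = (1 - t) * chord_side a b c + t * chord_side a b d"
  by (simp add: chord_side_def algebra_simps)

lemma chord_side_ends [simp]: "chord_side a b a = 0" "chord_side a b b = 0"
  by (simp_all add: chord_side_def algebra_simps)

lemma sphere_cis_Arg2pi: "z \<in> sphere 0 1 \<Longrightarrow> z = cis (Arg2pi z)"
  using Arg2pi_eq[of z] by (simp add: cis_conv_exp mult.commute)

lemma cis_diff: "cis x - cis y = 2 * \<i> * of_real (sin ((x - y) / 2)) * cis ((x + y) / 2)"
proof -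
  have "x = (x + y) / 2 + (x - y) / 2" "y = (x + y) / 2 - (x - y) / 2" by (simp_all add: field_simps)
  then have "cis x = cis ((x + y) / 2) * cis ((x - y) / 2)" "cis y = cis ((x + y) / 2) * cis (- ((x - y) / 2))"
    by (metis cis_mult, metis cis_mult diff_conv_add_uminus)
  then have "cis x - cis y = cis ((x + y) / 2) * (cis ((x - y) / 2) - cis (- ((x - y) / 2)))"
    by (simp add: algebra_simps)
  also have "cis ((x - y) / 2) - cis (- ((x - y) / 2)) = 2 * \<i> * of_real (sin ((x - y) / 2))"
    by (simp add: complex_eq_iff)
  finally show ?thesis by (simp add: mult_ac)
qed

text \<open>By \<open>cis_diff\<close> a difference of two unit vectors is a sine of half the angle
  times a vector at the mean argument. The mean arguments combine to \<open>(?z - ?b) / 2\<close>,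
  and the imaginary part supplies the last sine.\<close>

lemma chord_side_sphere:
  assumes "a \<in> sphere 0 1" "b \<in> sphere 0 1" "z \<in> sphere 0 1"
  shows "chord_side a b z = 4 * sin ((Arg2pi z - Arg2pi a) / 2) * sin ((Arg2pi b - Arg2pi a) / 2)
    * sin ((Arg2pi z - Arg2pi b) / 2)"
proof -
  let ?a = "Arg2pi a" and ?b = "Arg2pi b" and ?z = "Arg2pi z"
  have prod: "(2 * \<i> * of_real s * c) * cnj (2 * \<i> * of_real t * d) = of_real (4 * s * t) * (c * cnj d)"
    for s t c d by (simp add: complex_eq_iff algebra_simps)
  have "(z - a) * cnj (b - a) = (cis ?z - cis ?a) * cnj (cis ?b - cis ?a)"
    using assms sphere_cis_Arg2pi by metis
  also have "\<dots> = of_real (4 * sin ((?z - ?a) / 2) * sin ((?b - ?a) / 2)) *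
      (cis ((?z + ?a) / 2) * cis (- ((?b + ?a) / 2)))"
    unfolding cis_diff prod cis_cnj ..
  also have "cis ((?z + ?a) / 2) * cis (- ((?b + ?a) / 2)) = cis ((?z - ?b) / 2)"
    unfolding cis_mult by (rule arg_cong[of _ _ cis]) (simp add: field_simps)
  finally show ?thesis unfolding chord_side_def by (simp add: Im_complex_of_real)
qed

text \<open>Half the difference of two arguments stays strictly between \<open>- pi\<close> and
  \<open>pi\<close>, where the sine has the sign of its argument.\<close>

lemma sgn_sin_half:
  assumes "0 \<le> x" "x < 2 * pi" "0 \<le> y" "y < 2 * pi"
  shows "sgn (sin ((x - y) / 2)) = sgn (x - y)"
proof (cases x y rule: linorder_cases)
  case less
  then have "0 < sin ((y - x) / 2)" using assms by (intro sin_gt_zero) auto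
  moreover have "sin ((x - y) / 2) = - sin ((y - x) / 2)"
    by (metis minus_diff_eq minus_divide_left sin_minus)
  ultimately show ?thesis using less by simp
next
  case greater
  then have "0 < sin ((x - y) / 2)" using assms by (intro sin_gt_zero) auto
  then show ?thesis using greater by simp
qed simp

lemma sgn_chord_side:
  assumes "a \<in> sphere 0 1" "b \<in> sphere 0 1" "z \<in> sphere 0 1"
  shows "sgn (chord_side a b z) =
    sgn (Arg2pi z - Arg2pi a) * sgn (Arg2pi b - Arg2pi a) * sgn (Arg2pi z - Arg2pi b)"
  unfolding chord_side_sphere[OF assms] sgn_mult
  by (simp add: sgn_sin_half Arg2pi_lt_2pi Arg2pi_ge_0)

lemma chord_side_btw:
  assumes "a \<in> sphere 0 1" "b \<in> sphere 0 1" "z \<in> sphere 0 1"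
  shows "chord_side a b z < 0 \<longleftrightarrow> btw a z b" "chord_side a b z > 0 \<longleftrightarrow> btw b z a"
proof -
  have "chord_side a b z < 0 \<longleftrightarrow> sgn (chord_side a b z) = - 1" by (simp add: sgn_if)
  then show "chord_side a b z < 0 \<longleftrightarrow> btw a z b"
    unfolding sgn_chord_side[OF assms] btw_def by (auto simp: sgn_if)
  have "chord_side a b z > 0 \<longleftrightarrow> sgn (chord_side a b z) = 1" by (simp add: sgn_if)
  then show "chord_side a b z > 0 \<longleftrightarrow> btw b z a"
    unfolding sgn_chord_side[OF assms] btw_def by (auto simp: sgn_if)
qed

lemma chord_side_zero:
  assumes "a \<in> sphere 0 1" "b \<in> sphere 0 1" "z \<in> sphere 0 1" "a \<noteq> b" "chord_side a b z = 0"
  shows "z = a \<or> z = b"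
proof (rule ccontr)
  assume "\<not> ?thesis"
  then have "btw a z b \<or> btw b z a" using assms btw_total[of a z b] by auto
  then show False using assms chord_side_btw[of a b z] by auto
qed

text \<open>Both directions rest on \<open>chord_side a b\<close> being affine along the segment
  from \<open>c\<close> to \<open>d\<close>. A common point is a zero, so \<open>c\<close> and
  \<open>d\<close> lie on opposite sides, or both lie on the line and the chords coincide.
  Conversely opposite signs give a zero on the segment, which must also be located between
  \<open>a\<close> and \<open>b\<close>.\<close>

lemma crosses_btw:
  assumes "{a, b, c, d} \<subseteq> sphere 0 1" "a \<noteq> b" "c \<noteq> d" "{a, b} \<noteq> {c, d}"
  shows "crosses {a, b} {c, d} \<longleftrightarrow> btw a c b \<and> btw b d a \<or> btw a d b \<and> btw b c a"
proof
  assume "crosses {a, b} {c, d}"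
  then obtain w where w: "w \<in> closed_segment a b" "w \<in> closed_segment c d" "norm w < 1"
    by (auto simp: crosses_def segment_convex_hull)
  obtain s where s: "w = (1 - s) *\<^sub>R a + s *\<^sub>R b" using w(1) by (auto simp: in_segment)
  obtain t where t: "w = (1 - t) *\<^sub>R c + t *\<^sub>R d" "0 \<le> t" "t \<le> 1" using w(2) by (auto simp: in_segment)
  \<comment> \<open>The ends of the chord have norm 1, whereas \<open>w\<close> lies in the open
    disc.\<close>
  have "t \<noteq> 0" "t \<noteq> 1" using t(1) w(3) assms(1) by auto
  then have t01: "0 < t" "t < 1" using t by auto
  have "chord_side a b w = 0" unfolding s chord_side_affine by simp
  then have eq: "(1 - t) * chord_side a b c + t * chord_side a b d = 0"
    unfolding t chord_side_affine .
  show "btw a c b \<and> btw b d a \<or> btw a d b \<and> btw b c a"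
  proof (cases "chord_side a b c" "0::real" rule: linorder_cases)
    case less
    then have "t * chord_side a b d > 0" using eq t01 by (smt (verit) mult_pos_neg)
    then have "chord_side a b d > 0" using t01 by (simp add: zero_less_mult_iff)
    then show ?thesis using less chord_side_btw[of a b] assms(1) by auto
  next
    case equal
    then have "chord_side a b d = 0" using eq t01 by simp
    then show ?thesis using equal chord_side_zero[of a b] assms by blast
  next
    case greater
    then have "t * chord_side a b d < 0" using eq t01 by (smt (verit) mult_pos_pos)
    then have "chord_side a b d < 0" using t01 by (simp add: mult_less_0_iff)
    then show ?thesis using greater chord_side_btw[of a b] assms(1) by auto
  qed
next
  have main: "crosses {a, b} {c, d}"
    if sub: "{a, b, c, d} \<subseteq> sphere 0 1" and acb: "btw a c b" and bda: "btw b d a" for a b c d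
  proof -
    have neg: "chord_side a b c < 0" and pos: "chord_side a b d > 0"
      using chord_side_btw[of a b] sub acb bda by auto
    have "btw c b d" "btw d a c" using acb bda by (auto simp: btw_def)
    then have neg': "chord_side c d b < 0" and pos': "chord_side c d a > 0"
      using chord_side_btw[of c d] sub by auto
    \<comment> \<open>The zero of an affine function that is negative at \<open>c\<close> and
      positive at \<open>d\<close>.\<close>
    define t where "t = chord_side a b c / (chord_side a b c - chord_side a b d)"
    have t: "0 < t" "t < 1" using neg pos by (auto simp: t_def field_simps)
    define w where "w = (1 - t) *\<^sub>R c + t *\<^sub>R d"
    have w0: "chord_side a b w = 0"
      unfolding w_def chord_side_affine using neg pos by (simp add: t_def field_simps)
    have ab: "b - a \<noteq> 0" "c \<noteq> d" using acb bda btw_distinct[OF acb] \<open>btw c b d\<close> btw_distinct by auto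
    \<comment> \<open>A zero of \<open>chord_side a b\<close> lies on the line through
      \<open>a\<close> and \<open>b\<close>, at a real parameter \<open>s\<close>. The two chords
      then exchange roles: the signs of \<open>a\<close> and \<open>b\<close> relative to the chord
      from \<open>c\<close> to \<open>d\<close> place \<open>s\<close> between 0 and 1.\<close>
    have "Im ((w - a) / (b - a)) = 0"
      using w0 unfolding chord_side_def by (simp add: complex_div_cnj[of "w - a"])
    then have "(w - a) / (b - a) = of_real (Re ((w - a) / (b - a)))" by (simp add: complex_eq_iff)
    then obtain s where s': "w - a = of_real s * (b - a)" using ab by (metis nonzero_eq_divide_eq)
    then have s: "w = (1 - s) *\<^sub>R a + s *\<^sub>R b" by (simp add: scaleR_conv_of_real algebra_simps)
    have "chord_side c d w = 0" unfolding w_def chord_side_affine by simp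
    then have eq: "(1 - s) * chord_side c d a + s * chord_side c d b = 0"
      unfolding s chord_side_affine .
    have "0 \<le> s" using eq pos' neg' by (smt (verit) mult_pos_pos mult_neg_neg)
    moreover have "s \<le> 1" using eq pos' neg' by (smt (verit) mult_pos_neg mult_neg_pos)
    ultimately have "w \<in> closed_segment a b" using s by (auto simp: in_segment)
    moreover have op: "w \<in> open_segment c d" using t ab by (auto simp: in_segment w_def)
    moreover have "norm w < 1"
      using dist_decreases_open_segment[OF op, of 0] sub by auto
    moreover have "w \<in> closed_segment c d" using op by (simp add: open_segment_def)
    ultimately show ?thesis unfolding crosses_def segment_convex_hull by auto
  qed
  assume "btw a c b \<and> btw b d a \<or> btw a d b \<and> btw b c a"
  then show "crosses {a, b} {c, d}"
    using main[of a b c d] main[of a b d c] assms(1) by (auto simp: insert_commute)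
qed

section \<open>Dissections of a polygon\<close>

lemma sides_iff: "{a, b} \<in> sides S \<longleftrightarrow> ccw_next S a b \<or> ccw_next S b a"
  unfolding sides_def by (auto simp: doubleton_eq_iff)

lemma sidesE:
  assumes "e \<in> sides S"
  obtains a b where "e = {a, b}" "ccw_next S a b"
  using assms unfolding sides_def by blast

lemma diagonals_btw:
  assumes "S \<subseteq> sphere 0 1"
  shows "{a, b} \<in> diagonals S \<longleftrightarrow>
    a \<in> S \<and> b \<in> S \<and> a \<noteq> b \<and> (\<exists>x\<in>S. btw a x b) \<and> (\<exists>y\<in>S. btw b y a)"
proof -
  have "{a, b} \<in> diagonals S \<longleftrightarrow> a \<in> S \<and> b \<in> S \<and> a \<noteq> b \<and> {a, b} \<notin> sides S"
    unfolding diagonals_def by (auto simp: doubleton_eq_iff)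
  then show ?thesis unfolding sides_iff ccw_next_btw[OF assms] by blast
qed

lemma diagonalsE:
  assumes "d \<in> diagonals S"
  obtains a b where "d = {a, b}" "a \<in> S" "b \<in> S" "a \<noteq> b"
  using assms unfolding diagonals_def by blast

lemma diagonals_mono:
  assumes "R \<subseteq> S" "S \<subseteq> sphere 0 1"
  shows "diagonals R \<subseteq> diagonals S"
proof
  fix d assume d: "d \<in> diagonals R"
  then obtain a b where "d = {a, b}" by (elim diagonalsE)
  moreover have "R \<subseteq> sphere 0 1" using assms by blast
  ultimately show "d \<in> diagonals S" using d assms diagonals_btw[of R a b] diagonals_btw[of S a b] by auto
qed

lemma btw_cases:
  assumes "{c, d, x} \<subseteq> sphere 0 1" "c \<noteq> d" "\<not> btw c x d"
  shows "x = c \<or> x = d \<or> btw d x c"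
  using btw_total[of c x d] assms by blast

lemma btw_across: "btw a x b \<Longrightarrow> btw b y a \<Longrightarrow> btw x b y"
  by (auto simp: btw_def)

lemma btw_cases_in:
  assumes "S \<subseteq> sphere 0 1" "a \<in> S" "b \<in> S" "x \<in> S" "a \<noteq> b"
  shows "x = a \<or> x = b \<or> btw a x b \<or> btw b x a"
  using btw_cases[of a b x] assms by blast

lemma ccw_next_subset:
  assumes "S \<subseteq> sphere 0 1" "R \<subseteq> S" "ccw_next S a b" "a \<in> R" "b \<in> R"
  shows "ccw_next R a b"
proof -
  have "R \<subseteq> sphere 0 1" using assms by blast
  then show ?thesis using assms ccw_next_btw[of R a b] ccw_next_btw[of S a b] by auto
qed

subsection \<open>Cutting along a chord\<close>

lemma in_cut:
  assumes "S \<subseteq> sphere 0 1" "a \<in> S" "b \<in> S" "a \<noteq> b"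
  shows "z \<in> piece S a b \<longleftrightarrow> z \<in> S \<and> (z = a \<or> z = b \<or> btw a z b)"
proof -
  have "a \<in> sphere 0 1" "b \<in> sphere 0 1" using assms by blast+
  from ccw_arc_btw[OF this assms(4)] show ?thesis using assms(1) by blast
qed

lemma cut_union:
  assumes "S \<subseteq> sphere 0 1" "a \<in> S" "b \<in> S" "a \<noteq> b"
  shows "(piece S a b) \<union> (piece S b a) = S"
    "(piece S a b) \<inter> (piece S b a) = {a, b}"
proof -
  have "z = a \<or> z = b \<or> btw a z b \<or> btw b z a" if "z \<in> S" for z
    using btw_total[of a z b] that assms by blast
  then show "(piece S a b) \<union> (piece S b a) = S"
    using in_cut[OF assms] in_cut[OF assms(1,3,2) assms(4)[symmetric]] by fast
  have "\<not> (btw a z b \<and> btw b z a)" for z using btw_asym by blast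
  then show "(piece S a b) \<inter> (piece S b a) = {a, b}"
    using in_cut[OF assms] in_cut[OF assms(1,3,2) assms(4)[symmetric]] assms(2-4) by fast
qed

lemma card_cut:
  assumes "finite S" "S \<subseteq> sphere 0 1" "a \<in> S" "b \<in> S" "a \<noteq> b"
  shows "card (piece S a b) + card (piece S b a) = card S + 2"
proof -
  have "card (piece S a b) + card (piece S b a) =
      card ((piece S a b) \<union> (piece S b a)) + card ((piece S a b) \<inter> (piece S b a))"
    by (rule card_Un_Int) (use assms(1) in auto)
  then show ?thesis unfolding cut_union[OF assms(2-5)] using assms(5) by simp
qed

text \<open>The two pieces share only \<open>z\<close>, which is counted twice.\<close>

lemma card_cut_split:
  assumes "finite S" "S \<subseteq> sphere 0 1" "x \<in> S" "y \<in> S" "z \<in> S" "btw x z y"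
  shows "card (piece S x z) + card (piece S z y) = card (piece S x y) + 1"
proof -
  have ne: "x \<noteq> z" "z \<noteq> y" "x \<noteq> y" using btw_distinct[OF assms(6)] by auto
  note c = in_cut[OF assms(2,3,5) ne(1), unfolded Int_iff] in_cut[OF assms(2,5,4) ne(2), unfolded Int_iff]
    in_cut[OF assms(2,3,4) ne(3), unfolded Int_iff]
  have u: "(piece S x z) \<union> (piece S z y) = piece S x y"
  proof (rule Set.set_eqI)
    fix w
    have 1: "w = z \<or> btw x w z \<or> btw z w y" if "w \<in> S" "btw x w y"
    proof -
      have "w = z \<or> Arg2pi w \<noteq> Arg2pi z" using that assms(2,5) Arg2pi_inj_sphere[of w z] by blast
      then show ?thesis using that(2) assms(6) by (auto simp: btw_def)
    qed
    have 2: "btw x w y" if "btw x w z \<or> btw z w y" using that assms(6) by (auto simp: btw_def)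
    show "w \<in> (piece S x z) \<union> (piece S z y) \<longleftrightarrow> w \<in> piece S x y"
      unfolding Un_iff Int_iff c using 1 2 assms(3-6) by fast
  qed
  have i: "(piece S x z) \<inter> (piece S z y) = {z}"
  proof (rule Set.set_eqI)
    fix w
    have "\<not> (btw x w z \<and> btw z w y)" "\<not> btw x y z" "\<not> btw z x y"
      using assms(6) by (auto simp: btw_def)
    then show "w \<in> (piece S x z) \<inter> (piece S z y) \<longleftrightarrow> w \<in> {z}"
      unfolding Int_iff c using assms(3-5) ne by fast
  qed
  have "card (piece S x z) + card (piece S z y) =
      card ((piece S x z) \<union> (piece S z y)) + card ((piece S x z) \<inter> (piece S z y))"
    by (rule card_Un_Int) (use assms(1) in auto)
  then show ?thesis unfolding u i by simp
qed

lemma card_cut_next: "ccw_next S x y \<Longrightarrow> card (piece S x y) = 2"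
  by (simp add: ccw_next_def)

text \<open>A point of \<open>S\<close> strictly between consecutive points \<open>c\<close>,
  \<open>d\<close> of the piece is outside the piece, hence on the arc from \<open>b\<close> to
  \<open>a\<close>. As \<open>a\<close> and \<open>b\<close> are in the piece they are not strictly
  inside this gap, so the gap is the whole arc from \<open>b\<close> to \<open>a\<close>.\<close>

lemma ccw_next_cut:
  assumes "S \<subseteq> sphere 0 1" "a \<in> S" "b \<in> S" "a \<noteq> b" "ccw_next (piece S a b) c d"
  shows "ccw_next S c d \<or> c = b \<and> d = a"
proof (rule ccontr)
  assume neg: "\<not> ?thesis"
  have sub: "piece S a b \<subseteq> sphere 0 1" using assms(1) by blast
  note n = assms(5)[unfolded ccw_next_btw[OF sub]]
  note i = in_cut[OF assms(1-4)]
  obtain z where z: "z \<in> S" "btw c z d"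
    using neg n unfolding ccw_next_btw[OF assms(1)] by blast
  have cd: "c = a \<or> c = b \<or> btw a c b" "d = a \<or> d = b \<or> btw a d b"
    using n i by blast+
  have nz: "\<not> btw c a d" "\<not> btw c b d" using n i assms(2,3) by blast+
  have "\<not> (z = a \<or> z = b \<or> btw a z b)" using z n i by blast
  then have "btw b z a" using btw_cases[of a b z] z assms(1-4) by blast
  then show False using z(2) cd nz neg unfolding btw_def by (smt (z3))
qed

lemma sides_cut:
  assumes "S \<subseteq> sphere 0 1" "a \<in> S" "b \<in> S" "a \<noteq> b"
  shows "sides (piece S a b) \<subseteq> insert {a, b} (sides S)"
proof
  fix e assume "e \<in> sides (piece S a b)"
  then obtain c d where e: "e = {c, d}" "ccw_next (piece S a b) c d" by (elim sidesE)
  from ccw_next_cut[OF assms e(2)] show "e \<in> insert {a, b} (sides S)"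
  proof
    assume "ccw_next S c d"
    then show ?thesis using e(1) sides_iff[of c d S] by simp
  next
    assume "c = b \<and> d = a"
    then show ?thesis using e(1) by (simp add: insert_commute)
  qed
qed

lemma card_cut_diagonal:
  assumes "finite S" "S \<subseteq> sphere 0 1" "{a, b} \<in> diagonals S"
  shows "3 \<le> card (piece S a b)" "card (piece S a b) < card S"
proof -
  obtain x y where ab: "a \<in> S" "b \<in> S" "a \<noteq> b" and x: "x \<in> S" "btw a x b" and y: "y \<in> S" "btw b y a"
    using assms(3)[unfolded diagonals_btw[OF assms(2)]] by blast
  note i = in_cut[OF assms(2) ab]
  have "{a, x, b} \<subseteq> piece S a b" using i ab x by blast
  then have "card {a, x, b} \<le> card (piece S a b)" using assms(1) by (intro card_mono) auto
  then show "3 \<le> card (piece S a b)" using btw_distinct[OF x(2)] by simp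
  have "y \<notin> piece S a b" using i y btw_distinct[OF y(2)] btw_asym by blast
  then have "piece S a b \<subset> S" using y by blast
  then show "card (piece S a b) < card S" using assms(1) by (rule psubset_card_mono[rotated])
qed

subsection \<open>Regions\<close>

locale dissection =
  fixes S :: "complex set" and D :: "complex set set"
  assumes finS: "finite S" and onS: "S \<subseteq> sphere 0 1"
    and diag: "D \<subseteq> diagonals S" and nc: "noncrossing D"
begin

abbreviation "E \<equiv> D \<union> sides S"

lemma E_in: "{a, b} \<in> E \<Longrightarrow> a \<in> S \<and> b \<in> S \<and> a \<noteq> b"
  using diag diagonals_btw[OF onS, of a b] sides_iff[of a b S] ccw_next_neq by blast

text \<open>Two crossing chords have points of \<open>S\<close> strictly on both sides of each, so
  neither is a side of \<open>S\<close>; both are then members of \<open>D\<close>, which do not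
  cross.\<close>

lemma E_noncrossing:
  assumes "{c, d} \<in> E" "{e, f} \<in> E" "btw c e d" "btw d f c"
  shows False
proof -
  have S: "c \<in> S" "d \<in> S" "e \<in> S" "f \<in> S" "c \<noteq> d" "e \<noteq> f" using E_in assms by blast+
  have "{c, d} \<notin> sides S"
    using S assms(3,4) unfolding sides_iff ccw_next_btw[OF onS] by blast
  moreover have "btw e d f" "btw f c e" using assms(3,4) by (auto simp: btw_def)
  then have "{e, f} \<notin> sides S"
    using S unfolding sides_iff ccw_next_btw[OF onS] by blast
  ultimately have D: "{c, d} \<in> D" "{e, f} \<in> D" using assms(1,2) by blast+
  have ne: "{c, d} \<noteq> {e, f}" using btw_distinct assms(3) by (auto simp: doubleton_eq_iff)
  have on: "{c, d, e, f} \<subseteq> sphere 0 1" using S onS by blast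
  have "crosses {c, d} {e, f}" using crosses_btw[OF on S(5,6) ne] assms(3,4) by blast
  then show False using pairwiseD[OF nc[unfolded noncrossing_def] D ne] by blast
qed

lemma region_facts:
  assumes "R \<in> regions S D"
  shows "R \<subseteq> S" "finite R" "R \<subseteq> sphere 0 1" "3 \<le> card R" "sides R \<subseteq> E" "diagonals R \<inter> D = {}"
  using assms finS onS unfolding regions_def by (auto intro: finite_subset)

lemma region_side: "R \<in> regions S D \<Longrightarrow> ccw_next R a b \<Longrightarrow> {a, b} \<in> E"
  using region_facts(5)[of R] sides_iff[of a b R] by blast

text \<open>No edge of the dissection separates two corners of a region. If an end \<open>e\<close>
  of the edge is not a corner, it lies behind a side of the region, while \<open>x\<close>,
  \<open>y\<close> and therefore \<open>f\<close> are on the other side, so that the edge crosses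
  this side. If both ends are corners, the edge is a diagonal of the region in \<open>D\<close>,
  against the definition of a region.\<close>

lemma region_noncrossing:
  assumes "R \<in> regions S D" "x \<in> R" "y \<in> R" "{e, f} \<in> E" "btw x e y" "btw y f x"
  shows False
proof -
  note R = region_facts[OF assms(1)]
  have ef: "e \<in> S" "f \<in> S" "e \<noteq> f" using E_in[OF assms(4)] by auto
  have aux: False
    if "e \<notin> R" "x \<in> R" "y \<in> R" "{e, f} \<in> E" "btw x e y" "btw y f x" "e \<in> S" for e f x y
  proof -
    have "e \<in> sphere 0 1" "2 \<le> card R" using that onS R(4) by auto
    from ex_ccw_gap[OF R(2,3) this(2,1) that(1)]
    obtain c g where cg: "ccw_next R c g" "btw c e g" by blast
    then have n: "\<not> btw c x g" "\<not> btw c y g" "c \<in> R" "g \<in> R" "c \<noteq> g"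
      using that(2,3) unfolding ccw_next_btw[OF R(3)] by auto
    have "{c, g, x} \<subseteq> sphere 0 1" "{c, g, y} \<subseteq> sphere 0 1" using n(3,4) that(2,3) R(3) by blast+
    then have "x = c \<or> x = g \<or> btw g x c" "y = c \<or> y = g \<or> btw g y c"
      using btw_cases[OF _ n(5) n(1)] btw_cases[OF _ n(5) n(2)] by auto
    then have "btw g f c" using that(5,6) cg(2) unfolding btw_def by (smt (z3))
    then show False using E_noncrossing[OF region_side[OF assms(1) cg(1)] that(4) cg(2)] by blast
  qed
  show False
  proof (cases "e \<in> R \<and> f \<in> R")
    case True
    have "btw e y f" "btw f x e" using assms(5,6) by (auto simp: btw_def)
    then have "{e, f} \<in> diagonals R" unfolding diagonals_btw[OF R(3)] using True assms(2,3) ef by blast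
    moreover from this have "{e, f} \<in> diagonals S" using diagonals_mono[OF R(1) onS] by blast
    then have "{e, f} \<notin> sides S" by (simp add: diagonals_def)
    ultimately show False using R(6) assms(4) by blast
  next
    case False
    have "{f, e} \<in> E" using assms(4) by (simp add: insert_commute)
    then show False using False aux[of e x y f] aux[of f y x e] assms ef by blast
  qed
qed

text \<open>A corner \<open>z\<close> of \<open>R\<close> missing in \<open>R'\<close> lies behind a
  side of \<open>R'\<close>. This side does not separate \<open>z\<close> from \<open>p\<close> or
  \<open>v\<close>, so both are ends of it; then \<open>R'\<close> has the side in both directions,
  which is impossible with three corners.\<close>

lemma region_unique_aux:
  assumes "R \<in> regions S D" "R' \<in> regions S D" "ccw_next R p v" "ccw_next R' p v"
  shows "R \<subseteq> R'"
proof
  fix z assume z: "z \<in> R"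
  note R = region_facts[OF assms(1)] and R' = region_facts[OF assms(2)]
  show "z \<in> R'"
  proof (rule ccontr)
    assume "z \<notin> R'"
    moreover have "2 \<le> card R'" "z \<in> sphere 0 1" using z R' R by auto
    ultimately obtain c d where cd: "ccw_next R' c d" "btw c z d"
      using ex_ccw_gap[OF R'(2,3)] by blast
    have E: "{c, d} \<in> E" using region_side[OF assms(2) cd(1)] .
    then have E': "{d, c} \<in> E" by (simp add: insert_commute)
    have pv: "p \<in> R" "v \<in> R" "p \<in> R'" "v \<in> R'" "p \<noteq> v" "\<not> btw p z v"
      using assms(3,4) z unfolding ccw_next_btw[OF R(3)] ccw_next_btw[OF R'(3)] by auto
    have aux: "x = c \<or> x = d" if "x \<in> R" "x \<in> R'" for x
    proof (rule ccontr)
      assume "\<not> ?thesis"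
      moreover have "\<not> btw c x d" "c \<noteq> d" "c \<in> R'" "d \<in> R'"
        using cd that unfolding ccw_next_btw[OF R'(3)] by auto
      ultimately have "btw d x c" using btw_cases[of c d x] that(1) R(3) R'(3) by blast
      then have "btw z d x" "btw x c z" using cd(2) by (auto simp: btw_def)
      then show False using region_noncrossing[OF assms(1) z that(1) E'] by blast
    qed
    have "p = c \<or> p = d" "v = c \<or> v = d" using aux pv by blast+
    then have "c = v \<and> d = p" using pv cd(2) by blast
    then show False using ccw_next_asym[OF R'(3,4) cd(1)] assms(4) by blast
  qed
qed

lemma region_unique:
  assumes "R \<in> regions S D" "R' \<in> regions S D" "ccw_next R p v" "ccw_next R' p v"
  shows "R = R'"
  using region_unique_aux[OF assms] region_unique_aux[OF assms(2,1,4,3)] by blast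

text \<open>As long as a diagonal from \<open>D\<close> cuts the polygon, keep the part that
  contains the side from \<open>p\<close> to \<open>v\<close>. Intermediate polygons are not
  regions, but their sides stay in \<open>E\<close>, which is the invariant.\<close>

lemma region_exists_aux:
  assumes "S' \<subseteq> S" "ccw_next S' p v" "sides S' \<subseteq> E" "3 \<le> card S'"
  shows "\<exists>R\<in>regions S D. ccw_next R p v"
  using assms
proof (induction "card S'" arbitrary: S' rule: less_induct)
  case less
  have on: "S' \<subseteq> sphere 0 1" and fin: "finite S'" using less.prems onS finS by (auto intro: finite_subset)
  show ?case
  proof (cases "diagonals S' \<inter> D = {}")
    case True
    then show ?thesis using less.prems unfolding regions_def by blast
  next
    case False
    then obtain d where d: "d \<in> diagonals S'" "d \<in> D" by blast
    obtain a b where dab: "d = {a, b}" using d(1) by (elim diagonalsE)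
    have cut: ?thesis if ab: "{a, b} \<in> diagonals S'" "{a, b} \<in> D" and pv: "p \<in> piece S' a b" "v \<in> piece S' a b" for a b
    proof (rule less.hyps)
      have ab': "a \<in> S'" "b \<in> S'" "a \<noteq> b" using ab(1)[unfolded diagonals_btw[OF on]] by blast+
      show "card (piece S' a b) < card S'" "3 \<le> card (piece S' a b)"
        using card_cut_diagonal[OF fin on ab(1)] by auto
      show "piece S' a b \<subseteq> S" using less.prems by blast
      show "ccw_next (piece S' a b) p v"
        by (rule ccw_next_subset[OF on _ less.prems(2) pv]) blast
      show "sides (piece S' a b) \<subseteq> E" using sides_cut[OF on ab'] ab(2) less.prems(3) by blast
    qed
    have ab: "a \<in> S'" "b \<in> S'" "a \<noteq> b" using d(1)[unfolded dab diagonals_btw[OF on]] by blast+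
    have pv: "p \<in> S'" "v \<in> S'" "p \<noteq> v" "\<not> btw p a v" "\<not> btw p b v"
      using less.prems(2) ab unfolding ccw_next_btw[OF on] by auto
    \<comment> \<open>Neither \<open>a\<close> nor \<open>b\<close> lies strictly between the
      consecutive corners \<open>p\<close> and \<open>v\<close>, so cutting along
      \<open>{a, b}\<close> leaves \<open>p\<close> and \<open>v\<close> in a common part.\<close>
    have "(p = a \<or> p = b \<or> btw a p b) \<and> (v = a \<or> v = b \<or> btw a v b) \<or>
       (p = a \<or> p = b \<or> btw b p a) \<and> (v = a \<or> v = b \<or> btw b v a)"
    proof -
      have "p = a \<or> p = b \<or> btw a p b \<or> btw b p a" "v = a \<or> v = b \<or> btw a v b \<or> btw b v a"
        by (rule btw_cases_in[OF on ab(1,2) pv(1) ab(3)], rule btw_cases_in[OF on ab(1,2) pv(2) ab(3)])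
      moreover have "\<not> (btw a p b \<and> btw b v a)" "\<not> (btw b p a \<and> btw a v b)"
        using pv(4,5) btw_across[of a p b v] btw_across[of b p a v] by blast+
      ultimately show ?thesis by blast
    qed
    then have "p \<in> piece S' a b \<and> v \<in> piece S' a b \<or> p \<in> piece S' b a \<and> v \<in> piece S' b a"
      unfolding in_cut[OF on ab] in_cut[OF on ab(2,1) ab(3)[symmetric]] using pv(1,2) by blast
    moreover have "{b, a} \<in> diagonals S'" "{b, a} \<in> D" using d dab by (simp_all add: insert_commute)
    ultimately show ?thesis using cut[of a b] cut[of b a] d dab by blast
  qed
qed

text \<open>For a diagonal the search begins with the points on the arc from \<open>v\<close> to
  \<open>p\<close>, where the diagonal itself closes the polygon as the side from \<open>p\<close>
  to \<open>v\<close>. The region found is thus the one to the left of the directed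
  diagonal.\<close>

lemma region_exists:
  assumes "3 \<le> card S" "{p, v} \<in> D \<or> ccw_next S p v"
  shows "\<exists>R\<in>regions S D. ccw_next R p v"
proof (cases "ccw_next S p v")
  case True
  then show ?thesis using region_exists_aux[of S p v] assms(1) by blast
next
  case False
  then have pv: "{p, v} \<in> D" "{v, p} \<in> diagonals S" using assms diag by (auto simp: insert_commute)
  have pv': "v \<in> S" "p \<in> S" "v \<noteq> p" using pv(2)[unfolded diagonals_btw[OF onS]] by blast+
  show ?thesis
  proof (rule region_exists_aux)
    show "piece S v p \<subseteq> S" by blast
    show "3 \<le> card (piece S v p)" using card_cut_diagonal[OF finS onS pv(2)] by blast
    show "sides (piece S v p) \<subseteq> E"
      using sides_cut[OF onS pv'] pv(1) by (auto simp: insert_commute)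
    have "piece S v p \<subseteq> sphere 0 1" using onS by blast
    note n = ccw_next_btw[OF this] and i = in_cut[OF onS pv']
    have "\<not> btw p z v" if "z \<in> piece S v p" for z
    proof
      assume z: "btw p z v"
      then have "z \<noteq> v" "z \<noteq> p" "\<not> btw v z p" using btw_distinct[OF z] btw_asym[OF z] by auto
      then show False using that i by blast
    qed
    then show "ccw_next (piece S v p) p v" unfolding n using i pv' by blast
  qed
qed

text \<open>Across a single side of \<open>R\<close> both counts are congruent to 2 modulo
  \<open>m\<close>: the side is an edge of \<open>S\<close>, or a chord in \<open>D\<close>, for
  which this is assumed. Splitting the arc at a corner changes both counts by the same rule.\<close>

lemma region_card_cong:
  fixes m :: nat
  assumes "R \<in> regions S D" "\<And>c d. {c, d} \<in> D \<Longrightarrow> int m dvd int (card (piece S c d)) - 2"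
    and "x \<in> R" "y \<in> R" "x \<noteq> y"
  shows "int m dvd int (card (piece S x y)) - int (card (piece R x y))"
  using assms(3-5)
proof (induction "card (piece R x y)" arbitrary: x y rule: less_induct)
  case less
  note R = region_facts[OF assms(1)]
  show ?case
  proof (cases "ccw_next R x y")
    case True
    then have "{x, y} \<in> E" using region_side[OF assms(1)] by blast
    \<comment> \<open>The direction matters: a side of \<open>S\<close> from \<open>y\<close> to
      \<open>x\<close> would have the arc from \<open>x\<close> to \<open>y\<close> contain all of
      \<open>S\<close>.\<close>
    moreover have "\<not> ccw_next S y x"
      using ccw_next_subset[OF onS R(1), of y x] ccw_next_asym[OF R(3,4) True] less.prems by blast
    ultimately have "{x, y} \<in> D \<or> ccw_next S x y" using sides_iff by blast
    then show ?thesis using assms(2)[of x y] card_cut_next[OF True] card_cut_next[of S x y] by auto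
  next
    case False
    then obtain z where z: "z \<in> R" "btw x z y" using less.prems unfolding ccw_next_btw[OF R(3)] by blast
    have ne: "x \<noteq> z" "z \<noteq> y" using btw_distinct[OF z(2)] by auto
    note sR = card_cut_split[OF R(2,3) less.prems(1,2) z]
    have "x \<in> S" "y \<in> S" "z \<in> S" using less.prems z R by auto
    note sS = card_cut_split[OF finS onS this z(2)]
    have ge: "2 \<le> card (piece R a b)" if "a \<in> R" "b \<in> R" "a \<noteq> b" for a b
    proof -
      have "{a, b} \<subseteq> piece R a b" using in_cut[OF R(3) that] that by blast
      then have "card {a, b} \<le> card (piece R a b)" using R(2) by (intro card_mono) auto
      then show ?thesis using that by simp
    qed
    have lt: "card (piece R x z) < card (piece R x y)" "card (piece R z y) < card (piece R x y)"
      using ge[OF less.prems(1) z(1) ne(1)] ge[OF z(1) less.prems(2) ne(2)] sR by linarith+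
    then have "int m dvd int (card (piece S x z)) - int (card (piece R x z))"
      "int m dvd int (card (piece S z y)) - int (card (piece R z y))"
      using less.hyps[OF lt(1) less.prems(1) z(1) ne(1)] less.hyps[OF lt(2) z(1) less.prems(2) ne(2)] by auto
    then have "int m dvd (int (card (piece S x z)) - int (card (piece R x z))) +
      (int (card (piece S z y)) - int (card (piece R z y)))" by (rule dvd_add)
    moreover have "\<dots> = int (card (piece S x y)) - int (card (piece R x y))"
      using sR sS by linarith
    ultimately show ?thesis by simp
  qed
qed

end

text \<open>Moving the end of the arc to the next corner adds exactly one point, so every count from
  2 up to \<open>card R\<close> occurs.\<close>

lemma ex_cut_card:
  assumes "finite R" "R \<subseteq> sphere 0 1" "x \<in> R" "2 \<le> k" "k \<le> card R"
  shows "\<exists>y\<in>R. y \<noteq> x \<and> card (piece R x y) = k"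
  using assms(4,5)
proof (induction k rule: dec_induct)
  case base
  then obtain y where "ccw_next R x y" using ex_ccw_next[OF assms(1,2) _ assms(3)] by auto
  then show ?case using card_cut_next[of R x y] ccw_next_neq[of R x y] by (intro bexI[of _ y]) auto
next
  case (step k)
  then obtain y where y: "y \<in> R" "y \<noteq> x" "card (piece R x y) = k" by auto
  have "2 \<le> card R" using step by simp
  then obtain z where z: "ccw_next R y z" using ex_ccw_next[OF assms(1,2) _ y(1)] by blast
  then have z': "z \<in> R" "y \<noteq> z" "\<not> btw y x z" using assms(3) unfolding ccw_next_btw[OF assms(2)] by auto
  have "z \<noteq> x"
  proof
    assume "z = x"
    then have "card (piece R x y) + 2 = card R + 2"
      using card_cut[OF assms(1,2,3) y(1)] y(2) card_cut_next[OF z] by auto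
    then show False using y step by simp
  qed
  then have "btw z x y" using btw_cases[of y z x] z' y assms(2,3) by blast
  then have "btw x y z" by (auto simp: btw_def)
  from card_cut_split[OF assms(1,2,3) z'(1) y(1) this]
  show ?case using y z' \<open>z \<noteq> x\<close> card_cut_next[OF z] by (intro bexI[of _ z]) auto
qed

subsection \<open>Maximal dissections into pieces of the right size\<close>

text \<open>The arithmetic form of allowability. Every way of writing \<open>d\<close> as
  \<open>{p, q}\<close> is quantified over, so the condition covers the pieces on both
  sides.\<close>

definition good_diagonals :: "nat \<Rightarrow> complex set \<Rightarrow> complex set set" where
  "good_diagonals m S =
     {d \<in> diagonals S. \<forall>p q. d = {p, q} \<longrightarrow> int m dvd int (card (piece S p q)) - 2}"

text \<open>Cut along one diagonal of \<open>D\<close>: regions of either piece are regions of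
  \<open>S\<close>, and the sizes of the pieces add up to \<open>card S + 2\<close>, so the
  congruences for the pieces add up to the one for \<open>S\<close>.\<close>

lemma card_if_divisible_aux:
  fixes m :: nat
  assumes "finite S" "S \<subseteq> sphere 0 1" "3 \<le> card S" "D \<subseteq> diagonals S" "\<forall>R\<in>regions S D. card R = m + 2"
  shows "int m dvd int (card S) - 2"
  using assms
proof (induction "card S" arbitrary: S D rule: less_induct)
  case less
  show ?case
  proof (cases "D = {}")
    case True
    then have "S \<in> regions S D" using less.prems(3) by (auto simp: regions_def)
    then have "card S = m + 2" using less.prems(5) by blast
    then show ?thesis by simp
  next
    case False
    then obtain d where d: "d \<in> D" by blast
    obtain a b where ab: "d = {a, b}" "a \<in> S" "b \<in> S" "a \<noteq> b" using d less.prems(4) diagonalsE by blast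
    have piece: "int m dvd int (card (piece S a b)) - 2" if "{a, b} \<in> D" "a \<in> S" "b \<in> S" "a \<noteq> b" for a b
    proof (rule less.hyps)
      let ?S = "piece S a b"
      have "{a, b} \<in> diagonals S" using that less.prems(4) by blast
      from card_cut_diagonal[OF less.prems(1,2) this]
      show "card ?S < card S" "3 \<le> card ?S" by auto
      show "finite ?S" "?S \<subseteq> sphere 0 1" using less.prems by auto
      then have on: "?S \<subseteq> sphere 0 1" by blast
      show "D \<inter> diagonals ?S \<subseteq> diagonals ?S" by blast
      show "\<forall>R\<in>regions ?S (D \<inter> diagonals ?S). card R = m + 2"
      proof
        fix R assume R: "R \<in> regions ?S (D \<inter> diagonals ?S)"
        have "diagonals R \<subseteq> diagonals ?S" using R on by (intro diagonals_mono) (auto simp: regions_def)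
        then have "R \<in> regions S D"
          using R sides_cut[OF less.prems(2) that(2-4)] that(1) unfolding regions_def by blast
        then show "card R = m + 2" using less.prems(5) by blast
      qed
    qed
    have "int m dvd (int (card (piece S a b)) - 2) + (int (card (piece S b a)) - 2)"
      using piece[of a b] piece[of b a] d ab by (intro dvd_add) (auto simp: insert_commute)
    moreover have "int (card (piece S a b)) + int (card (piece S b a)) = int (card S) + 2"
      using card_cut[OF less.prems(1,2) ab(2-4)] by linarith
    ultimately show ?thesis by (simp add: algebra_simps)
  qed
qed

text \<open>A region inherits the congruence from \<open>S\<close>, so its size is at least
  \<open>m + 2\<close>. If it were larger, an \<open>(m + 2)\<close>-gon could be cut off inside it.
  The cutting diagonal satisfies the congruence on both sides and crosses no member of
  \<open>D\<close>, so maximality puts it into \<open>D\<close>, although a region has no diagonal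
  in \<open>D\<close>.\<close>

lemma (in dissection) maximal_regions:
  fixes m :: nat
  assumes m: "1 \<le> m" and S: "int m dvd int (card S) - 2"
    and D: "D \<subseteq> good_diagonals m S"
    and max: "\<And>d. d \<in> good_diagonals m S \<Longrightarrow> noncrossing (insert d D) \<Longrightarrow> d \<in> D"
    and R: "R \<in> regions S D"
  shows "card R = m + 2"
proof -
  note RF = region_facts[OF R]
  have Dd: "int m dvd int (card (piece S c d)) - 2" if "{c, d} \<in> D" for c d
    using D that unfolding good_diagonals_def by blast
  note cong = region_card_cong[OF R Dd]
  obtain x where x: "x \<in> R" using RF(4) by fastforce
  obtain y where "ccw_next R x y" using ex_ccw_next[OF RF(2,3) _ x] RF(4) by auto
  then have y: "y \<in> R" "x \<noteq> y" using ccw_next_neq by blast+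
  have "int m dvd int (card (piece S x y)) - int (card (piece R x y))"
    "int m dvd int (card (piece S y x)) - int (card (piece R y x))"
    using cong x y by auto
  \<comment> \<open>Adding the congruences for the two complementary arcs compares
    \<open>card S + 2\<close> with \<open>card R + 2\<close>.\<close>
  then have "int m dvd (int (card S) - 2) - ((int (card (piece S x y)) - int (card (piece R x y))) +
    (int (card (piece S y x)) - int (card (piece R y x))))" 
    by (intro dvd_diff[OF S] dvd_add)
  moreover have "int (card (piece S x y)) + int (card (piece S y x)) = int (card S) + 2"
    "int (card (piece R x y)) + int (card (piece R y x)) = int (card R) + 2"
    using card_cut[OF finS onS subsetD[OF RF(1) x] subsetD[OF RF(1) y(1)] y(2)]
      card_cut[OF RF(2,3) x y] by linarith+
  ultimately have dR: "int m dvd int (card R) - 2" by (simp add: algebra_simps)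
  then have ge: "m + 2 \<le> card R" using zdvd_imp_le[OF dR] RF(4) by linarith
  show ?thesis
  proof (rule ccontr)
    assume "\<not> ?thesis"
    then have gt: "m + 2 < card R" using ge by simp
    \<comment> \<open>The chord from \<open>x\<close> to this \<open>y\<close> cuts off exactly
      \<open>m + 2\<close> corners. It is not a side, since \<open>m + 2 > 2\<close> and more than
      two corners remain on the other arc.\<close>
    obtain y where y: "y \<in> R" "y \<noteq> x" "card (piece R x y) = m + 2"
      using ex_cut_card[OF RF(2,3) x, of "m + 2"] gt by auto
    have sum: "card (piece R x y) + card (piece R y x) = card R + 2"
      using card_cut[OF RF(2,3) x y(1)] y(2) by simp
    have "\<not> ccw_next R x y" using card_cut_next[of R x y] y m by auto
    moreover have "\<not> ccw_next R y x" using card_cut_next[of R y x] y(3) sum gt by auto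
    ultimately have dg: "{x, y} \<in> diagonals R"
      unfolding diagonals_btw[OF RF(3)] using x y(1,2) unfolding ccw_next_btw[OF RF(3)] by blast
    then have dS: "{x, y} \<in> diagonals S" using diagonals_mono[OF RF(1) onS] by blast
    have xyS: "x \<in> S" "y \<in> S" using x y RF(1) by auto
    have 1: "int m dvd int (card (piece S x y)) - 2"
    proof -
      have "int m dvd int (card (piece S x y)) - int (m + 2)" using cong[OF _ x y(1)] y by auto
      then have "int m dvd int (card (piece S x y)) - int (m + 2) + int m" by (rule dvd_add) simp
      then show ?thesis by simp
    qed
    have 2: "int m dvd int (card (piece S y x)) - 2"
    proof -
      have "int m dvd (int (card S) - 2) - (int (card (piece S x y)) - 2)" using S 1 by (rule dvd_diff)
      moreover have "(int (card S) - 2) - (int (card (piece S x y)) - 2) = int (card (piece S y x)) - 2"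
        using card_cut[OF finS onS xyS y(2)[symmetric]] by linarith
      ultimately show ?thesis by metis
    qed
    have good: "{x, y} \<in> good_diagonals m S"
      unfolding good_diagonals_def using dS 1 2 by (auto simp: doubleton_eq_iff)
    have "\<not> crosses {x, y} d" "\<not> crosses d {x, y}" if d: "d \<in> D" "d \<noteq> {x, y}" for d
    proof -
      obtain e f where ef: "d = {e, f}" "e \<in> S" "f \<in> S" "e \<noteq> f" using d diag diagonalsE by blast
      have on: "{x, y, e, f} \<subseteq> sphere 0 1" using ef xyS onS by blast
      have E: "{e, f} \<in> E" "{f, e} \<in> E" using d ef by (auto simp: insert_commute)
      have "\<not> crosses {x, y} {e, f}"
        unfolding crosses_btw[OF on y(2)[symmetric] ef(4) d(2)[unfolded ef(1), symmetric]]
        using region_noncrossing[OF R x y(1) E(1)] region_noncrossing[OF R x y(1) E(2)] by blast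
      then show "\<not> crosses {x, y} d" "\<not> crosses d {x, y}" using ef by (auto simp: crosses_def Int_ac)
    qed
    then have "noncrossing (insert {x, y} D)"
      using nc unfolding noncrossing_def pairwise_insert by blast
    then have "{x, y} \<in> D" using max good by blast
    then show False using dg RF(6) by blast
  qed
qed

text \<open>For the converse, an inclusion-maximal non-crossing set of good diagonals is a
  dissection of the required kind by \<open>maximal_regions\<close>.\<close>

lemma divisible_into_gons_iff:
  fixes m :: nat
  assumes m: "1 \<le> m" and S: "finite S" "S \<subseteq> sphere 0 1" "3 \<le> card S"
  shows "divisible_into_gons (m + 2) S \<longleftrightarrow> int m dvd int (card S) - 2"
proof
  assume "divisible_into_gons (m + 2) S"
  then show "int m dvd int (card S) - 2"
    unfolding divisible_into_gons_def using card_if_divisible_aux[OF S] by blast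
next
  assume dv: "int m dvd int (card S) - 2"
  define F where "F = {D. D \<subseteq> good_diagonals m S \<and> noncrossing D}"
  have "good_diagonals m S \<subseteq> Pow S" unfolding good_diagonals_def diagonals_def by blast
  then have "finite (good_diagonals m S)" using S(1) by (simp add: finite_subset)
  then have "finite F" unfolding F_def by (rule finite_subset[rotated, OF finite_Pow_iff[THEN iffD2]]) blast
  moreover have "{} \<in> F" by (simp add: F_def noncrossing_def)
  ultimately obtain D where D: "D \<in> F" "\<forall>D'\<in>F. D \<subseteq> D' \<longrightarrow> D = D'"
    using finite_has_maximal2[of F "{}"] by blast
  interpret dissection S D
    using S D(1) by unfold_locales (auto simp: F_def good_diagonals_def)
  have "card R = m + 2" if "R \<in> regions S D" for R
  proof (rule maximal_regions[OF m dv _ _ that])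
    show "D \<subseteq> good_diagonals m S" using D by (simp add: F_def)
    fix d assume "d \<in> good_diagonals m S" "noncrossing (insert d D)"
    then have "insert d D \<in> F" using D(1) by (simp add: F_def)
    then show "d \<in> D" using D(2) by blast
  qed
  then show "divisible_into_gons (m + 2) S"
    unfolding divisible_into_gons_def using diag nc by blast
qed

text \<open>With allowable and good diagonals identified, maximality of \<open>T\<close> is the
  maximality required by \<open>maximal_regions\<close>. The congruence for the whole of
  \<open>M\<close> comes from a diagonal in \<open>T\<close>.\<close>

lemma angulation_facts:
  assumes m: "1 \<le> m" and M: "finite M" "M \<subseteq> sphere 0 1" and T: "angulation m M T" "T \<noteq> {}"
  shows "dissection M T" "\<And>R. R \<in> regions M T \<Longrightarrow> card R = m + 2" "3 \<le> card M"
proof -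
  have sub: "T \<subseteq> allowable_diagonals m M" and nc: "noncrossing T"
    and max: "\<And>T'. T \<subseteq> T' \<Longrightarrow> T' \<subseteq> allowable_diagonals m M \<Longrightarrow> noncrossing T' \<Longrightarrow> T' = T"
    using T(1) unfolding angulation_def by blast+
  have ald: "allowable_diagonals m M \<subseteq> diagonals M" unfolding allowable_diagonals_def by blast
  have div: "divisible_into_gons (m + 2) (piece M p q) \<longleftrightarrow> int m dvd int (card (piece M p q)) - 2"
    if "{p, q} \<in> diagonals M" for p q
    using card_cut_diagonal(1)[OF M that] M by (intro divisible_into_gons_iff[OF m]) auto
  have dv: "int m dvd int (card (piece M p q)) - 2"
    if "{p, q} \<in> allowable_diagonals m M" for p q
  proof -
    have "{p, q} \<in> diagonals M" "{q, p} \<in> diagonals M" using that ald by (auto simp: insert_commute)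
    moreover have "divisible_into_gons (m + 2) (piece M p q)"
      using that unfolding allowable_diagonals_def by (auto simp: doubleton_eq_iff)
    ultimately show ?thesis using div by blast
  qed
  have al: "allowable_diagonals m M = good_diagonals m M"
  proof
    show "allowable_diagonals m M \<subseteq> good_diagonals m M"
    proof
      fix d assume d: "d \<in> allowable_diagonals m M"
      have "int m dvd int (card (piece M p q)) - 2" if "d = {p, q}" for p q
        using dv[of p q] d that by simp
      then show "d \<in> good_diagonals m M" using d ald by (auto simp: good_diagonals_def)
    qed
    show "good_diagonals m M \<subseteq> allowable_diagonals m M"
    proof
      fix d assume d: "d \<in> good_diagonals m M"
      then have dg: "d \<in> diagonals M" by (simp add: good_diagonals_def)
      then obtain p q where pq: "d = {p, q}" by (rule diagonalsE)
      then have qp: "d = {q, p}" by (simp add: insert_commute)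
      have "int m dvd int (card (piece M p q)) - 2" "int m dvd int (card (piece M q p)) - 2"
        using d pq qp unfolding good_diagonals_def by blast+
      then have "divisible_into_gons (m + 2) (piece M p q)" "divisible_into_gons (m + 2) (piece M q p)"
        using div[of p q] div[of q p] dg pq qp by simp_all
      then show "d \<in> allowable_diagonals m M"
        unfolding allowable_diagonals_def using dg pq by blast
    qed
  qed
  show dis: "dissection M T" using M sub ald nc by unfold_locales auto
  then interpret dissection M T .
  obtain d where d: "d \<in> T" using T(2) by blast
  then obtain p q where pq: "d = {p, q}" "p \<in> M" "q \<in> M" "p \<noteq> q" using diag diagonalsE by blast
  have dg: "{p, q} \<in> diagonals M" "{p, q} \<in> allowable_diagonals m M" "{q, p} \<in> allowable_diagonals m M"
    using d pq diag sub by (auto simp: insert_commute)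
  show "3 \<le> card M" using card_cut_diagonal[OF M dg(1)] by linarith
  \<comment> \<open>Both pieces at an allowable diagonal have size 2 modulo \<open>m\<close>, and
    together they have \<open>card M + 2\<close> points, the ends being counted twice.\<close>
  have "int m dvd (int (card (piece M p q)) - 2) + (int (card (piece M q p)) - 2)"
    using dv dg by (intro dvd_add) auto
  moreover have "int (card (piece M p q)) + int (card (piece M q p)) = int (card M) + 2"
    using card_cut[OF M pq(2-4)] by linarith
  ultimately have dM: "int m dvd int (card M) - 2" by (simp add: algebra_simps)
  show "card R = m + 2" if "R \<in> regions M T" for R
  proof (rule maximal_regions[OF m dM _ _ that])
    show "T \<subseteq> good_diagonals m M" using sub al by simp
    fix d assume "d \<in> good_diagonals m M" "noncrossing (insert d T)"
    then show "d \<in> T" using max[of "insert d T"] sub al by blast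
  qed
qed

section \<open>Monomial ideals of path algebras\<close>

lemma path_end_append: "path_end Q (path_end Q u a) b = path_end Q u (a @ b)"
  by (simp add: path_end_def)

lemma path_end_Cons: "path_end Q (head Q e) es = path_end Q u (e # es)"
  by (simp add: path_end_def)

lemma is_path_Nil: "is_path Q (u, []) \<longleftrightarrow> u \<in> verts Q"
  using pre_digraph.cas.simps(1)[of Q u u] by (auto simp: is_path_def pre_digraph.awalk_def)

lemma is_path_Cons:
  assumes "wf_digraph Q"
  shows "is_path Q (u, e # p) \<longleftrightarrow> e \<in> arcs Q \<and> tail Q e = u \<and> is_path Q (head Q e, p)"
  using wf_digraph.tail_in_verts[OF assms, of e] wf_digraph.head_in_verts[OF assms, of e]
  by (auto simp: is_path_def pre_digraph.awalk_def pre_digraph.cas.simps)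

lemma is_path_append:
  assumes "wf_digraph Q"
  shows "is_path Q (u, a @ b) \<longleftrightarrow> is_path Q (u, a) \<and> is_path Q (path_end Q u a, b)"
proof (induction a arbitrary: u)
  case Nil
  have "is_path Q (u, b) \<Longrightarrow> u \<in> verts Q" by (auto simp: is_path_def pre_digraph.awalk_def)
  then show ?case by (auto simp: is_path_Nil path_end_def)
next
  case (Cons e a)
  have "path_end Q (head Q e) a = path_end Q u (e # a)" by (rule path_end_Cons)
  then show ?case using Cons[of "head Q e"] by (simp add: is_path_Cons[OF assms])
qed

lemma is_path_end:
  assumes "wf_digraph Q" "is_path Q (u, a)"
  shows "path_end Q u a \<in> verts Q"
  using assms(2) is_path_append[OF assms(1), of u a "[]"] by (simp add: is_path_Nil)

lemma is_path_hd:
  assumes "wf_digraph Q" "p \<noteq> []"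
  shows "is_path Q (tail Q (hd p), p) \<longleftrightarrow>
    set p \<subseteq> arcs Q \<and> (\<forall>i. Suc i < length p \<longrightarrow> head Q (p ! i) = tail Q (p ! Suc i))"
  using assms(2)
proof (induction p rule: list_nonempty_induct)
  case (single x)
  then show ?case
    using wf_digraph.head_in_verts[OF assms(1), of x] by (auto simp: is_path_Cons[OF assms(1)] is_path_Nil)
next
  case (cons x xs)
  have all: "(\<forall>i. Suc i < length (x # xs) \<longrightarrow> P ((x # xs) ! i) ((x # xs) ! Suc i)) \<longleftrightarrow>
      P x (hd xs) \<and> (\<forall>i. Suc i < length xs \<longrightarrow> P (xs ! i) (xs ! Suc i))" for P
    using cons(1) by (auto simp: nth_Cons hd_conv_nth split: nat.splits)
  have "is_path Q (head Q x, xs) \<longleftrightarrow> head Q x = tail Q (hd xs) \<and> is_path Q (tail Q (hd xs), xs)"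
    using cons(1) by (cases xs) (auto simp: is_path_Cons[OF assms(1)])
  then show ?case unfolding all[of "\<lambda>a b. head Q a = tail Q b"] using cons by (auto simp: is_path_Cons[OF assms(1)])
qed

locale path_alg = wf_digraph Q for Q :: "('v, 'a) pre_digraph" +
  fixes A :: "('v \<times> 'a list \<Rightarrow> 'k::field) ring"
  assumes finV: "finite (verts Q)" and A: "A = path_algebra Q"
begin

lemma wfQ: "wf_digraph Q" by unfold_locales

lemma carrier_A: "carrier A = {f. finite {x. f x \<noteq> 0} \<and> (\<forall>x. f x \<noteq> 0 \<longrightarrow> is_path Q x)}"
  and mult_A: "mult A f g (u, p) =
    (\<Sum>i\<le>length p. f (u, take i p) * g (path_end Q u (take i p), drop i p))"
  and one_A: "one A (u, p) = (if u \<in> verts Q \<and> p = [] then 1 else 0)"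
  and zero_A: "zero A = (\<lambda>x. 0)"
  and add_A: "add A f g = (\<lambda>x. f x + g x)"
  by (simp_all add: A path_algebra_def)

lemma mult_support:
  assumes "mult A f g (u, p) \<noteq> 0"
  shows "\<exists>i\<le>length p. f (u, take i p) \<noteq> 0 \<and> g (path_end Q u (take i p), drop i p) \<noteq> 0"
proof (rule ccontr)
  assume "\<not> ?thesis"
  then have "mult A f g (u, p) = 0" unfolding mult_A by (intro sum.neutral) auto
  then show False using assms by simp
qed

lemma mult_closed:
  assumes "f \<in> carrier A" "g \<in> carrier A"
  shows "mult A f g \<in> carrier A"
proof -
  \<comment> \<open>Concatenation of paths. The starting vertex of the second factor is dropped,
    being the end of the first; the support of a product is covered by the image of a finite
    set.\<close>
  let ?F = "\<lambda>((u, a), (v :: 'v, b)). (u :: 'v, a @ b :: 'a list)"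
  have "{x. mult A f g x \<noteq> 0} \<subseteq> ?F ` ({x. f x \<noteq> 0} \<times> {x. g x \<noteq> 0})"
  proof
    fix x assume "x \<in> {x. mult A f g x \<noteq> 0}"
    moreover obtain u p where x: "x = (u, p)" by (cases x)
    ultimately obtain i where "f (u, take i p) \<noteq> 0" "g (path_end Q u (take i p), drop i p) \<noteq> 0"
      using mult_support[of f g u p] by auto
    then have "((u, take i p), (path_end Q u (take i p), drop i p)) \<in> {x. f x \<noteq> 0} \<times> {x. g x \<noteq> 0}" by simp
    from imageI[OF this, of ?F] show "x \<in> ?F ` ({x. f x \<noteq> 0} \<times> {x. g x \<noteq> 0})" by (simp add: x)
  qed
  moreover have "finite (?F ` ({x. f x \<noteq> 0} \<times> {x. g x \<noteq> 0}))"
    using assms by (auto simp: carrier_A)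
  ultimately have "finite {x. mult A f g x \<noteq> 0}" by (rule finite_subset)
  moreover have "is_path Q (u, p)" if nz: "mult A f g (u, p) \<noteq> 0" for u p
  proof -
    obtain i where "f (u, take i p) \<noteq> 0" "g (path_end Q u (take i p), drop i p) \<noteq> 0"
      using mult_support[OF nz] by auto
    then have "is_path Q (u, take i p)" "is_path Q (path_end Q u (take i p), drop i p)"
      using assms by (auto simp: carrier_A)
    then show ?thesis using is_path_append[OF wfQ, of u "take i p" "drop i p"] by simp
  qed
  ultimately show ?thesis by (auto simp: carrier_A)
qed

lemma one_mult:
  assumes "f \<in> carrier A"
  shows "mult A (one A) f = f" "mult A f (one A) = f"
proof -
  have "mult A (one A) f (u, p) = f (u, p)" for u p
  proof -
    have "mult A (one A) f (u, p) = (\<Sum>i\<le>length p. if i = 0 then (if u \<in> verts Q then f (u, p) else 0) else 0)"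
      unfolding mult_A one_A by (intro sum.cong) (auto simp: path_end_def)
    also have "\<dots> = (if u \<in> verts Q then f (u, p) else 0)" by simp
    also have "\<dots> = f (u, p)"
      using assms by (auto simp: carrier_A is_path_def awalk_def split: if_splits)
    finally show ?thesis .
  qed
  then show "mult A (one A) f = f" by auto
  have "mult A f (one A) (u, p) = f (u, p)" for u p
  proof -
    have "mult A f (one A) (u, p) =
        (\<Sum>i\<le>length p. if i = length p then (if path_end Q u p \<in> verts Q then f (u, p) else 0) else 0)"
      unfolding mult_A one_A by (intro sum.cong) auto
    also have "\<dots> = (if path_end Q u p \<in> verts Q then f (u, p) else 0)" by simp
    also have "\<dots> = f (u, p)" using assms is_path_end[OF wfQ, of u p] by (auto simp: carrier_A)
    finally show ?thesis .
  qed
  then show "mult A f (one A) = f" by auto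
qed

text \<open>Both sides sum over all divisions of \<open>p\<close> into three consecutive segments,
  of lengths \<open>j\<close>, \<open>k\<close> and the rest; only the order of summation
  differs.\<close>

lemma mult_assoc: "mult A (mult A f g) h = mult A f (mult A g h)"
proof -
  have "mult A (mult A f g) h (u, p) = mult A f (mult A g h) (u, p)" for u p
  proof -
    define n where "n = length p"
    define F where "F j k = f (u, take j p) * g (path_end Q u (take j p), take k (drop j p)) *
      h (path_end Q u (take (j + k) p), drop (j + k) p)" for j k
    have "mult A (mult A f g) h (u, p) = (\<Sum>i\<le>n. \<Sum>j\<le>i. F j (i - j))"
      unfolding mult_A n_def sum_distrib_right F_def
      by (intro sum.cong) (auto simp: min_def drop_take)
    also have "\<dots> = (\<Sum>(j, k)\<in>{(j, k). j + k \<le> n}. F j k)"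
      by (rule sum.triangle_reindex_eq[symmetric])
    also have "{(j, k). j + k \<le> n} = Sigma {..n} (\<lambda>j. {..n - j})" by auto
    also have "(\<Sum>(j, k)\<in>Sigma {..n} (\<lambda>j. {..n - j}). F j k) = (\<Sum>j\<le>n. \<Sum>k\<le>n - j. F j k)"
      by (rule sum.Sigma[symmetric]) auto
    also have "\<dots> = mult A f (mult A g h) (u, p)"
      unfolding mult_A n_def sum_distrib_left F_def
      by (intro sum.cong) (auto simp: path_end_append take_add add.commute mult.assoc)
    finally show ?thesis .
  qed
  then show ?thesis by auto
qed

lemma add_closed: "f \<in> carrier A \<Longrightarrow> g \<in> carrier A \<Longrightarrow> add A f g \<in> carrier A"
proof -
  assume fg: "f \<in> carrier A" "g \<in> carrier A"
  have "{x. f x + g x \<noteq> 0} \<subseteq> {x. f x \<noteq> 0} \<union> {x. g x \<noteq> 0}" by auto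
  then have "finite {x. f x + g x \<noteq> 0}" using fg by (auto simp: carrier_A intro: finite_subset)
  moreover have "is_path Q x" if "f x + g x \<noteq> 0" for x
  proof -
    have "f x \<noteq> 0 \<or> g x \<noteq> 0" using that by auto
    then show ?thesis using fg by (cases x) (auto simp: carrier_A)
  qed
  ultimately show ?thesis by (simp add: carrier_A add_A)
qed

lemma uminus_closed: "f \<in> carrier A \<Longrightarrow> (\<lambda>x. - f x) \<in> carrier A"
  by (simp add: carrier_A)

lemma ring_A: "ring A"
proof (rule ringI)
  show "abelian_group A"
  proof (rule abelian_groupI)
    fix f g h assume f: "f \<in> carrier A" and "g \<in> carrier A" "h \<in> carrier A"
    show "f \<oplus>\<^bsub>A\<^esub> g \<oplus>\<^bsub>A\<^esub> h = f \<oplus>\<^bsub>A\<^esub> (g \<oplus>\<^bsub>A\<^esub> h)" by (simp add: add_A add.assoc)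
    show "f \<oplus>\<^bsub>A\<^esub> g = g \<oplus>\<^bsub>A\<^esub> f" by (simp add: add_A add.commute)
    show "\<zero>\<^bsub>A\<^esub> \<oplus>\<^bsub>A\<^esub> f = f" by (simp add: add_A zero_A)
    show "\<exists>y\<in>carrier A. y \<oplus>\<^bsub>A\<^esub> f = \<zero>\<^bsub>A\<^esub>"
      using uminus_closed[OF f] by (intro bexI[of _ "\<lambda>x. - f x"]) (auto simp: add_A zero_A)
  next
    show "\<And>f g. f \<in> carrier A \<Longrightarrow> g \<in> carrier A \<Longrightarrow> f \<oplus>\<^bsub>A\<^esub> g \<in> carrier A" by (rule add_closed)
  qed (auto simp: carrier_A zero_A)
  show "monoid A"
  proof (rule monoidI)
    have "{x. \<one>\<^bsub>A\<^esub> x \<noteq> 0} \<subseteq> verts Q \<times> {[]}" by (auto simp: one_A split: if_splits)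
    then have "finite {x. \<one>\<^bsub>A\<^esub> x \<noteq> 0}" using finV by (auto intro: finite_subset)
    then show "\<one>\<^bsub>A\<^esub> \<in> carrier A" by (auto simp: carrier_A one_A is_path_Nil split: if_splits)
  qed (auto simp: mult_closed one_mult mult_assoc)
qed (auto simp: fun_eq_iff mult_A add_A distrib_left distrib_right sum.distrib)

lemma path_elem_closed: "is_path Q x \<Longrightarrow> path_elem x \<in> carrier A"
  by (simp add: carrier_A path_elem_def)

lemma path_elem_mult:
  assumes "v = path_end Q u a"
  shows "mult A (path_elem (u, a)) (path_elem (v, b)) = path_elem (u, a @ b)"
proof -
  have "mult A (path_elem (u, a)) (path_elem (v, b)) (w, p) = path_elem (u, a @ b) (w, p)" for w p
  proof -
    have eq: "path_elem (u, a) (w, take i p) * path_elem (v, b) (path_end Q w (take i p), drop i p) =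
        (if i = length a then (if w = u \<and> p = a @ b then 1 else 0) else (0 :: 'k))" if "i \<le> length p" for i
    proof (cases "w = u \<and> take i p = a \<and> drop i p = b")
      case True
      then have "p = a @ b" by (metis append_take_drop_id)
      moreover have "i = length a" using True that by auto
      ultimately show ?thesis using True assms by (simp add: path_elem_def)
    next
      case False
      then have "\<not> (i = length a \<and> w = u \<and> p = a @ b)" by auto
      then have "(if i = length a then (if w = u \<and> p = a @ b then 1 else 0) else (0 :: 'k)) = 0" by auto
      moreover have "path_elem (u, a) (w, take i p) * path_elem (v, b) (path_end Q w (take i p), drop i p) = (0 :: 'k)"
        using False by (auto simp: path_elem_def)
      ultimately show ?thesis by simp
    qed
    have "mult A (path_elem (u, a)) (path_elem (v, b)) (w, p) =
        (\<Sum>i\<le>length p. if i = length a then (if w = u \<and> p = a @ b then 1 else 0) else 0)"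
      unfolding mult_A using eq by (intro sum.cong) auto
    also have "\<dots> = path_elem (u, a @ b) (w, p)" by (auto simp: path_elem_def)
    finally show ?thesis .
  qed
  then show ?thesis by auto
qed

definition contains_rel :: "('a \<Rightarrow> 'a \<Rightarrow> bool) \<Rightarrow> 'a list \<Rightarrow> bool" where
  "contains_rel r p \<longleftrightarrow> (\<exists>i. Suc i < length p \<and> r (p ! i) (p ! Suc i))"

lemma contains_rel_take: "contains_rel r (take i p) \<Longrightarrow> contains_rel r p"
  unfolding contains_rel_def by auto

lemma contains_rel_drop: "contains_rel r (drop i p) \<Longrightarrow> contains_rel r p"
  unfolding contains_rel_def by (metis add_Suc_right drop_drop length_drop less_diff_conv nth_drop add.commute nat_le_linear drop_all length_0_conv list.size(3) less_zeroE less_imp_le)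

text \<open>A coefficient of a product at \<open>p\<close> comes from divisions of \<open>p\<close>,
  and a relation inside a segment of \<open>p\<close> is one inside \<open>p\<close>. This ideal
  bounds the generated one from above.\<close>

lemma monomial_ideal:
  "ideal {f \<in> carrier A. \<forall>u p. f (u, p) \<noteq> 0 \<longrightarrow> contains_rel r p} A"
proof (rule idealI)
  interpret ring A by (rule ring_A)
  let ?J = "{f \<in> carrier A. \<forall>u p. f (u, p) \<noteq> 0 \<longrightarrow> contains_rel r p}"
  show "ring A" by (rule ring_A)
  show "subgroup ?J (add_monoid A)"
  proof
    show "\<And>f g. f \<in> ?J \<Longrightarrow> g \<in> ?J \<Longrightarrow> f \<otimes>\<^bsub>add_monoid A\<^esub> g \<in> ?J"
      using add_closed by (auto simp: add_A) (metis add.right_neutral)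
    show "\<one>\<^bsub>add_monoid A\<^esub> \<in> ?J" using zero_closed by (auto simp: zero_A)
    show "?J \<subseteq> carrier (add_monoid A)" by auto
    fix f assume f: "f \<in> ?J"
    have "\<ominus>\<^bsub>A\<^esub> f = (\<lambda>x. - f x)"
      using f uminus_closed[of f] by (intro minus_equality) (auto simp: add_A zero_A)
    then show "inv\<^bsub>add_monoid A\<^esub> f \<in> ?J" using f uminus_closed[of f] by (auto simp: a_inv_def)
  qed
  fix f g assume f: "f \<in> ?J" and g: "g \<in> carrier A"
  show "g \<otimes>\<^bsub>A\<^esub> f \<in> ?J" using f g mult_closed[of g f] mult_support[of g f] contains_rel_drop by blast
  show "f \<otimes>\<^bsub>A\<^esub> g \<in> ?J" using f g mult_closed[of f g] mult_support[of f g] contains_rel_take by blast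
qed

context
  fixes r :: "'a \<Rightarrow> 'a \<Rightarrow> bool" and I :: "('v \<times> 'a list \<Rightarrow> 'k) set"
  assumes I: "I = genideal A {path_elem (tail Q \<alpha>, [\<alpha>, \<beta>]) | \<alpha> \<beta>.
    \<alpha> \<in> arcs Q \<and> \<beta> \<in> arcs Q \<and> head Q \<alpha> = tail Q \<beta> \<and> r \<alpha> \<beta>}"
begin

text \<open>The ideal is monomial, so membership of a single path can be read off the path. This
  replaces the ideal by a condition on consecutive arrows in all that follows.\<close>

lemma path_elem_in_ideal_iff:
  assumes "is_path Q (u, p)"
  shows "path_elem (u, p) \<in> I \<longleftrightarrow> contains_rel r p"
proof
  let ?S = "{path_elem (tail Q \<alpha>, [\<alpha>, \<beta>]) | \<alpha> \<beta>.
    \<alpha> \<in> arcs Q \<and> \<beta> \<in> arcs Q \<and> head Q \<alpha> = tail Q \<beta> \<and> r \<alpha> \<beta>} :: ('v \<times> 'a list \<Rightarrow> 'k) set"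
  let ?J = "{f \<in> carrier A. \<forall>u p. f (u, p) \<noteq> 0 \<longrightarrow> contains_rel r p}"
  interpret ring A by (rule ring_A)
  have path2: "is_path Q (tail Q \<alpha>, [\<alpha>, \<beta>])" if "\<alpha> \<in> arcs Q" "\<beta> \<in> arcs Q" "head Q \<alpha> = tail Q \<beta>" for \<alpha> \<beta>
    using that by (auto simp: is_path_Cons[OF wfQ] is_path_Nil)
  have S: "?S \<subseteq> carrier A" using path2 path_elem_closed by blast
  have "?S \<subseteq> ?J"
  proof
    fix f assume "f \<in> ?S"
    then obtain \<alpha> \<beta> where f: "f = path_elem (tail Q \<alpha>, [\<alpha>, \<beta>])" "r \<alpha> \<beta>" "f \<in> carrier A" using S by blast
    have "contains_rel r [\<alpha>, \<beta>]" using f(2) unfolding contains_rel_def by (intro exI[of _ 0]) simp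
    then show "f \<in> ?J" using f by (auto simp: path_elem_def split: if_splits)
  qed
  then have "I \<subseteq> ?J" unfolding I genideal_def using monomial_ideal[of r] by blast
  moreover assume "path_elem (u, p) \<in> I"
  ultimately have "path_elem (u, p) (u, p) \<noteq> (0 :: 'k) \<longrightarrow> contains_rel r p" by blast
  then show "contains_rel r p" by (simp add: path_elem_def)
next
  let ?S = "{path_elem (tail Q \<alpha>, [\<alpha>, \<beta>]) | \<alpha> \<beta>.
    \<alpha> \<in> arcs Q \<and> \<beta> \<in> arcs Q \<and> head Q \<alpha> = tail Q \<beta> \<and> r \<alpha> \<beta>} :: ('v \<times> 'a list \<Rightarrow> 'k) set"
  interpret ring A by (rule ring_A)
  have path2: "is_path Q (tail Q \<alpha>, [\<alpha>, \<beta>])" if "\<alpha> \<in> arcs Q" "\<beta> \<in> arcs Q" "head Q \<alpha> = tail Q \<beta>" for \<alpha> \<beta>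
    using that by (auto simp: is_path_Cons[OF wfQ] is_path_Nil)
  have S: "?S \<subseteq> carrier A" using path2 path_elem_closed by blast
  interpret I: ideal I A unfolding I by (rule genideal_ideal[OF S])
  assume "contains_rel r p"
  then obtain i where i: "Suc i < length p" "r (p ! i) (p ! Suc i)" unfolding contains_rel_def by blast
  \<comment> \<open>Multiplying the generator for the two arrows by the path before them and by the
    path after them gives the whole path.\<close>
  define a \<alpha> \<beta> b where "a = take i p" "\<alpha> = p ! i" "\<beta> = p ! Suc i" "b = drop (Suc (Suc i)) p"
  have p: "p = a @ [\<alpha>, \<beta>] @ b"
    using i(1) unfolding a_\<alpha>_\<beta>_b_def by (simp add: Cons_nth_drop_Suc)
  have a: "is_path Q (u, a)" and ab: "is_path Q (path_end Q u a, [\<alpha>, \<beta>])"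
    and b: "is_path Q (path_end Q u (a @ [\<alpha>, \<beta>]), b)"
    using assms unfolding p is_path_append[OF wfQ] path_end_append by auto
  have t: "tail Q \<alpha> = path_end Q u a" "\<alpha> \<in> arcs Q" "\<beta> \<in> arcs Q" "head Q \<alpha> = tail Q \<beta>"
    using ab by (auto simp: is_path_Cons[OF wfQ])
  have "path_elem (tail Q \<alpha>, [\<alpha>, \<beta>]) \<in> ?S" using t i(2) a_\<alpha>_\<beta>_b_def by blast
  then have "path_elem (tail Q \<alpha>, [\<alpha>, \<beta>]) \<in> I" unfolding I using genideal_self[OF S] by blast
  then have "mult A (path_elem (u, a)) (path_elem (tail Q \<alpha>, [\<alpha>, \<beta>])) \<in> I"
    using I.I_l_closed path_elem_closed[OF a] by blast
  then have "path_elem (u, a @ [\<alpha>, \<beta>]) \<in> I" using path_elem_mult[OF t(1)] by simp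
  then have "mult A (path_elem (u, a @ [\<alpha>, \<beta>])) (path_elem (path_end Q u (a @ [\<alpha>, \<beta>]), b)) \<in> I"
    using I.I_r_closed path_elem_closed[OF b] by blast
  then show "path_elem (u, p) \<in> I" using path_elem_mult[of _ u "a @ [\<alpha>, \<beta>]" b] p by simp
qed

lemma relation_iff:
  assumes "\<alpha> \<in> arcs Q" "\<beta> \<in> arcs Q" "head Q \<alpha> = tail Q \<beta>"
  shows "relation Q I \<alpha> \<beta> \<longleftrightarrow> r \<alpha> \<beta>"
proof -
  have "is_path Q (tail Q \<alpha>, [\<alpha>, \<beta>])" using assms by (auto simp: is_path_Cons[OF wfQ] is_path_Nil)
  from path_elem_in_ideal_iff[OF this] show ?thesis by (auto simp: relation_def contains_rel_def less_Suc_eq)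
qed

lemma permitted_path_iff:
  "permitted_path Q I p \<longleftrightarrow> p \<noteq> [] \<and> set p \<subseteq> arcs Q \<and>
     (\<forall>i. Suc i < length p \<longrightarrow> head Q (p ! i) = tail Q (p ! Suc i) \<and> \<not> r (p ! i) (p ! Suc i))"
proof (cases "p = []")
  case False
  then show ?thesis
    using is_path_hd[OF wfQ False] path_elem_in_ideal_iff[of "tail Q (hd p)" p]
    unfolding permitted_path_def contains_rel_def by blast
qed (simp add: permitted_path_def)

lemma forbidden_path_iff:
  "forbidden_path Q I p \<longleftrightarrow> p \<noteq> [] \<and> set p \<subseteq> arcs Q \<and> distinct p \<and>
     (\<forall>i. Suc i < length p \<longrightarrow> head Q (p ! i) = tail Q (p ! Suc i) \<and> r (p ! i) (p ! Suc i))"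
proof (cases "p = []")
  case False
  have "relation Q I (p ! i) (p ! Suc i) \<longleftrightarrow> r (p ! i) (p ! Suc i)"
    if "set p \<subseteq> arcs Q" "Suc i < length p" "head Q (p ! i) = tail Q (p ! Suc i)" for i
    using that by (intro relation_iff) auto
  then show ?thesis
    using is_path_hd[OF wfQ False] False unfolding forbidden_path_def by blast
qed (simp add: forbidden_path_def)

end

end

section \<open>The quiver of an angulation\<close>

lemma arc_walk:
  assumes "finite R" "R \<subseteq> sphere 0 1" "a \<in> R" "p \<in> R" "a \<noteq> p"
  shows "\<exists>zs. distinct zs \<and> set zs = {z \<in> R. btw a z p} \<and> successively (ccw_next R) (a # zs @ [p])"
  using assms(3,5)
proof (induction "card {z \<in> R. btw a z p}" arbitrary: a rule: less_induct)
  case less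
  show ?case
  proof (cases "{z \<in> R. btw a z p} = {}")
    case True
    then have "ccw_next R a p" using less.prems assms(4) unfolding ccw_next_btw[OF assms(2)] by blast
    then show ?thesis using True by (intro exI[of _ "[]"]) auto
  next
    case False
    have "card {a, p} \<le> card R" using less.prems assms(1,4) by (intro card_mono) auto
    then have "2 \<le> card R" using less.prems by simp
    then obtain b where b: "ccw_next R a b" using ex_ccw_next[OF assms(1,2) _ less.prems(1)] by blast
    then have b': "b \<in> R" "a \<noteq> b" "\<And>z. z \<in> R \<Longrightarrow> \<not> btw a z b"
      unfolding ccw_next_btw[OF assms(2)] by blast+
    obtain z where z: "z \<in> R" "btw a z p" using False by blast
    have "b \<noteq> p" using z b'(3) by blast
    moreover have "\<not> btw a p b" using b'(3) assms(4) by blast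
    ultimately have ab: "btw a b p"
      using btw_cases_in[OF assms(2) less.prems(1) b'(1) assms(4) b'(2)] less.prems(2)
      by (auto simp: btw_rotate[of b p a] btw_rotate[of p a b])
    have eq: "{z \<in> R. btw a z p} = insert b {z \<in> R. btw b z p}" "b \<notin> {z \<in> R. btw b z p}"
    proof -
      have "btw b z p" if "z \<in> R" "btw a z p" "z \<noteq> b" for z
      proof -
        have "btw b z a" using btw_cases_in[OF assms(2) less.prems(1) b'(1) that(1) b'(2)] that b'(3) btw_distinct[OF that(2)] by blast
        then show ?thesis using that(2) ab by (auto simp: btw_def)
      qed
      moreover have "btw a z p" if "btw b z p" for z using that ab by (auto simp: btw_def)
      ultimately show "{z \<in> R. btw a z p} = insert b {z \<in> R. btw b z p}" using ab b'(1) by blast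
      show "b \<notin> {z \<in> R. btw b z p}" using btw_distinct by blast
    qed
    have "card {z \<in> R. btw b z p} < card {z \<in> R. btw a z p}"
      unfolding eq(1) using eq(2) assms(1) by simp
    from less.hyps[OF this b'(1) \<open>b \<noteq> p\<close>] obtain zs where
      zs: "distinct zs" "set zs = {z \<in> R. btw b z p}" "successively (ccw_next R) (b # zs @ [p])" by blast
    show ?thesis
      using zs eq b by (intro exI[of _ "b # zs"]) auto
  qed
qed

lemma successively_functional_prefix:
  assumes "successively r l" "successively r l'" "l \<noteq> []" "l' \<noteq> []" "hd l = hd l'" "length l \<le> length l'"
    and "\<And>a b c. a \<in> set l \<Longrightarrow> b \<in> set l \<Longrightarrow> c \<in> set l' \<Longrightarrow> r a b \<Longrightarrow> r a c \<Longrightarrow> b = c"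
  shows "l = take (length l) l'"
proof (rule nth_equalityI)
  show "length l = length (take (length l) l')" using assms(6) by simp
  fix i assume "i < length l"
  then show "l ! i = take (length l) l' ! i"
  proof (induction i)
    case 0
    then show ?case using assms(3-5) by (simp add: hd_conv_nth)
  next
    case (Suc i)
    then have eq: "l ! i = l' ! i" by simp
    have "r (l ! i) (l ! Suc i)" using assms(1) Suc.prems by (simp add: successively_conv_nth)
    moreover have "r (l ! i) (l' ! Suc i)"
      using assms(2,6) Suc.prems unfolding eq by (simp add: successively_conv_nth)
    ultimately have "l ! Suc i = l' ! Suc i"
      using assms(6,7) Suc.prems by (meson Suc_lessD nth_mem order_less_le_trans)
    then show ?case using Suc.prems by simp
  qed
qed

text \<open>A functional step relation leaves no choice after the head, and a proper prefix of a
  chain could be prolonged. Threads are recovered from their first or last arrow in this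
  way.\<close>

lemma successively_maximal_unique:
  assumes "successively r l" "successively r l'" "l \<noteq> []" "l' \<noteq> []" "hd l = hd l'"
    and "\<And>a b c. a \<in> A \<Longrightarrow> b \<in> A \<Longrightarrow> c \<in> A \<Longrightarrow> r a b \<Longrightarrow> r a c \<Longrightarrow> b = c"
    and "set l \<subseteq> A" "set l' \<subseteq> A" "\<And>b. b \<in> A \<Longrightarrow> \<not> r (last l) b" "\<And>b. b \<in> A \<Longrightarrow> \<not> r (last l') b"
  shows "l = l'"
proof -
  have aux: "l = l'"
    if "successively r l" "successively r l'" "l \<noteq> []" "l' \<noteq> []" "hd l = hd l'" "set l \<subseteq> A" "set l' \<subseteq> A"
      "\<And>b. b \<in> A \<Longrightarrow> \<not> r (last l) b" "length l \<le> length l'" for l l'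
  proof -
    have t: "l = take (length l) l'"
    proof (rule successively_functional_prefix[OF that(1-5,9)])
      show "b = c" if "a \<in> set l" "b \<in> set l" "c \<in> set l'" "r a b" "r a c" for a b c
        using that assms(6) \<open>set l \<subseteq> A\<close> \<open>set l' \<subseteq> A\<close> by blast
    qed
    have "\<not> length l < length l'"
    proof
      assume lt: "length l < length l'"
      define k where "k = length l - 1"
      have k: "Suc k < length l'" "k < length l" using lt that(3) by (cases l; simp add: k_def)+
      then have "r (l' ! k) (l' ! Suc k)" using that(2) by (simp add: successively_conv_nth)
      moreover have "l' ! k = last l" using t k that(3) by (metis k_def last_conv_nth nth_take)
      moreover have "l' ! Suc k \<in> A" using k(1) that(7) by (meson nth_mem subsetD)
      ultimately show False using that(8) by metis
    qed
    then show ?thesis using t that(9) by (metis nat_less_le take_all_iff order_refl le_neq_implies_less)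
  qed
  show ?thesis
  proof (cases "length l \<le> length l'")
    case True
    show ?thesis by (rule aux[OF assms(1-5,7,8,9) True])
  next
    case False
    have "l' = l" by (rule aux[OF assms(2,1,4,3) assms(5)[symmetric] assms(8,7,10)]) (use False in auto)
    then show ?thesis by simp
  qed
qed

lemma ex_maximal_chain:
  fixes f :: "'a \<Rightarrow> nat"
  assumes "a \<in> A" "\<And>x y. x \<in> A \<Longrightarrow> y \<in> A \<Longrightarrow> r x y \<Longrightarrow> f y < f x"
  shows "\<exists>l. l \<noteq> [] \<and> hd l = a \<and> set l \<subseteq> A \<and> successively r l \<and> (\<forall>b\<in>A. \<not> r (last l) b)"
  using assms(1)
proof (induction "f a" arbitrary: a rule: less_induct)
  case less
  show ?case
  proof (cases "\<exists>b\<in>A. r a b")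
    case True
    then obtain b where b: "b \<in> A" "r a b" by blast
    from less.hyps[OF assms(2)[OF less.prems b] b(1)] obtain l where
      "l \<noteq> []" "hd l = b" "set l \<subseteq> A" "successively r l" "\<forall>b\<in>A. \<not> r (last l) b" by blast
    then show ?thesis using b less.prems by (intro exI[of _ "a # l"]) (auto simp: successively_Cons)
  next
    case False
    then show ?thesis using less.prems by (intro exI[of _ "[a]"]) auto
  qed
qed

text \<open>The polygon \<open>R'\<close> is not mentioned, because the directed side from
  \<open>v\<close> to \<open>p\<close> already determines it.\<close>

fun around_point :: "corner \<Rightarrow> corner \<Rightarrow> bool" where
  "around_point (R, u, p, v) (R', u', p', v') \<longleftrightarrow> p' = p \<and> u' = v"

fun around_region :: "corner \<Rightarrow> corner \<Rightarrow> bool" where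
  "around_region (R, u, p, v) (R', u', p', v') \<longleftrightarrow> R' = R \<and> u' = p \<and> p' = v"

text \<open>Connectedness of a digraph is strong connectedness of its symmetrisation, so a non-empty
  set of vertices that no arrow enters or leaves is everything.\<close>

lemma connected_closed_set:
  assumes con: "Digraph_Component.connected Q" and "B \<subseteq> verts Q" "B \<noteq> {}"
    and "\<And>e. e \<in> arcs Q \<Longrightarrow> tail Q e \<in> B \<longleftrightarrow> head Q e \<in> B"
  shows "B = verts Q"
proof -
  obtain b where b: "b \<in> B" using assms(3) by blast
  have "x \<in> B" if "x \<in> verts Q" for x
  proof -
    have "b \<rightarrow>\<^sup>*\<^bsub>mk_symmetric Q\<^esub> x"
      using con that b assms(2) unfolding connected_def strongly_connected_def by auto
    then have "(b, x) \<in> rtrancl_on (verts (mk_symmetric Q)) (arcs_ends (mk_symmetric Q))"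
      by (simp add: reachable_def)
    then show ?thesis using b
    proof (induction rule: rtrancl_on.induct)
      case (rtrancl_on_into_rtrancl_on u v w)
      then have "(v, w) \<in> parcs (mk_symmetric Q)" by (simp add: arcs_ends_def arc_to_ends_def)
      then show ?case using assms(4) rtrancl_on_into_rtrancl_on by (auto simp: parcs_mk_symmetric)
    qed
  qed
  then show ?thesis using assms(2) by blast
qed

section \<open>Corners of the polygons as arrows, and their compositions\<close>

locale polygon_angulation = dissection M T for M T +
  fixes m :: nat and Q
  assumes m: "1 \<le> m" and card_region: "\<And>R. R \<in> regions M T \<Longrightarrow> card R = m + 2"
    and T_ne: "T \<noteq> {}" and card_M: "3 \<le> card M"
    and Q: "Q = angulation_quiver m M T"
begin

lemma gons_eq: "gons m M T = regions M T"
  using card_region by (auto simp: gons_def)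

lemma verts_Q [simp]: "verts Q = T" and tail_Q [simp]: "tail Q (R, u, p, v) = {u, p}"
  and head_Q [simp]: "head Q (R, u, p, v) = {p, v}"
  by (simp_all add: Q angulation_quiver_def)

lemma arcs_Q: "(R, u, p, v) \<in> arcs Q \<longleftrightarrow>
    R \<in> regions M T \<and> ccw_next R u p \<and> ccw_next R p v \<and> {u, p} \<in> T \<and> {p, v} \<in> T"
  by (simp add: Q angulation_quiver_def gons_eq)

lemma wf_Q: "wf_digraph Q"
  by unfold_locales (auto simp: arcs_Q)

lemma finite_T: "finite T"
proof -
  have "T \<subseteq> Pow M" using diag unfolding diagonals_def by blast
  then show ?thesis using finS by (auto intro: finite_subset)
qed

lemma T_in: "{a, b} \<in> T \<Longrightarrow> a \<in> M \<and> b \<in> M \<and> a \<noteq> b"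
  using E_in[of a b] by blast

lemma T_E: "{a, b} \<in> T \<Longrightarrow> {a, b} \<in> E \<and> {b, a} \<in> E \<and> {b, a} \<in> T"
  by (simp add: insert_commute)

lemma T_elem:
  assumes "e \<in> T" obtains a b where "e = {a, b}" "a \<noteq> b" "a \<in> M" "b \<in> M"
  using assms diag diagonalsE by blast

lemma arc_points:
  assumes "(R, u, p, v) \<in> arcs Q"
  shows "u \<noteq> v" "u \<noteq> p" "p \<noteq> v" "btw p v u" "u \<in> M" "p \<in> M" "v \<in> M"
proof -
  note a = assms[unfolded arcs_Q]
  then have R: "R \<subseteq> sphere 0 1" "3 \<le> card R" and n: "ccw_next R u p" "ccw_next R p v" using region_facts by blast+
  show uv: "u \<noteq> v" using ccw_next_asym[OF R n(1)] n(2) by blast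
  show up: "u \<noteq> p" "p \<noteq> v" using n ccw_next_neq by blast+
  have "u \<in> R" "p \<in> R" "v \<in> R" "\<not> btw p u v" using n unfolding ccw_next_btw[OF R(1)] by auto
  then have "btw v u p" using btw_cases_in[OF R(1), of p v u] uv up by blast
  then show "btw p v u" by (auto simp: btw_def)
  show "u \<in> M" "p \<in> M" "v \<in> M" using T_in a by blast+
qed

lemma arc_eq_out:
  assumes "(R, u, p, v) \<in> arcs Q" "(R', u', p, v) \<in> arcs Q"
  shows "R = R' \<and> u = u'"
proof -
  have "R = R'" using assms region_unique[of R R' p v] unfolding arcs_Q by blast
  then show ?thesis using assms ccw_prev_unique[of R u p u'] region_facts(3)[of R] unfolding arcs_Q by blast
qed

lemma arc_eq_in:
  assumes "(R, u, p, v) \<in> arcs Q" "(R', u, p, v') \<in> arcs Q"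
  shows "R = R' \<and> v = v'"
proof -
  have "R = R'" using assms region_unique[of R R' u p] unfolding arcs_Q by blast
  then show ?thesis using assms ccw_next_unique[of R p v v'] region_facts(3)[of R] unfolding arcs_Q by blast
qed

text \<open>The common diagonal \<open>{p, v}\<close> is matched with \<open>{u', p'}\<close> in one
  of two ways. Matched in the same direction it is a side of one polygon only, by
  \<open>region_unique\<close>; matched in reverse, both corners are at \<open>p\<close>, and a
  point does not form a side with itself.\<close>

lemma composable_cases:
  assumes "\<alpha> \<in> arcs Q" "\<beta> \<in> arcs Q" "head Q \<alpha> = tail Q \<beta>"
  shows "neighbouring_corners \<alpha> \<beta> \<longleftrightarrow> around_region \<alpha> \<beta>" "\<not> neighbouring_corners \<alpha> \<beta> \<longleftrightarrow> around_point \<alpha> \<beta>"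
proof -
  obtain R u p v R' u' p' v' where ab: "\<alpha> = (R, u, p, v)" "\<beta> = (R', u', p', v')" by (metis prod_cases4)
  have a: "(R, u, p, v) \<in> arcs Q" "(R', u', p', v') \<in> arcs Q" using assms ab by auto
  have "{p, v} = {u', p'}" using assms(3) ab by simp
  then consider "p' = v" "u' = p" | "p' = p" "u' = v" by (auto simp: doubleton_eq_iff)
  then have "(neighbouring_corners \<alpha> \<beta> \<longleftrightarrow> around_region \<alpha> \<beta>) \<and> (\<not> neighbouring_corners \<alpha> \<beta> \<longleftrightarrow> around_point \<alpha> \<beta>)"
  proof cases
    case 1
    have "R = R'" using a region_unique[of R R' p v] unfolding 1 arcs_Q by blast
    moreover have "{p, v} \<in> sides R" using a(1) unfolding arcs_Q sides_iff by blast
    ultimately show ?thesis using arc_points(3)[OF a(1)] by (simp add: ab 1 neighbouring_corners_def)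
  next
    case 2
    have "{p, p} \<notin> sides R" using sides_iff[of p p R] ccw_next_neq by auto
    then show ?thesis using arc_points(3)[OF a(1)] by (auto simp: ab 2 neighbouring_corners_def)
  qed
  then show "neighbouring_corners \<alpha> \<beta> \<longleftrightarrow> around_region \<alpha> \<beta>" "\<not> neighbouring_corners \<alpha> \<beta> \<longleftrightarrow> around_point \<alpha> \<beta>" by auto
qed

lemma composable_if:
  "around_region \<alpha> \<beta> \<Longrightarrow> head Q \<alpha> = tail Q \<beta>" "around_point \<alpha> \<beta> \<Longrightarrow> head Q \<alpha> = tail Q \<beta>"
  by (cases \<alpha>; cases \<beta>; auto simp: insert_commute)+

section \<open>The fan of diagonals at a marked point\<close>

definition nbs :: "complex \<Rightarrow> complex set" where "nbs p = {x. {p, x} \<in> T}"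

lemma nbs_sub: "nbs p \<subseteq> M" "finite (nbs p)" "p \<notin> nbs p" "nbs p \<subseteq> sphere 0 1"
proof -
  show 1: "nbs p \<subseteq> M" using T_in unfolding nbs_def by blast
  show "finite (nbs p)" using 1 finS finite_subset by blast
  show "nbs p \<subseteq> sphere 0 1" using 1 onS by blast
  show "p \<notin> nbs p" using T_in[of p p] unfolding nbs_def by blast
qed

lemma nbs_sym: "x \<in> nbs p \<longleftrightarrow> p \<in> nbs x"
  by (simp add: nbs_def insert_commute)

definition MT :: "complex set" where "MT = incident_points M T"

lemma MT_iff: "p \<in> MT \<longleftrightarrow> nbs p \<noteq> {}"
proof
  assume "p \<in> MT"
  then obtain e where "e \<in> T" "p \<in> e" unfolding MT_def incident_points_def by blast
  moreover obtain a b where "e = {a, b}" using T_elem[OF \<open>e \<in> T\<close>] by blast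
  ultimately have "{p, a} \<in> T \<or> {p, b} \<in> T" by (auto simp: insert_commute)
  then show "nbs p \<noteq> {}" unfolding nbs_def by blast
next
  assume "nbs p \<noteq> {}"
  then obtain x where "{p, x} \<in> T" unfolding nbs_def by blast
  then show "p \<in> MT" using T_in[of p x] unfolding MT_def incident_points_def by blast
qed

lemma MT_sub: "MT \<subseteq> M" "finite MT" "MT \<subseteq> sphere 0 1"
  unfolding MT_def incident_points_def using finS onS by auto

lemma card_MT: "2 \<le> card MT"
proof -
  obtain e where e: "e \<in> T" using T_ne by blast
  then obtain a b where ab: "e = {a, b}" "a \<noteq> b" by (rule T_elem)
  then have "a \<in> nbs b" "b \<in> nbs a" using e by (auto simp: nbs_def insert_commute)
  then have "{a, b} \<subseteq> MT" using MT_iff by blast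
  then have "card {a, b} \<le> card MT" using MT_sub by (intro card_mono) auto
  then show ?thesis using ab by simp
qed

text \<open>The order is counter-clockwise from \<open>p\<close>, whereas an arrow
  \<open>(R, u, p, v)\<close> leads from the later neighbour \<open>u\<close> to the earlier
  \<open>v\<close>. So the permitted thread at \<open>p\<close> runs from \<open>last_nb p\<close>
  down to \<open>first_nb p\<close>.\<close>

definition first_nb :: "complex \<Rightarrow> complex" where
  "first_nb p = (SOME v. v \<in> nbs p \<and> (\<forall>z\<in>nbs p. \<not> btw p z v))"

definition last_nb :: "complex \<Rightarrow> complex" where
  "last_nb p = (SOME v. v \<in> nbs p \<and> (\<forall>z\<in>nbs p. \<not> btw p v z))"

lemma first_nb:
  assumes "p \<in> MT"
  shows "first_nb p \<in> nbs p" "z \<in> nbs p \<Longrightarrow> \<not> btw p z (first_nb p)"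
proof -
  have "p \<in> sphere 0 1" "nbs p \<noteq> {}" using assms MT_sub MT_iff by blast+
  then have "\<exists>v. v \<in> nbs p \<and> (\<forall>z\<in>nbs p. \<not> btw p z v)"
    using ex_first_ccw[OF nbs_sub(2) _ nbs_sub(4)] by blast
  from someI_ex[OF this] show "first_nb p \<in> nbs p" "z \<in> nbs p \<Longrightarrow> \<not> btw p z (first_nb p)"
    unfolding first_nb_def by blast+
qed

lemma last_nb:
  assumes "p \<in> MT"
  shows "last_nb p \<in> nbs p" "z \<in> nbs p \<Longrightarrow> \<not> btw p (last_nb p) z"
proof -
  have "p \<in> sphere 0 1" "nbs p \<noteq> {}" using assms MT_sub MT_iff by blast+
  then have "\<exists>v. v \<in> nbs p \<and> (\<forall>z\<in>nbs p. \<not> btw p v z)"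
    using ex_last_ccw[OF nbs_sub(2) _ nbs_sub(4)] by blast
  from someI_ex[OF this] show "last_nb p \<in> nbs p" "z \<in> nbs p \<Longrightarrow> \<not> btw p (last_nb p) z"
    unfolding last_nb_def by blast+
qed

lemma nbs_total:
  assumes "x \<in> nbs p" "y \<in> nbs p" "x \<noteq> y"
  shows "btw p x y \<or> btw p y x"
proof -
  have "p \<in> M" "x \<in> M" "y \<in> M" "p \<noteq> x" "p \<noteq> y"
    using assms(1,2) nbs_sub(1,3) nbs_sym by blast+
  then show ?thesis using btw_cases_in[OF onS, of p y x] assms(3) by (auto simp: btw_rotate)
qed

text \<open>An edge at \<open>p\<close> pointing into the angle of \<open>R\<close> would separate
  the adjacent corners \<open>u\<close> and \<open>v\<close>.\<close>

lemma corner_empty: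
  assumes "R \<in> regions M T" "ccw_next R u p" "ccw_next R p v" "{p, z} \<in> E" "btw p v z" "btw p z u"
  shows False
proof -
  have "v \<in> R" "u \<in> R" "{z, p} \<in> E" using assms(2-4) by (auto dest: ccw_next_neq simp: insert_commute)
  moreover have "btw v z u" "btw u p v" using assms(5,6) by (auto simp: btw_def)
  ultimately show False using region_noncrossing[OF assms(1)] by blast
qed

text \<open>Take the region with side from \<open>p\<close> to \<open>v\<close> and its corner
  \<open>w\<close> before \<open>p\<close>. If \<open>u\<close> came first, the diagonal to
  \<open>u\<close> would enter the angle of the region. If \<open>w\<close> came first,
  \<open>{w, p}\<close> would not be in \<open>T\<close>, hence be a side of \<open>M\<close>, yet
  \<open>u\<close> and \<open>v\<close> lie on different sides of it.\<close>

lemma arc_exists: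
  assumes "u \<in> nbs p" "v \<in> nbs p" "btw p v u" "\<And>z. z \<in> nbs p \<Longrightarrow> \<not> (btw p v z \<and> btw p z u)"
  shows "\<exists>R. (R, u, p, v) \<in> arcs Q"
proof -
  have T: "{p, v} \<in> T" "{u, p} \<in> T" using assms(1,2) by (auto simp: nbs_def insert_commute)
  have M: "p \<in> M" "u \<in> M" "v \<in> M" using T T_in by blast+
  obtain R where R: "R \<in> regions M T" "ccw_next R p v" using region_exists[OF card_M] T(1) by blast
  note RF = region_facts[OF R(1)]
  have pR: "p \<in> R" "v \<in> R" "p \<noteq> v" using R(2) ccw_next_neq by blast+
  obtain w where w: "ccw_next R w p" using ex_ccw_prev[OF RF(2,3) _ pR(1)] RF(4) by auto
  then have wR: "w \<in> R" "w \<noteq> p" using ccw_next_neq by blast+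
  then have wM: "w \<in> M" using RF(1) by blast
  have "w \<noteq> v" using ccw_next_asym[OF RF(3,4) R(2)] w by blast
  moreover have "\<not> btw p w v" using R(2) wR unfolding ccw_next_btw[OF RF(3)] by blast
  ultimately have "btw v w p" using btw_cases_in[OF RF(3) pR(1,2) wR(1) pR(3)] wR(2) by blast
  then have pvw: "btw p v w" by (auto simp: btw_def)
  have "w = u"
  proof (rule ccontr)
    assume ne: "w \<noteq> u"
    have "u \<noteq> p" using T(2) T_in by blast
    then consider "btw p u w" | "btw p w u"
      using btw_cases_in[OF onS M(1) wM M(2)] wR(2) ne by (auto simp: btw_rotate)
    then show False
    proof cases
      case 1
      have "{p, u} \<in> E" using T(2) by (simp add: insert_commute)
      then show False using corner_empty[OF R(1) w R(2) _ assms(3) 1] by blast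
    next
      case 2
      have "{w, p} \<in> E" using region_side[OF R(1) w] .
      moreover have "w \<notin> nbs p" using assms(4) pvw 2 by blast
      then have "{w, p} \<notin> T" by (simp add: nbs_def insert_commute)
      ultimately have "ccw_next M w p \<or> ccw_next M p w" using sides_iff by blast
      moreover have "btw w u p" using 2 by (auto simp: btw_def)
      ultimately show False using M pvw unfolding ccw_next_btw[OF onS] by blast
    qed
  qed
  then show ?thesis using R w T by (auto simp: arcs_Q)
qed

lemma arc_before:
  assumes "v \<in> nbs p" "v \<noteq> last_nb p"
  shows "\<exists>R u. (R, u, p, v) \<in> arcs Q"
proof -
  have p: "p \<in> MT" using assms(1) MT_iff by blast
  note x = last_nb[OF p]
  let ?A = "{z \<in> nbs p. btw p v z}"
  have "btw p v (last_nb p)" using nbs_total[OF assms(1) x(1) assms(2)] x(2)[OF assms(1)] by blast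
  then have ne: "?A \<noteq> {}" using x(1) by blast
  have "finite ?A" "?A \<subseteq> sphere 0 1" "p \<in> sphere 0 1"
    using nbs_sub(2,4)[of p] subsetD[OF MT_sub(3) p] by auto
  from ex_first_ccw[OF this(1) ne this(2,3)] obtain u where
    u: "u \<in> nbs p" "btw p v u" "\<forall>z\<in>?A. \<not> btw p z u" by blast
  have "\<exists>R. (R, u, p, v) \<in> arcs Q" by (rule arc_exists[OF u(1) assms(1) u(2)]) (use u(3) in blast)
  then show ?thesis by blast
qed

lemma arc_after:
  assumes "u \<in> nbs p" "u \<noteq> first_nb p"
  shows "\<exists>R v. (R, u, p, v) \<in> arcs Q"
proof -
  have p: "p \<in> MT" using assms(1) MT_iff by blast
  note x = first_nb[OF p]
  let ?A = "{z \<in> nbs p. btw p z u}"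
  have "btw p (first_nb p) u" using nbs_total[OF assms(1) x(1) assms(2)] x(2)[OF assms(1)] by blast
  then have ne: "?A \<noteq> {}" using x(1) by blast
  have "finite ?A" "?A \<subseteq> sphere 0 1" "p \<in> sphere 0 1"
    using nbs_sub(2,4)[of p] subsetD[OF MT_sub(3) p] by auto
  from ex_last_ccw[OF this(1) ne this(2,3)] obtain v where
    v: "v \<in> nbs p" "btw p v u" "\<forall>z\<in>?A. \<not> btw p v z" by blast
  have "\<exists>R. (R, u, p, v) \<in> arcs Q" by (rule arc_exists[OF assms(1) v(1,2)]) (use v(3) in blast)
  then show ?thesis by blast
qed

lemma arc_nbs:
  assumes "(R, u, p, v) \<in> arcs Q"
  shows "u \<in> nbs p" "v \<in> nbs p" "p \<in> MT" "v \<noteq> last_nb p" "u \<noteq> first_nb p"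
proof -
  show 1: "u \<in> nbs p" "v \<in> nbs p" using assms by (auto simp: arcs_Q nbs_def insert_commute)
  show p: "p \<in> MT" using 1 MT_iff by blast
  show "v \<noteq> last_nb p" "u \<noteq> first_nb p" using last_nb(2)[OF p 1(1)] first_nb(2)[OF p 1(2)] arc_points(4)[OF assms] by blast+
qed

subsection \<open>The boundary piece following a fan\<close>

text \<open>\<open>R\<close> is the polygon to the left of the diagonal directed from
  \<open>first_nb p\<close> to \<open>p\<close>, beyond the end of the fan at \<open>p\<close> and
  facing the boundary piece from \<open>p\<close> to \<open>a\<close>.\<close>

context
  fixes p a R
  assumes conQ: "Digraph_Component.connected Q"
    and pa: "ccw_next MT p a" and R: "R \<in> regions M T" and vp: "ccw_next R (first_nb p) p"
begin

lemma piece_pts: "p \<in> MT" "a \<in> MT" "p \<noteq> a" "p \<in> R" "first_nb p \<in> R" "first_nb p \<noteq> p" "{first_nb p, p} \<in> T" "p \<in> M" "a \<in> M"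
  "\<And>z. z \<in> MT \<Longrightarrow> \<not> btw p z a"
proof -
  show p: "p \<in> MT" "a \<in> MT" "p \<noteq> a" "\<And>z. z \<in> MT \<Longrightarrow> \<not> btw p z a"
    using pa unfolding ccw_next_btw[OF MT_sub(3)] by blast+
  show "p \<in> R" "first_nb p \<in> R" "first_nb p \<noteq> p" using vp ccw_next_neq by blast+
  show "{first_nb p, p} \<in> T" using first_nb(1)[OF p(1)] by (simp add: nbs_def insert_commute)
  show "p \<in> M" "a \<in> M" using p MT_sub by blast+
qed

lemma T_MT: "{c, d} \<in> T \<Longrightarrow> c \<in> MT \<and> d \<in> MT"
  unfolding MT_iff nbs_def using T_E[of c d] by blast

text \<open>The corner \<open>w\<close> lies between \<open>p\<close> and \<open>first_nb p\<close>,
  so a diagonal to it would contradict the choice of \<open>first_nb p\<close>.\<close>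

lemma next_side_not_T:
  assumes "ccw_next R p w"
  shows "{p, w} \<notin> T"
proof
  assume "{p, w} \<in> T"
  then have w: "w \<in> nbs p" by (simp add: nbs_def)
  note RF = region_facts[OF R]
  have "w \<noteq> first_nb p" using ccw_next_asym[OF RF(3,4) vp] assms by blast
  then have "btw p (first_nb p) w" using nbs_total[OF w first_nb(1)] first_nb(2)[OF _ w] piece_pts(1) by blast
  then have "btw (first_nb p) w p" by (auto simp: btw_def)
  then show False using vp assms unfolding ccw_next_btw[OF RF(3)] by blast
qed

lemma region_gap_T:
  assumes "ccw_next R c d" "z \<in> M" "btw c z d"
  shows "{c, d} \<in> T"
proof -
  note RF = region_facts[OF R]
  have "\<not> ccw_next M c d" using assms unfolding ccw_next_btw[OF onS] by blast
  moreover have "\<not> ccw_next M d c"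
    using ccw_next_asym[OF RF(3,4) assms(1)] ccw_next_subset[OF onS RF(1), of d c] ccw_next_neq[OF assms(1)] by blast
  ultimately show ?thesis using region_side[OF R assms(1)] sides_iff by blast
qed

text \<open>Otherwise \<open>a\<close> is cut off by a side from \<open>c\<close> to
  \<open>d\<close> in \<open>T\<close>. As the sides leaving \<open>p\<close> are not in
  \<open>T\<close>, \<open>c\<close> is a point of \<open>MT\<close> strictly between
  \<open>p\<close> and \<open>a\<close>, which are consecutive in \<open>MT\<close>.\<close>

lemma next_in_region: "a \<in> R"
proof (rule ccontr)
  assume aR: "a \<notin> R"
  note RF = region_facts[OF R]
  have "2 \<le> card R" "a \<in> sphere 0 1" using RF(4) piece_pts onS by auto
  from ex_ccw_gap[OF RF(2,3) this aR] obtain c d where cd: "ccw_next R c d" "btw c a d" by blast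
  have T: "{c, d} \<in> T" using region_gap_T[OF cd(1) piece_pts(9) cd(2)] .
  have "c \<noteq> p" using next_side_not_T cd T by blast
  moreover have "\<not> btw c p d" "c \<in> R" "d \<in> R" "c \<noteq> d" using cd piece_pts(4) unfolding ccw_next_btw[OF RF(3)] by auto
  ultimately have "p = d \<or> btw d p c" using btw_cases_in[OF RF(3) _ _ piece_pts(4), of c d] by blast
  then have "btw p c a" using cd(2) by (auto simp: btw_def)
  then show False using piece_pts(10) T_MT[OF T] by blast
qed

lemma boundary_side:
  assumes "ccw_next R c d" "c = p \<or> btw p c a"
  shows "{c, d} \<notin> T"
proof (cases "c = p")
  case True
  then show ?thesis using next_side_not_T assms(1) by blast
next
  case False
  then show ?thesis using assms(2) piece_pts(10)[of c] T_MT[of c d] by blast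
qed

lemma piece_sub_region:
  assumes "z \<in> M" "btw p z a"
  shows "z \<in> R"
proof (rule ccontr)
  assume zR: "z \<notin> R"
  note RF = region_facts[OF R]
  have "2 \<le> card R" "z \<in> sphere 0 1" using RF(4) assms onS by auto
  from ex_ccw_gap[OF RF(2,3) this zR] obtain c d where cd: "ccw_next R c d" "btw c z d" by blast
  have T: "{c, d} \<in> T" using region_gap_T[OF cd(1) assms(1) cd(2)] .
  then have "\<not> btw p c a" "\<not> btw p d a" using piece_pts(10) T_MT by blast+
  moreover have n: "\<not> btw c p d" "\<not> btw c a d" "c \<in> R" "d \<in> R" "c \<noteq> d"
    using cd piece_pts(4) next_in_region unfolding ccw_next_btw[OF RF(3)] by auto
  ultimately have c: "c = p \<or> c = a \<or> btw a c p" and d: "d = p \<or> d = a \<or> btw a d p"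
    using btw_cases_in[OF RF(3) piece_pts(4) next_in_region _ piece_pts(3)] by blast+
  have "c = p"
  proof (rule ccontr)
    assume "c \<noteq> p"
    then have "c = a \<or> btw a c p" using c by blast
    then have "btw c p z" using assms(2) by (auto simp: btw_def)
    then have "btw c p d" using cd(2) by (auto simp: btw_def)
    then show False using n by blast
  qed
  then show False using next_side_not_T cd(1) T by blast
qed

text \<open>This is where connectedness enters. A second gap among the sides of \<open>R\<close>,
  from \<open>c\<close> to \<open>d\<close>, together with the one after \<open>p\<close>, would
  divide the diagonals into those on either side of \<open>R\<close> between the gaps: one class
  contains \<open>{first_nb p, p}\<close>, the other a diagonal at \<open>a\<close>, and no arrow
  joins the classes.\<close>

lemma inner_side:
  assumes "ccw_next R c d" "c \<noteq> p" "\<not> btw p c a"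
  shows "{c, d} \<in> T"
proof (rule ccontr)
  assume nT: "{c, d} \<notin> T"
  note RF = region_facts[OF R]
  let ?v = "first_nb p"
  have cd: "c \<in> R" "d \<in> R" "c \<noteq> d" "c \<in> M" "d \<in> M" "\<And>z. z \<in> R \<Longrightarrow> \<not> btw c z d"
    using assms(1) RF(1) unfolding ccw_next_btw[OF RF(3)] by blast+
  have noM: "\<not> btw c z d" if "z \<in> M" for z using region_gap_T[OF assms(1) that] nT by blast
  have dp: "d \<noteq> p"
  proof
    assume "d = p"
    then have "c = ?v" using ccw_prev_unique[OF RF(3) assms(1)] vp by blast
    then show False using nT piece_pts(7) \<open>d = p\<close> by simp
  qed
  have "\<not> btw c p d" using cd(6) piece_pts(4) by blast
  then have dpc: "btw d p c" using btw_cases_in[OF RF(3) cd(1,2) piece_pts(4) cd(3)] assms(2) dp by blast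
  \<comment> \<open>The point \<open>p\<close> is assigned to \<open>Y\<close>: its diagonals all
    lead there, since \<open>first_nb p\<close> is its first neighbour and lies in
    \<open>Y\<close>.\<close>
  define X where "X = {z \<in> M. z = c \<or> btw p z c}"
  define Y where "Y = {z \<in> M. z = d \<or> z = p \<or> btw d z p}"
  have disj: "X \<inter> Y = {}"
  proof -
    have "\<not> (btw p z c \<and> btw d z p)" "\<not> btw d c p" "\<not> btw p d c" for z using dpc by (auto simp: btw_def)
    then show ?thesis unfolding X_def Y_def using cd(3) assms(2) btw_distinct by blast
  qed
  have vY: "?v \<in> Y"
  proof -
    have "\<not> btw p ?v d"
    proof
      assume "btw p ?v d"
      then have "?v = c \<or> btw p ?v c \<or> btw c ?v d"
        using btw_cases_in[OF RF(3) piece_pts(4) cd(1) piece_pts(5) assms(2)[symmetric]] piece_pts(6) dpc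
        by (auto simp: btw_def)
      moreover have "?v \<noteq> c" using ccw_next_unique[OF RF(3) assms(1)] vp dp by blast
      moreover have "\<not> btw ?v c p" using vp cd(1) unfolding ccw_next_btw[OF RF(3)] by blast
      then have "\<not> btw p ?v c" by (auto simp: btw_def)
      ultimately show False using cd(6) piece_pts(5) by blast
    qed
    then have "?v = d \<or> btw d ?v p"
      using btw_cases_in[OF RF(3) piece_pts(4) cd(2) piece_pts(5) dp[symmetric]] piece_pts(6) by blast
    moreover have "?v \<in> M" using piece_pts(5) RF(1) by blast
    ultimately show ?thesis unfolding Y_def by blast
  qed
  have pY: "p \<in> Y" unfolding Y_def using piece_pts by blast
  have cover: "z \<in> X \<or> z \<in> Y" if z: "z \<in> M" for z
  proof -
    have "z = c \<or> z = p \<or> btw p z c \<or> btw c z p"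
      using btw_cases_in[OF onS piece_pts(8) cd(4) z assms(2)[symmetric]] by blast
    moreover have "z = d \<or> btw d z p" if "btw c z p"
    proof (rule ccontr)
      assume "\<not> ?thesis"
      then have "z = p \<or> btw p z d" using btw_cases_in[OF onS piece_pts(8) cd(5) z dp[symmetric]] by blast
      then have "btw c z d" using that dpc by (auto simp: btw_def)
      then show False using noM z by blast
    qed
    ultimately show ?thesis unfolding X_def Y_def using z by blast
  qed
  \<comment> \<open>A diagonal between the classes either starts at \<open>p\<close> before
    \<open>first_nb p\<close>, or is the side \<open>{c, d}\<close> itself, or separates two corners
    of \<open>R\<close>.\<close>
  have mixed: False if xy: "{x, y} \<in> T" "x \<in> X" "y \<in> Y" for x y
  proof -
    have E: "{x, y} \<in> E" "{y, x} \<in> E" using T_E[OF xy(1)] by blast+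
    have x: "x = c \<or> btw p x c" and y: "y = d \<or> y = p \<or> btw d y p" and M: "x \<in> M" "y \<in> M"
      using xy unfolding X_def Y_def by blast+
    show False
    proof (cases "y = p")
      case True
      then have "x \<in> nbs p" using xy(1) by (simp add: nbs_def insert_commute)
      moreover have "btw p x ?v"
      proof -
        have v: "?v = d \<or> btw d ?v p" using vY piece_pts(6) unfolding Y_def by blast
        have "btw p x d" using x dpc by (auto simp: btw_def)
        then show ?thesis using v by (auto simp: btw_def)
      qed
      ultimately show False using first_nb(2)[OF piece_pts(1)] by blast
    next
      case False
      then have y: "y = d \<or> btw d y p" using y by blast
      show False
      proof (cases "x = c")
        case True
        then have "btw d y p" using y nT xy(1) by blast
        moreover have "btw p x d" using True dpc by (auto simp: btw_def)
        ultimately show False using region_noncrossing[OF R cd(2) piece_pts(4) E(2)] by blast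
      next
        case False
        then have "btw p x c" using x by blast
        moreover have "btw c y p" using y dpc by (auto simp: btw_def)
        ultimately show False using region_noncrossing[OF R piece_pts(4) cd(1) E(1)] by blast
      qed
    qed
  qed
  define B where "B = {e \<in> T. e \<subseteq> Y}"
  have split: "e \<subseteq> X \<or> e \<subseteq> Y" if e: "e \<in> T" for e
  proof -
    obtain x y where xy: "e = {x, y}" "x \<in> M" "y \<in> M" using e by (elim T_elem)
    have "{x, y} \<in> T" "{y, x} \<in> T" using e xy by (auto simp: insert_commute)
    then show ?thesis using mixed[of x y] mixed[of y x] cover[OF xy(2)] cover[OF xy(3)] xy(1) by blast
  qed
  \<comment> \<open>The two diagonals of an arrow share a point and hence belong to the same class.
    Connectedness would put every diagonal inside \<open>Y\<close>, but \<open>a\<close> is in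
    \<open>X\<close>.\<close>
  have "B = verts Q"
  proof (rule connected_closed_set[OF conQ])
    show "B \<subseteq> verts Q" unfolding B_def by auto
    have "{?v, p} \<in> B" unfolding B_def using piece_pts(7) vY pY by blast
    then show "B \<noteq> {}" by blast
    fix e assume e: "e \<in> arcs Q"
    obtain R' u q w where e': "e = (R', u, q, w)" by (cases e) auto
    have T: "{u, q} \<in> T" "{q, w} \<in> T" using e unfolding e' arcs_Q by blast+
    show "tail Q e \<in> B \<longleftrightarrow> head Q e \<in> B"
      using split[OF T(1)] split[OF T(2)] T disj unfolding e' B_def by auto
  qed
  moreover obtain e where e: "e \<in> T" "a \<in> e"
    using piece_pts(2) unfolding MT_def incident_points_def by blast
  moreover have "a \<in> X"
  proof -
    have "c = a \<or> btw a c p" 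
      using btw_cases_in[OF RF(3) piece_pts(4) next_in_region cd(1) piece_pts(3)] assms(2,3) by blast
    then have "a = c \<or> btw p a c" by (auto simp: btw_def)
    then show ?thesis unfolding X_def using piece_pts by blast
  qed
  ultimately show False using disj unfolding B_def by auto
qed

text \<open>The origin of \<open>m - w\<close>: the \<open>m + 2\<close> corners of \<open>R\<close>
  are \<open>p\<close>, \<open>a\<close>, those beyond \<open>a\<close>, and all marked points of
  the boundary piece. The corners beyond \<open>a\<close> are the points at which two consecutive
  sides from \<open>T\<close> meet.\<close>

lemma card_pieces:
  "card {z \<in> R. btw a z p} + card {z \<in> M. btw p z a} = m"
proof -
  note RF = region_facts[OF R]
  have eq: "{z \<in> M. btw p z a} = {z \<in> R. btw p z a}" using piece_sub_region RF(1) by blast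
  have "R = {p, a} \<union> {z \<in> R. btw a z p} \<union> {z \<in> R. btw p z a}"
    using btw_cases_in[OF RF(3) piece_pts(4) next_in_region _ piece_pts(3)] piece_pts(4) next_in_region by blast
  moreover have "card ({p, a} \<union> {z \<in> R. btw a z p} \<union> {z \<in> R. btw p z a}) =
      card {p, a} + card {z \<in> R. btw a z p} + card {z \<in> R. btw p z a}"
  proof -
    have d: "{p, a} \<inter> {z \<in> R. btw a z p} = {}" "({p, a} \<union> {z \<in> R. btw a z p}) \<inter> {z \<in> R. btw p z a} = {}"
      by (auto simp: btw_def)
    have f: "finite {p, a}" "finite {z \<in> R. btw a z p}" "finite {z \<in> R. btw p z a}" using RF(2) by auto
    show ?thesis
      using card_Un_disjoint[OF f(1,2) d(1)] card_Un_disjoint[OF finite_UnI[OF f(1,2)] f(3) d(2)] by linarith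
  qed
  ultimately have "card R = 2 + card {z \<in> R. btw a z p} + card {z \<in> R. btw p z a}"
    using piece_pts(3) by simp
  then show ?thesis using card_region[OF R] eq by simp
qed

lemma prev_side_not_T:
  assumes w: "ccw_next R w a"
  shows "{w, a} \<notin> T"
proof -
  note RF = region_facts[OF R]
  have wR: "w \<in> R" "w \<noteq> a" "\<not> btw w p a" using w piece_pts(4) unfolding ccw_next_btw[OF RF(3)] by blast+
  have "w = p \<or> btw p w a"
  proof (rule ccontr)
    assume "\<not> ?thesis"
    then have "btw a w p" using btw_cases_in[OF RF(3) piece_pts(4) next_in_region wR(1) piece_pts(3)] wR(2) by blast
    then have "btw w p a" by (auto simp: btw_def)
    then show False using wR by blast
  qed
  then show ?thesis using boundary_side[OF w] by blast
qed

text \<open>The diagonal where the forbidden thread starts is the extreme one of the fan at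
  \<open>a\<close>, so the next permitted thread is that fan. A later neighbour would lie beyond the
  side from \<open>w\<close> to \<open>a\<close>, which has no marked points behind it, or point
  into the angle of \<open>R\<close> at \<open>a\<close>.\<close>

lemma last_nb_next:
  assumes "ccw_next R a b"
  shows "last_nb a = b" "{a, b} \<in> T"
proof -
  note RF = region_facts[OF R]
  show T: "{a, b} \<in> T" using inner_side[OF assms] piece_pts(3) btw_distinct by blast
  then have b: "b \<in> nbs a" by (simp add: nbs_def)
  have ar: "a \<in> R" using next_in_region .
  obtain w where w: "ccw_next R w a" using ex_ccw_prev[OF RF(2,3) _ ar] RF(4) by auto
  then have wR: "w \<in> R" "w \<noteq> a" using ccw_next_neq by blast+
  have wT: "{w, a} \<notin> T" using prev_side_not_T[OF w] .
  have no: "\<not> btw w z a" if "z \<in> M" for z using region_gap_T[OF w that] wT by blast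
  have wM: "w \<in> M" using wR RF(1) by blast
  have max: "\<not> btw a b z" if z: "z \<in> nbs a" for z
  proof
    assume abz: "btw a b z"
    have zM: "z \<in> M" "z \<noteq> a" using z nbs_sub[of a] by blast+
    have "z \<noteq> w" using z wT by (auto simp: nbs_def insert_commute)
    then have "btw a z w" using btw_cases_in[OF onS wM piece_pts(9) zM(1) wR(2)] no[OF zM(1)] zM(2) by blast
    moreover have "{a, z} \<in> E" using z by (simp add: nbs_def)
    ultimately show False using corner_empty[OF R w assms _ abz] by blast
  qed
  have aM: "a \<in> MT" using piece_pts by blast
  show "last_nb a = b"
    using nbs_total[OF last_nb(1)[OF aM] b] max[OF last_nb(1)[OF aM]] last_nb(2)[OF aM b] by blast
qed

end

end

section \<open>Threads and signs\<close>

lemma region_list: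
  assumes "finite R" "R \<subseteq> sphere 0 1" "2 \<le> card R" "a \<in> R"
  shows "\<exists>ws. ws \<noteq> [] \<and> hd ws = a \<and> distinct ws \<and> set ws = R \<and> successively (ccw_next R) ws \<and> ccw_next R (last ws) a"
proof -
  obtain p where p: "ccw_next R p a" using ex_ccw_prev[OF assms] by blast
  then have p': "p \<in> R" "a \<noteq> p" "\<And>z. z \<in> R \<Longrightarrow> \<not> btw p z a" unfolding ccw_next_btw[OF assms(2)] by blast+
  obtain zs where zs: "distinct zs" "set zs = {z \<in> R. btw a z p}" "successively (ccw_next R) (a # zs @ [p])"
    using arc_walk[OF assms(1,2,4) p'(1,2)] by blast
  have "set (a # zs @ [p]) = R"
    using zs(2) p' assms(4) btw_cases_in[OF assms(2,4) p'(1) _ p'(2)] by auto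
  moreover have "a \<notin> set zs" "p \<notin> set zs" using zs(2) btw_distinct by blast+
  then have "distinct (a # zs @ [p])" using zs(1) p'(2) by simp
  ultimately show ?thesis using zs(3) p by (intro exI[of _ "a # zs @ [p]"]) auto
qed

lemma successively_closed:
  assumes "successively r ws" "ws \<noteq> []" "hd ws \<in> U" "\<And>x y. x \<in> U \<Longrightarrow> r x y \<Longrightarrow> y \<in> U"
  shows "set ws \<subseteq> U"
  using assms(1-3)
proof (induction ws)
  case (Cons x ws)
  show ?case
  proof (cases ws)
    case Nil
    then show ?thesis using Cons.prems by simp
  next
    case (Cons y ys)
    then have "r x y" "successively r ws" "x \<in> U" using Cons.prems by auto
    then show ?thesis using Cons.IH Cons assms(4) by auto
  qed
qed simp

lemma successively_const:
  assumes "successively r l" "\<And>x y. r x y \<Longrightarrow> g x = g y" "x \<in> set l"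
  shows "g x = g (hd l)"
proof -
  have "l \<noteq> []" using assms(3) by auto
  from successively_closed[OF assms(1) this, of "{x. g x = g (hd l)}"] assms(2,3)
  show ?thesis by auto
qed

fun corner_point :: "corner \<Rightarrow> complex" where "corner_point (R, u, p, v) = p"

section \<open>Threads and signs in terms of corners\<close>

locale signed_angulation = polygon_angulation M T m Q for M T m Q +
  fixes I :: "(complex set \<times> corner list \<Rightarrow> 'k::field) set" and \<sigma> \<epsilon> :: "corner \<Rightarrow> int"
  assumes I: "I = angulation_ideal m M T"
    and con: "Digraph_Component.connected Q"
    and sgn: "sign_functions Q I \<sigma> \<epsilon>"
begin

interpretation PA: path_alg Q "path_algebra Q :: (complex set \<times> corner list \<Rightarrow> 'k) ring"
  using wf_Q finite_T by (simp add: path_alg_def path_alg_axioms_def)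

lemma I_eq: "I = genideal (path_algebra Q) {path_elem (tail Q \<alpha>, [\<alpha>, \<beta>]) | \<alpha> \<beta>.
    \<alpha> \<in> arcs Q \<and> \<beta> \<in> arcs Q \<and> head Q \<alpha> = tail Q \<beta> \<and> neighbouring_corners \<alpha> \<beta>}"
  unfolding I angulation_ideal_def Let_def Q ..

lemma relation_around:
  assumes "\<alpha> \<in> arcs Q" "\<beta> \<in> arcs Q" "head Q \<alpha> = tail Q \<beta>"
  shows "relation Q I \<alpha> \<beta> \<longleftrightarrow> around_region \<alpha> \<beta>" "\<not> relation Q I \<alpha> \<beta> \<longleftrightarrow> around_point \<alpha> \<beta>"
  using PA.relation_iff[OF I_eq assms] composable_cases[OF assms] by auto

lemma permitted_path_around:
  "permitted_path Q I l \<longleftrightarrow> l \<noteq> [] \<and> set l \<subseteq> arcs Q \<and> successively around_point l"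
proof -
  have "(head Q \<alpha> = tail Q \<beta> \<and> \<not> neighbouring_corners \<alpha> \<beta>) \<longleftrightarrow> around_point \<alpha> \<beta>"
    if "\<alpha> \<in> arcs Q" "\<beta> \<in> arcs Q" for \<alpha> \<beta>
    using composable_cases(2)[OF that] composable_if(2)[of \<alpha> \<beta>] by blast
  then have "(\<forall>i. Suc i < length l \<longrightarrow> head Q (l ! i) = tail Q (l ! Suc i) \<and> \<not> neighbouring_corners (l ! i) (l ! Suc i))
     \<longleftrightarrow> (\<forall>i. Suc i < length l \<longrightarrow> around_point (l ! i) (l ! Suc i))" if "set l \<subseteq> arcs Q"
    using that by (meson Suc_lessD nth_mem subsetD)
  then show ?thesis unfolding PA.permitted_path_iff[OF I_eq] successively_conv_nth by blast
qed

lemma forbidden_path_around: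
  "forbidden_path Q I l \<longleftrightarrow> l \<noteq> [] \<and> set l \<subseteq> arcs Q \<and> distinct l \<and> successively around_region l"
proof -
  have "(head Q \<alpha> = tail Q \<beta> \<and> neighbouring_corners \<alpha> \<beta>) \<longleftrightarrow> around_region \<alpha> \<beta>"
    if "\<alpha> \<in> arcs Q" "\<beta> \<in> arcs Q" for \<alpha> \<beta>
    using composable_cases(1)[OF that] composable_if(1)[of \<alpha> \<beta>] by blast
  then have "(\<forall>i. Suc i < length l \<longrightarrow> head Q (l ! i) = tail Q (l ! Suc i) \<and> neighbouring_corners (l ! i) (l ! Suc i))
     \<longleftrightarrow> (\<forall>i. Suc i < length l \<longrightarrow> around_region (l ! i) (l ! Suc i))" if "set l \<subseteq> arcs Q"
    using that by (meson Suc_lessD nth_mem subsetD)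
  then show ?thesis unfolding PA.forbidden_path_iff[OF I_eq] successively_conv_nth by blast
qed

lemma relation_cycle_around:
  "relation_cycle Q I l \<longleftrightarrow> forbidden_path Q I l \<and> around_region (last l) (hd l)"
proof (cases "forbidden_path Q I l")
  case True
  then have "last l \<in> arcs Q" "hd l \<in> arcs Q" unfolding forbidden_path_around by auto
  then have "head Q (last l) = tail Q (hd l) \<and> relation Q I (last l) (hd l) \<longleftrightarrow> around_region (last l) (hd l)"
    using relation_around(1)[of "last l" "hd l"] composable_if(1)[of "last l" "hd l"] by blast
  then show ?thesis using True by (simp add: relation_cycle_def)
qed (simp add: relation_cycle_def)

lemma around_point_unique:
  assumes "\<alpha> \<in> arcs Q" "\<beta> \<in> arcs Q" "\<gamma> \<in> arcs Q"
  shows "around_point \<alpha> \<beta> \<Longrightarrow> around_point \<alpha> \<gamma> \<Longrightarrow> \<beta> = \<gamma>"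
    "around_point \<beta> \<alpha> \<Longrightarrow> around_point \<gamma> \<alpha> \<Longrightarrow> \<beta> = \<gamma>"
  using assms by (cases \<alpha>; cases \<beta>; cases \<gamma>; auto dest: arc_eq_in arc_eq_out)+

lemma around_region_unique:
  assumes "\<alpha> \<in> arcs Q" "\<beta> \<in> arcs Q" "\<gamma> \<in> arcs Q"
  shows "around_region \<alpha> \<beta> \<Longrightarrow> around_region \<alpha> \<gamma> \<Longrightarrow> \<beta> = \<gamma>"
    "around_region \<beta> \<alpha> \<Longrightarrow> around_region \<gamma> \<alpha> \<Longrightarrow> \<beta> = \<gamma>"
  using assms by (cases \<alpha>; cases \<beta>; cases \<gamma>; auto dest: arc_eq_in arc_eq_out)+

lemma permitted_thread_around:
  "nontrivial_permitted_thread Q I l \<longleftrightarrow> permitted_path Q I l \<and>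
     (\<forall>\<beta>\<in>arcs Q. \<not> around_point \<beta> (hd l) \<and> \<not> around_point (last l) \<beta>)"
proof (cases "permitted_path Q I l")
  case True
  note p = True[unfolded permitted_path_around]
  have "permitted_path Q I (\<beta> # l) \<longleftrightarrow> around_point \<beta> (hd l)"
    "permitted_path Q I (l @ [\<beta>]) \<longleftrightarrow> around_point (last l) \<beta>" if "\<beta> \<in> arcs Q" for \<beta>
    using that p unfolding permitted_path_around by (auto simp: successively_Cons successively_append_iff)
  then show ?thesis unfolding nontrivial_permitted_thread_def by blast
qed (simp add: nontrivial_permitted_thread_def)

text \<open>An extension of a forbidden path may also fail because the new arrow already occurs.
  Distinctness and uniqueness of neighbours force such an arrow to be the opposite end of the path,
  which is then a relation cycle and excluded from the threads.\<close>

lemma forbidden_thread_around: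
  "nontrivial_forbidden_thread Q I l \<longleftrightarrow> forbidden_path Q I l \<and>
     (\<forall>\<beta>\<in>arcs Q. \<not> around_region \<beta> (hd l) \<and> \<not> around_region (last l) \<beta>)"
proof (cases "forbidden_path Q I l")
  case True
  then have p: "l \<noteq> []" "set l \<subseteq> arcs Q" "distinct l" "successively around_region l"
    unfolding forbidden_path_around by blast+
  have ext: "forbidden_path Q I (\<beta> # l) \<longleftrightarrow> \<beta> \<notin> set l \<and> around_region \<beta> (hd l)"
    "forbidden_path Q I (l @ [\<beta>]) \<longleftrightarrow> \<beta> \<notin> set l \<and> around_region (last l) \<beta>" if "\<beta> \<in> arcs Q" for \<beta>
    using that p unfolding forbidden_path_around by (auto simp: successively_Cons successively_append_iff)
  have nthA: "l ! i \<in> arcs Q" if "i < length l" for i using p(2) that nth_mem by blast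
  have cyc1: "relation_cycle Q I l" if b: "\<beta> \<in> set l" "around_region \<beta> (hd l)" for \<beta>
  proof -
    obtain i where i: "i < length l" "\<beta> = l ! i" using b(1) by (metis in_set_conv_nth)
    have h: "hd l = l ! 0" using p(1) by (simp add: hd_conv_nth)
    have "\<not> Suc i < length l"
    proof
      assume s: "Suc i < length l"
      then have "around_region (l ! i) (l ! Suc i)" using p(4) by (simp add: successively_conv_nth)
      then have "l ! Suc i = l ! 0"
        using around_region_unique(1)[OF nthA[OF i(1)] nthA[OF s] nthA] b(2) i p(1) h by auto
      then show False using p(1,3) s nth_eq_iff_index_eq[of l "Suc i" 0] by auto
    qed
    then have "i = length l - 1" using i(1) by simp
    then have "\<beta> = last l" using i p(1) by (simp add: last_conv_nth)
    then show ?thesis using b True by (simp add: relation_cycle_around)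
  qed
  have cyc2: "relation_cycle Q I l" if b: "\<beta> \<in> set l" "around_region (last l) \<beta>" for \<beta>
  proof -
    obtain i where i: "i < length l" "\<beta> = l ! i" using b(1) by (metis in_set_conv_nth)
    have h: "last l = l ! (length l - 1)" using p(1) by (simp add: last_conv_nth)
    have "i = 0"
    proof (rule ccontr)
      assume "i \<noteq> 0"
      then obtain j where j: "i = Suc j" by (cases i) auto
      have jl: "j < length l" "length l - 1 < length l" using i j p(1) by auto
      then have "around_region (l ! j) (l ! Suc j)" using p(4) i j by (simp add: successively_conv_nth)
      then have "l ! j = l ! (length l - 1)"
        using around_region_unique(2)[OF nthA[OF i(1)] nthA[OF jl(1)] nthA[OF jl(2)]] b(2) i h j by auto
      then show False using p(3) i j jl nth_eq_iff_index_eq[of l j "length l - 1"] by auto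
    qed
    then have "\<beta> = hd l" using i p(1) by (simp add: hd_conv_nth)
    then show ?thesis using b True by (simp add: relation_cycle_around)
  qed
  have "relation_cycle Q I l \<Longrightarrow> around_region (last l) (hd l) \<and> hd l \<in> arcs Q"
    using p by (auto simp: relation_cycle_around)
  then show ?thesis
    unfolding nontrivial_forbidden_thread_def using True ext cyc1 cyc2 by blast
qed (simp add: nontrivial_forbidden_thread_def)

subsection \<open>Signs as a function on directed diagonals\<close>

lemma sgn_pm: "\<alpha> \<in> arcs Q \<Longrightarrow> \<sigma> \<alpha> \<in> {-1, 1}" "\<alpha> \<in> arcs Q \<Longrightarrow> \<epsilon> \<alpha> \<in> {-1, 1}"
  using sgn[unfolded sign_functions_def, THEN conjunct1] by simp_all

lemma sgn_tail: "\<alpha> \<in> arcs Q \<Longrightarrow> \<beta> \<in> arcs Q \<Longrightarrow> \<alpha> \<noteq> \<beta> \<Longrightarrow> tail Q \<alpha> = tail Q \<beta> \<Longrightarrow> \<sigma> \<alpha> = - \<sigma> \<beta>"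
  using sgn[unfolded sign_functions_def, THEN conjunct2, THEN conjunct1] by blast

lemma sgn_head: "\<alpha> \<in> arcs Q \<Longrightarrow> \<beta> \<in> arcs Q \<Longrightarrow> \<alpha> \<noteq> \<beta> \<Longrightarrow> head Q \<alpha> = head Q \<beta> \<Longrightarrow> \<epsilon> \<alpha> = - \<epsilon> \<beta>"
  using sgn[unfolded sign_functions_def, THEN conjunct2, THEN conjunct2, THEN conjunct1] by blast

lemma sgn_point:
  assumes "\<alpha> \<in> arcs Q" "\<beta> \<in> arcs Q" "around_point \<alpha> \<beta>" shows "\<sigma> \<beta> = - \<epsilon> \<alpha>"
  using sgn[unfolded sign_functions_def, THEN conjunct2, THEN conjunct2, THEN conjunct2, THEN conjunct1]
    assms composable_if(2)[OF assms(3)] relation_around(2)[OF assms(1,2)] by simp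

text \<open>A further arrow at the vertex composes with \<alpha> or \<beta> around a point, and two
  sign clauses combine to the claim. If there is none, the vertex carries a trivial forbidden
  thread, and the clause on the agreement of its two prescriptions is the claim.\<close>

lemma sgn_region:
  assumes "\<alpha> \<in> arcs Q" "\<beta> \<in> arcs Q" "around_region \<alpha> \<beta>" shows "\<sigma> \<beta> = \<epsilon> \<alpha>"
proof -
  let ?x = "head Q \<alpha>"
  have t: "tail Q \<beta> = ?x" using composable_if(1)[OF assms(3)] by simp
  show ?thesis
  proof (cases "(\<exists>\<gamma>\<in>arcs Q. \<gamma> \<noteq> \<beta> \<and> tail Q \<gamma> = ?x) \<or> (\<exists>\<delta>\<in>arcs Q. \<delta> \<noteq> \<alpha> \<and> head Q \<delta> = ?x)")
    case True
    then consider \<gamma> where "\<gamma> \<in> arcs Q" "\<gamma> \<noteq> \<beta>" "tail Q \<gamma> = ?x" | \<delta> where "\<delta> \<in> arcs Q" "\<delta> \<noteq> \<alpha>" "head Q \<delta> = ?x" by blast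
    then show ?thesis
    proof cases
      case 1
      have "\<not> around_region \<alpha> \<gamma>" using around_region_unique(1)[OF assms(1) 1(1) assms(2)] assms(3) 1(2) by blast
      then have "around_point \<alpha> \<gamma>" using relation_around[OF assms(1) 1(1)] 1(3) by auto
      then have "\<sigma> \<gamma> = - \<epsilon> \<alpha>" using sgn_point assms(1) 1(1) by blast
      moreover have "\<sigma> \<gamma> = - \<sigma> \<beta>" using sgn_tail[OF 1(1) assms(2) 1(2)] 1(3) t by simp
      ultimately show ?thesis by simp
    next
      case 2
      have "\<not> around_region \<delta> \<beta>" using around_region_unique(2)[OF assms(2) 2(1) assms(1)] assms(3) 2(2) by blast
      then have "around_point \<delta> \<beta>" using relation_around[OF 2(1) assms(2)] 2(3) t by auto
      then have "\<sigma> \<beta> = - \<epsilon> \<delta>" using sgn_point assms(2) 2(1) by blast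
      moreover have "\<epsilon> \<delta> = - \<epsilon> \<alpha>" using sgn_head[OF 2(1) assms(1) 2(2)] 2(3) by simp
      ultimately show ?thesis by simp
    qed
  next
    case False
    then have io: "in_arcs Q ?x = {\<alpha>}" "out_arcs Q ?x = {\<beta>}"
      using assms(1,2) t unfolding in_arcs_def out_arcs_def by auto
    have "relation Q I \<alpha> \<beta>" using relation_around(1)[OF assms(1,2)] t assms(3) by simp
    moreover have "?x \<in> verts Q" using wf_digraph.head_in_verts[OF wf_Q assms(1)] .
    ultimately have "trivial_forbidden_at Q I ?x" unfolding trivial_forbidden_at_def io by simp
    moreover have "\<alpha> \<in> in_arcs Q ?x" "\<beta> \<in> out_arcs Q ?x" using io by auto
    ultimately have "- \<sigma> \<beta> = - \<epsilon> \<alpha>"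
      using sgn[unfolded sign_functions_def, THEN conjunct2, THEN conjunct2, THEN conjunct2, THEN conjunct2] by blast
    then show ?thesis by simp
  qed
qed

text \<open>The diagonal seen from \<open>p\<close>. Arrows with corner point \<open>p\<close>
  contribute \<epsilon> when they arrive and \<open>- \<sigma>\<close> when they leave, in
  accordance with compositions around a point; arrows with corner point \<open>q\<close> see the
  diagonal from its other end and contribute with the opposite sign.\<close>

definition directed_signs :: "complex \<Rightarrow> complex \<Rightarrow> int set" where
  "directed_signs p q = {\<epsilon> (R, u, p, q) | R u. (R, u, p, q) \<in> arcs Q} \<union> {- \<sigma> (R, q, p, w) | R w. (R, q, p, w) \<in> arcs Q}
    \<union> {- \<epsilon> (R, u, q, p) | R u. (R, u, q, p) \<in> arcs Q} \<union> {\<sigma> (R, p, q, w) | R w. (R, p, q, w) \<in> arcs Q}"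

text \<open>Each pair of kinds is one clause on signs: compositions around a point for
  \<open>AB\<close> and \<open>CD\<close>, common head for \<open>AC\<close>, common tail for
  \<open>BD\<close>, relations for \<open>AD\<close> and \<open>BC\<close>. Within one kind the
  directed side determines the arrow.\<close>

lemma directed_signs_single:
  assumes "s \<in> directed_signs p q" "t \<in> directed_signs p q"
  shows "s = t"
proof -
  let ?A = "{\<epsilon> (R, u, p, q) | R u. (R, u, p, q) \<in> arcs Q}"
  let ?B = "{- \<sigma> (R, q, p, w) | R w. (R, q, p, w) \<in> arcs Q}"
  let ?C = "{- \<epsilon> (R, u, q, p) | R u. (R, u, q, p) \<in> arcs Q}"
  let ?D = "{\<sigma> (R, p, q, w) | R w. (R, p, q, w) \<in> arcs Q}"
  have rr: "\<epsilon> (R, u, p, q) = \<sigma> (R', p, q, w)"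
    if "(R, u, p, q) \<in> arcs Q" "(R', p, q, w) \<in> arcs Q" for R u R' w p q
  proof -
    have "\<not> around_point (R, u, p, q) (R', p, q, w)" using arc_points(3)[OF that(1)] by simp
    then have "around_region (R, u, p, q) (R', p, q, w)" using relation_around[OF that] by simp
    then show ?thesis using sgn_region[OF that] by simp
  qed
  have AA: "x = y" if xy: "x \<in> ?A" "y \<in> ?A" for x y
  proof -
    obtain R u R' u' where "x = \<epsilon> (R, u, p, q)" "y = \<epsilon> (R', u', p, q)" "(R, u, p, q) \<in> arcs Q" "(R', u', p, q) \<in> arcs Q"
      using xy by blast
    then show ?thesis using arc_eq_out[of R u p q R' u'] by simp
  qed
  have BB: "x = y" if xy: "x \<in> ?B" "y \<in> ?B" for x y
  proof -
    obtain R u R' u' where "x = - \<sigma> (R, q, p, u)" "y = - \<sigma> (R', q, p, u')" "(R, q, p, u) \<in> arcs Q" "(R', q, p, u') \<in> arcs Q"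
      using xy by blast
    then show ?thesis using arc_eq_in[of R q p u R' u'] by simp
  qed
  have CC: "x = y" if xy: "x \<in> ?C" "y \<in> ?C" for x y
  proof -
    obtain R u R' u' where "x = - \<epsilon> (R, u, q, p)" "y = - \<epsilon> (R', u', q, p)" "(R, u, q, p) \<in> arcs Q" "(R', u', q, p) \<in> arcs Q"
      using xy by blast
    then show ?thesis using arc_eq_out[of R u q p R' u'] by simp
  qed
  have DD: "x = y" if xy: "x \<in> ?D" "y \<in> ?D" for x y
  proof -
    obtain R u R' u' where "x = \<sigma> (R, p, q, u)" "y = \<sigma> (R', p, q, u')" "(R, p, q, u) \<in> arcs Q" "(R', p, q, u') \<in> arcs Q"
      using xy by blast
    then show ?thesis using arc_eq_in[of R p q u R' u'] by simp
  qed
  have AB: "x = y" if xy: "x \<in> ?A" "y \<in> ?B" for x y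
  proof -
    obtain R u R' w where e: "x = \<epsilon> (R, u, p, q)" "y = - \<sigma> (R', q, p, w)" "(R, u, p, q) \<in> arcs Q" "(R', q, p, w) \<in> arcs Q"
      using xy by blast
    then show ?thesis using sgn_point[OF e(3,4)] by simp
  qed
  have AC: "x = y" if xy: "x \<in> ?A" "y \<in> ?C" for x y
  proof -
    obtain R u R' w where e: "x = \<epsilon> (R, u, p, q)" "y = - \<epsilon> (R', w, q, p)" "(R, u, p, q) \<in> arcs Q" "(R', w, q, p) \<in> arcs Q"
      using xy by blast
    then show ?thesis using sgn_head[OF e(3,4)] arc_points(3)[OF e(3)] by (simp add: insert_commute)
  qed
  have AD: "x = y" if xy: "x \<in> ?A" "y \<in> ?D" for x y
  proof -
    obtain R u R' w where e: "x = \<epsilon> (R, u, p, q)" "y = \<sigma> (R', p, q, w)" "(R, u, p, q) \<in> arcs Q" "(R', p, q, w) \<in> arcs Q"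
      using xy by blast
    then show ?thesis using rr[OF e(3,4)] by simp
  qed
  have BC: "x = y" if xy: "x \<in> ?B" "y \<in> ?C" for x y
  proof -
    obtain R u R' w where e: "x = - \<sigma> (R, q, p, u)" "y = - \<epsilon> (R', w, q, p)" "(R, q, p, u) \<in> arcs Q" "(R', w, q, p) \<in> arcs Q"
      using xy by blast
    then show ?thesis using rr[OF e(4,3)] by simp
  qed
  have BD: "x = y" if xy: "x \<in> ?B" "y \<in> ?D" for x y
  proof -
    obtain R u R' w where e: "x = - \<sigma> (R, q, p, u)" "y = \<sigma> (R', p, q, w)" "(R, q, p, u) \<in> arcs Q" "(R', p, q, w) \<in> arcs Q"
      using xy by blast
    then show ?thesis using sgn_tail[OF e(3,4)] arc_points(2)[OF e(3)] by (simp add: insert_commute)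
  qed
  have CD: "x = y" if xy: "x \<in> ?C" "y \<in> ?D" for x y
  proof -
    obtain R u R' w where e: "x = - \<epsilon> (R, u, q, p)" "y = \<sigma> (R', p, q, w)" "(R, u, q, p) \<in> arcs Q" "(R', p, q, w) \<in> arcs Q"
      using xy by blast
    then show ?thesis using sgn_point[OF e(3,4)] by simp
  qed
  have s: "s \<in> ?A \<or> s \<in> ?B \<or> s \<in> ?C \<or> s \<in> ?D" and t: "t \<in> ?A \<or> t \<in> ?B \<or> t \<in> ?C \<or> t \<in> ?D"
    using assms unfolding directed_signs_def by (simp_all only: Un_iff disj_assoc)
  show ?thesis
    using s
  proof (elim disjE)
    assume s: "s \<in> ?A"
    show ?thesis using t by (elim disjE) (rule AA[OF s], assumption, rule AB[OF s], assumption,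
      rule AC[OF s], assumption, rule AD[OF s], assumption)
  next
    assume s: "s \<in> ?B"
    show ?thesis using t by (elim disjE) (rule AB[OF _ s, symmetric], assumption, rule BB[OF s], assumption,
      rule BC[OF s], assumption, rule BD[OF s], assumption)
  next
    assume s: "s \<in> ?C"
    show ?thesis using t by (elim disjE) (rule AC[OF _ s, symmetric], assumption, rule BC[OF _ s, symmetric], assumption,
      rule CC[OF s], assumption, rule CD[OF s], assumption)
  next
    assume s: "s \<in> ?D"
    show ?thesis using t by (elim disjE) (rule AD[OF _ s, symmetric], assumption, rule BD[OF _ s, symmetric], assumption,
      rule CD[OF _ s, symmetric], assumption, rule DD[OF s], assumption)
  qed
qed

lemma directed_signs_pm: "s \<in> directed_signs p q \<Longrightarrow> s \<in> {-1, 1}"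
  unfolding directed_signs_def using sgn_pm by fastforce

lemma directed_signs_swap: "s \<in> directed_signs p q \<Longrightarrow> - s \<in> directed_signs q p"
  unfolding directed_signs_def by fastforce

text \<open>
  \<open>directed_signs p q\<close> collects the values of \<open>\<tau> p q\<close> that the arrows at the diagonal \<open>{p, q}\<close>
  prescribe. At the vertex of a quiver without arrows nothing is prescribed and any antisymmetric choice
  will do.
\<close>

definition \<tau> :: "complex \<Rightarrow> complex \<Rightarrow> int" where
  "\<tau> p q = (if directed_signs p q \<noteq> {} then THE s. s \<in> directed_signs p q
     else if Arg2pi p < Arg2pi q then 1 else -1)"

lemma tau_eq: "s \<in> directed_signs p q \<Longrightarrow> \<tau> p q = s"
  using directed_signs_single[of _ p q] unfolding \<tau>_def by auto

lemma tau_pm: "\<tau> p q \<in> {-1, 1}"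
proof (cases "directed_signs p q = {}")
  case False
  then obtain s where s: "s \<in> directed_signs p q" by blast
  then show ?thesis using tau_eq[OF s] directed_signs_pm[OF s] by simp
qed (simp add: \<tau>_def)

lemma tau_swap:
  assumes "{p, q} \<in> T"
  shows "\<tau> q p = - \<tau> p q"
proof (cases "directed_signs p q = {}")
  case True
  then have "directed_signs q p = {}" using directed_signs_swap by blast
  moreover have "p \<in> sphere 0 1" "q \<in> sphere 0 1" "p \<noteq> q" using T_in[OF assms] onS by blast+
  then have "Arg2pi p \<noteq> Arg2pi q" using Arg2pi_inj_sphere by blast
  ultimately show ?thesis using True by (auto simp: \<tau>_def)
next
  case False
  then obtain s where "s \<in> directed_signs p q" by blast
  then show ?thesis using tau_eq directed_signs_swap by metis
qed

lemma tau_arc: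
  assumes "(R, u, p, v) \<in> arcs Q"
  shows "\<epsilon> (R, u, p, v) = \<tau> p v" "\<sigma> (R, u, p, v) = - \<tau> p u"
proof -
  have "\<epsilon> (R, u, p, v) \<in> directed_signs p v" "- \<sigma> (R, u, p, v) \<in> directed_signs p u"
    unfolding directed_signs_def using assms by blast+
  from tau_eq[OF this(1)] tau_eq[OF this(2)]
  show "\<epsilon> (R, u, p, v) = \<tau> p v" "\<sigma> (R, u, p, v) = - \<tau> p u" by auto
qed

text \<open>A vertex of the quiver together with a sign therefore amounts to a directed diagonal,
  which tells apart the fans at its two ends.\<close>

lemma tau_inj:
  assumes "{p, q} \<in> T" "{p, q} = {p', q'}" "\<tau> p q = \<tau> p' q'"
  shows "p = p' \<and> q = q'"
proof (rule ccontr)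
  assume "\<not> ?thesis"
  then have "p' = q" "q' = p" using assms(2) by (auto simp: doubleton_eq_iff)
  then show False using assms(3) tau_swap[OF assms(1)] tau_pm[of p q] by auto
qed

subsection \<open>Uniqueness of threads with given end and sign\<close>

abbreviation "permitted \<equiv> permitted_thread Q I \<sigma> \<epsilon>"
abbreviation "forbidden \<equiv> forbidden_thread Q I \<sigma> \<epsilon>"

text \<open>This makes the algorithm deterministic. The sign \<sigma> selects the first arrow among
  those leaving the vertex, and the arrow determines the maximal chain. A trivial thread has the
  sign opposite to \<sigma> of any arrow leaving its vertex, so it is not confused with a
  non-trivial one.\<close>

lemma permitted_thread_unique:
  assumes "permitted H" "permitted H'"
    and "thread_start Q H = thread_start Q H'" "thread_sigma \<sigma> H = thread_sigma \<sigma> H'"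
  shows "H = H'"
proof -
  have tn: False if "permitted (Trivial x s)" "permitted (Nontrivial l)"
    "x = tail Q (hd l)" "s = \<sigma> (hd l)" for x s l
  proof -
    have "hd l \<in> arcs Q" using that(2) by (auto simp: permitted_thread_around permitted_path_around)
    then have "hd l \<in> out_arcs Q x" "\<sigma> (hd l) \<in> {-1, 1}" using that(3) sgn_pm by auto
    then have "s = - \<sigma> (hd l)" using that(1) by auto
    then show False using that(4) \<open>\<sigma> (hd l) \<in> {-1, 1}\<close> by auto
  qed
  have nn: "l = l'" if l: "permitted (Nontrivial l)" "permitted (Nontrivial l')"
    "tail Q (hd l) = tail Q (hd l')" "\<sigma> (hd l) = \<sigma> (hd l')" for l l'
  proof -
    have p: "l \<noteq> []" "set l \<subseteq> arcs Q" "successively around_point l" "\<And>b. b \<in> arcs Q \<Longrightarrow> \<not> around_point (last l) b"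
      "l' \<noteq> []" "set l' \<subseteq> arcs Q" "successively around_point l'" "\<And>b. b \<in> arcs Q \<Longrightarrow> \<not> around_point (last l') b"
      using l(1,2) unfolding permitted_thread.simps permitted_thread_around permitted_path_around by blast+
    have h: "hd l \<in> arcs Q" "hd l' \<in> arcs Q" using p(1,2,5,6) by auto
    have "hd l = hd l'"
    proof (rule ccontr)
      assume "hd l \<noteq> hd l'"
      from sgn_tail[OF h this l(3)] show False using l(4) sgn_pm(1)[OF h(2)] by auto
    qed
    then have hd: "hd l = hd l'" .
    show ?thesis
    proof (rule successively_maximal_unique[where r = around_point and A = "arcs Q", OF p(3,7,1,5) hd])
      show "b = c" if "a \<in> arcs Q" "b \<in> arcs Q" "c \<in> arcs Q" "around_point a b" "around_point a c" for a b c
        using around_point_unique(1)[OF that] .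
      show "set l \<subseteq> arcs Q" "set l' \<subseteq> arcs Q" by (fact p(2), fact p(6))
      show "\<not> around_point (last l) b" "\<not> around_point (last l') b" if "b \<in> arcs Q" for b
        by (rule p(4)[OF that], rule p(8)[OF that])
    qed
  qed
  show ?thesis
  proof (cases H; cases H')
    fix x s y t assume "H = Trivial x s" "H' = Trivial y t"
    then show ?thesis using assms(3,4) by simp
  next
    fix x s l assume e: "H = Trivial x s" "H' = Nontrivial l"
    then have "x = tail Q (hd l)" "s = \<sigma> (hd l)" using assms(3,4) by simp_all
    from tn[OF assms(1)[unfolded e] assms(2)[unfolded e] this] show ?thesis ..
  next
    fix x s l assume e: "H = Nontrivial l" "H' = Trivial x s"
    then have "x = tail Q (hd l)" "s = \<sigma> (hd l)" using assms(3,4) by simp_all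
    from tn[OF assms(2)[unfolded e] assms(1)[unfolded e] this] show ?thesis ..
  next
    fix l l' assume e: "H = Nontrivial l" "H' = Nontrivial l'"
    then have "tail Q (hd l) = tail Q (hd l')" "\<sigma> (hd l) = \<sigma> (hd l')" using assms(3,4) by simp_all
    from nn[OF assms(1)[unfolded e] assms(2)[unfolded e] this] show ?thesis using e by simp
  qed
qed

lemma forbidden_thread_unique:
  assumes "forbidden F" "forbidden F'"
    and "thread_end Q F = thread_end Q F'" "forbidden_epsilon \<epsilon> F = forbidden_epsilon \<epsilon> F'"
  shows "F = F'"
proof -
  have tn: False if "forbidden (Trivial x s)" "forbidden (Nontrivial l)"
    "x = head Q (last l)" "s = \<epsilon> (last l)" for x s l
  proof -
    have "last l \<in> arcs Q" using that(2) by (auto simp: forbidden_thread_around forbidden_path_around)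
    then have "last l \<in> in_arcs Q x" "\<epsilon> (last l) \<in> {-1, 1}" using that(3) sgn_pm by auto
    then have "s = - \<epsilon> (last l)" using that(1) by auto
    then show False using that(4) \<open>\<epsilon> (last l) \<in> {-1, 1}\<close> by auto
  qed
  have nn: "l = l'" if l: "forbidden (Nontrivial l)" "forbidden (Nontrivial l')"
    "head Q (last l) = head Q (last l')" "\<epsilon> (last l) = \<epsilon> (last l')" for l l'
  proof -
    have p: "l \<noteq> []" "set l \<subseteq> arcs Q" "successively around_region l" "\<And>b. b \<in> arcs Q \<Longrightarrow> \<not> around_region b (hd l)"
      "l' \<noteq> []" "set l' \<subseteq> arcs Q" "successively around_region l'" "\<And>b. b \<in> arcs Q \<Longrightarrow> \<not> around_region b (hd l')"
      using l(1,2) unfolding forbidden_thread.simps forbidden_thread_around forbidden_path_around by blast+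
    have h: "last l \<in> arcs Q" "last l' \<in> arcs Q" using p(1,2,5,6) by auto
    have eq: "last l = last l'"
    proof (rule ccontr)
      assume "last l \<noteq> last l'"
      from sgn_head[OF h this l(3)] show False using l(4) sgn_pm(2)[OF h(2)] by auto
    qed
    \<comment> \<open>Forbidden threads are prescribed by their end, so the chains are followed
      backwards.\<close>
    let ?r = "\<lambda>x y. around_region y x"
    have "rev l = rev l'"
    proof (rule successively_maximal_unique[where r = ?r and A = "arcs Q"])
      show "successively ?r (rev l)" "successively ?r (rev l')" using p by (simp_all add: successively_rev)
      show "hd (rev l) = hd (rev l')" using eq by (simp add: hd_rev)
      show "b = c" if "a \<in> arcs Q" "b \<in> arcs Q" "c \<in> arcs Q" "around_region b a" "around_region c a" for a b c
        using around_region_unique(2)[OF that] .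
      show "rev l \<noteq> []" "rev l' \<noteq> []" "set (rev l) \<subseteq> arcs Q" "set (rev l') \<subseteq> arcs Q"
        using p(1,2,5,6) by simp_all
      show "\<not> around_region b (last (rev l))" "\<not> around_region b (last (rev l'))" if "b \<in> arcs Q" for b
        using p(4)[OF that] p(8)[OF that] by (simp_all add: last_rev)
    qed
    then show ?thesis by simp
  qed
  show ?thesis
  proof (cases F; cases F')
    fix x s y t assume "F = Trivial x s" "F' = Trivial y t"
    then show ?thesis using assms(3,4) by simp
  next
    fix x s l assume e: "F = Trivial x s" "F' = Nontrivial l"
    then have "x = head Q (last l)" "s = \<epsilon> (last l)" using assms(3,4) by simp_all
    from tn[OF assms(1)[unfolded e] assms(2)[unfolded e] this] show ?thesis ..
  next
    fix x s l assume e: "F = Nontrivial l" "F' = Trivial x s"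
    then have "x = head Q (last l)" "s = \<epsilon> (last l)" using assms(3,4) by simp_all
    from tn[OF assms(2)[unfolded e] assms(1)[unfolded e] this] show ?thesis ..
  next
    fix l l' assume e: "F = Nontrivial l" "F' = Nontrivial l'"
    then have "head Q (last l) = head Q (last l')" "\<epsilon> (last l) = \<epsilon> (last l')" using assms(3,4) by simp_all
    from nn[OF assms(1)[unfolded e] assms(2)[unfolded e] this] show ?thesis using e by simp
  qed
qed

subsection \<open>Permitted threads are fans\<close>

definition perm_at :: "complex \<Rightarrow> (complex set, corner) thread \<Rightarrow> bool" where
  "perm_at p H \<longleftrightarrow> permitted H \<and>
     thread_start Q H = {p, last_nb p} \<and> thread_sigma \<sigma> H = - \<tau> p (last_nb p) \<and>
     thread_end Q H = {p, first_nb p} \<and> permitted_epsilon \<epsilon> H = \<tau> p (first_nb p)"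

lemma fan_ends:
  assumes "p \<in> MT"
  shows "last_nb p = first_nb p \<longleftrightarrow> nbs p = {last_nb p}"
proof
  assume eq: "last_nb p = first_nb p"
  have "z = last_nb p" if "z \<in> nbs p" for z
    using nbs_total[OF that last_nb(1)[OF assms]] last_nb(2)[OF assms that] first_nb(2)[OF assms that] eq by auto
  then show "nbs p = {last_nb p}" using last_nb(1)[OF assms] by blast
next
  assume "nbs p = {last_nb p}"
  then show "last_nb p = first_nb p" using first_nb(1)[OF assms] by (metis singletonD)
qed

lemma T_last_nb: "p \<in> MT \<Longrightarrow> {p, last_nb p} \<in> T" and T_first_nb: "p \<in> MT \<Longrightarrow> {p, first_nb p} \<in> T"
  using last_nb(1) first_nb(1) by (auto simp: nbs_def)

lemma in_arc_cases:
  assumes "\<alpha> \<in> in_arcs Q {p, q}"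
  obtains R u where "\<alpha> = (R, u, p, q)" "(R, u, p, q) \<in> arcs Q" | R u where "\<alpha> = (R, u, q, p)" "(R, u, q, p) \<in> arcs Q"
  using assms by (cases \<alpha>) (auto simp: in_arcs_def doubleton_eq_iff)

lemma out_arc_cases:
  assumes "\<alpha> \<in> out_arcs Q {p, q}"
  obtains R w where "\<alpha> = (R, q, p, w)" "(R, q, p, w) \<in> arcs Q" | R w where "\<alpha> = (R, p, q, w)" "(R, p, q, w) \<in> arcs Q"
  using assms by (cases \<alpha>) (auto simp: out_arcs_def doubleton_eq_iff)

lemma card_le_1I:
  assumes "\<And>x y. x \<in> A \<Longrightarrow> y \<in> A \<Longrightarrow> x = y"
  shows "card A \<le> 1"
proof (cases "finite A")
  case True
  then show ?thesis using assms card_le_Suc0_iff_eq[OF True] by simp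
qed simp

lemma in_arcs_one_corner:
  assumes "x = {p, q}" "\<And>R u. (R, u, p, q) \<notin> arcs Q"
  shows "\<alpha> \<in> in_arcs Q x \<Longrightarrow> \<exists>R u. \<alpha> = (R, u, q, p) \<and> (R, u, q, p) \<in> arcs Q" "card (in_arcs Q x) \<le> 1"
proof -
  have i: "\<exists>R u. \<alpha> = (R, u, q, p) \<and> (R, u, q, p) \<in> arcs Q" if "\<alpha> \<in> in_arcs Q x" for \<alpha>
  proof (rule in_arc_cases[OF that[unfolded assms(1)]])
    fix R u assume "(R, u, p, q) \<in> arcs Q"
    then show ?thesis using assms(2)[of R u] by simp
  next
    fix R u assume "\<alpha> = (R, u, q, p)" "(R, u, q, p) \<in> arcs Q"
    then show ?thesis by (intro exI conjI)
  qed
  then show "\<alpha> \<in> in_arcs Q x \<Longrightarrow> \<exists>R u. \<alpha> = (R, u, q, p) \<and> (R, u, q, p) \<in> arcs Q" .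
  show "card (in_arcs Q x) \<le> 1"
  proof (rule card_le_1I)
    fix y z assume "y \<in> in_arcs Q x" "z \<in> in_arcs Q x"
    then obtain R u R' u' where "y = (R, u, q, p)" "(R, u, q, p) \<in> arcs Q" "z = (R', u', q, p)" "(R', u', q, p) \<in> arcs Q"
      using i[of y] i[of z] by blast
    then show "y = z" using arc_eq_out[of R u q p R' u'] by simp
  qed
qed

lemma out_arcs_one_corner:
  assumes "x = {p, q}" "\<And>R w. (R, q, p, w) \<notin> arcs Q"
  shows "\<alpha> \<in> out_arcs Q x \<Longrightarrow> \<exists>R w. \<alpha> = (R, p, q, w) \<and> (R, p, q, w) \<in> arcs Q" "card (out_arcs Q x) \<le> 1"
proof -
  have o: "\<exists>R w. \<alpha> = (R, p, q, w) \<and> (R, p, q, w) \<in> arcs Q" if "\<alpha> \<in> out_arcs Q x" for \<alpha>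
  proof (rule out_arc_cases[OF that[unfolded assms(1)]])
    fix R w assume "(R, q, p, w) \<in> arcs Q"
    then show ?thesis using assms(2)[of R w] by simp
  next
    fix R w assume "\<alpha> = (R, p, q, w)" "(R, p, q, w) \<in> arcs Q"
    then show ?thesis by (intro exI conjI)
  qed
  then show "\<alpha> \<in> out_arcs Q x \<Longrightarrow> \<exists>R w. \<alpha> = (R, p, q, w) \<and> (R, p, q, w) \<in> arcs Q" .
  show "card (out_arcs Q x) \<le> 1"
  proof (rule card_le_1I)
    fix y z assume "y \<in> out_arcs Q x" "z \<in> out_arcs Q x"
    then obtain R w R' w' where "y = (R, p, q, w)" "(R, p, q, w) \<in> arcs Q" "z = (R', p, q, w')" "(R', p, q, w') \<in> arcs Q"
      using o[of y] o[of z] by blast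
    then show "y = z" using arc_eq_in[of R p q w R' w'] by simp
  qed
qed

text \<open>With one diagonal at \<open>p\<close> no arrow has corner point \<open>p\<close>, and
  the arrows at the diagonal all sit at its other end; the thread is trivial. Otherwise the maximal
  chain starting at the last neighbour stays at \<open>p\<close> and stops only at the
  first.\<close>

lemma perm_at_exists:
  assumes p: "p \<in> MT"
  shows "\<exists>H. perm_at p H"
proof (cases "last_nb p = first_nb p")
  case True
  define q where "q = last_nb p"
  have nb: "nbs p = {q}" "first_nb p = q" using fan_ends[OF p] True q_def by auto
  have T: "{p, q} \<in> T" using T_last_nb[OF p] q_def by simp
  have no: False if "(R, u, p, v) \<in> arcs Q" for R u v
  proof -
    have "u = q" "v = q" using arc_nbs(1,2)[OF that] nb(1) by simp_all
    then show False using arc_points(1)[OF that] by simp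
  qed
  have ni: "(R, u, p, q) \<notin> arcs Q" and no': "(R, q, p, w) \<notin> arcs Q" for R u w using no by blast+
  note i = in_arcs_one_corner[OF refl ni] and o = out_arcs_one_corner[OF refl no']
  have "trivial_permitted_at Q I {p, q}"
    unfolding trivial_permitted_at_def
  proof (intro conjI ballI)
    show "{p, q} \<in> verts Q" using T by simp
    show "card (in_arcs Q {p, q}) \<le> 1" "card (out_arcs Q {p, q}) \<le> 1" by (rule i(2), rule o(2))
    fix \<beta> \<gamma> assume "\<beta> \<in> in_arcs Q {p, q}" "\<gamma> \<in> out_arcs Q {p, q}"
    then obtain R u R' w where bg: "\<beta> = (R, u, q, p)" "\<beta> \<in> arcs Q" "\<gamma> = (R', p, q, w)" "\<gamma> \<in> arcs Q"
      using i(1)[of \<beta>] o(1)[of \<gamma>] by blast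
    have "head Q \<beta> = tail Q \<gamma>" unfolding bg by (simp add: insert_commute)
    then show "\<not> relation Q I \<beta> \<gamma>" using relation_around(2)[OF bg(2,4)] bg(1,3) by simp
  qed
  moreover have "\<forall>\<alpha>\<in>out_arcs Q {p, q}. \<tau> q p = - \<sigma> \<alpha>"
  proof
    fix \<alpha> assume "\<alpha> \<in> out_arcs Q {p, q}"
    then obtain R w where "\<alpha> = (R, p, q, w)" "(R, p, q, w) \<in> arcs Q" using o(1)[of \<alpha>] by blast
    then show "\<tau> q p = - \<sigma> \<alpha>" using tau_arc(2)[of R p q w] by simp
  qed
  moreover have "\<forall>\<alpha>\<in>in_arcs Q {p, q}. \<tau> q p = \<epsilon> \<alpha>"
  proof
    fix \<alpha> assume "\<alpha> \<in> in_arcs Q {p, q}"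
    then obtain R u where "\<alpha> = (R, u, q, p)" "(R, u, q, p) \<in> arcs Q" using i(1)[of \<alpha>] by blast
    then show "\<tau> q p = \<epsilon> \<alpha>" using tau_arc(1)[of R u q p] by simp
  qed
  \<comment> \<open>The sign is forced: it must be \<open>- \<tau> p q\<close>, which is
    \<open>\<tau> q p\<close> by antisymmetry.\<close>
  ultimately have "perm_at p (Trivial {p, q} (\<tau> q p))"
    unfolding perm_at_def using tau_pm[of q p] tau_swap[OF T] nb q_def by simp
  then show ?thesis ..
next
  case False
  obtain R v where a0: "(R, last_nb p, p, v) \<in> arcs Q" using arc_after[OF last_nb(1)[OF p] False] by blast
  \<comment> \<open>The number of neighbours still ahead drops with every arrow around
    \<open>p\<close>, so the chain ends.\<close>
  define f where "f = (\<lambda>(R :: complex set, u :: complex, p, v). card {z \<in> nbs p. btw p z v})"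
  have dec: "f y < f x" if xy: "x \<in> arcs Q" "y \<in> arcs Q" "around_point x y" for x y
  proof -
    obtain R u p v where x: "x = (R, u, p, v)" by (cases x) auto
    obtain R' w where y: "y = (R', v, p, w)" using xy(3) x by (cases y) auto
    have ya: "(R', v, p, w) \<in> arcs Q" using xy(2) y by simp
    have "w \<in> nbs p" "btw p w v" using arc_nbs(2)[OF ya] arc_points(4)[OF ya] .
    moreover have "btw p z v" if "btw p z w" for z using that \<open>btw p w v\<close> by (auto simp: btw_def)
    moreover have "\<not> btw p w w" using btw_distinct by blast
    ultimately have "{z \<in> nbs p. btw p z w} \<subset> {z \<in> nbs p. btw p z v}" by blast
    moreover have "finite {z \<in> nbs p. btw p z v}" using nbs_sub(2)[of p] by simp
    ultimately show ?thesis unfolding f_def x y by (simp add: psubset_card_mono)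
  qed
  have "\<exists>l. l \<noteq> [] \<and> hd l = (R, last_nb p, p, v) \<and> set l \<subseteq> arcs Q \<and> successively around_point l \<and>
      (\<forall>b\<in>arcs Q. \<not> around_point (last l) b)"
    by (rule ex_maximal_chain[where f = f, OF a0]) (rule dec)
  then obtain l where
    l: "l \<noteq> []" "hd l = (R, last_nb p, p, v)" "set l \<subseteq> arcs Q" "successively around_point l"
      "\<forall>b\<in>arcs Q. \<not> around_point (last l) b" by (elim exE conjE)
  have "corner_point (last l) = corner_point (hd l)"
  proof (rule successively_const[OF l(4)])
    fix x y :: corner assume "around_point x y"
    then show "corner_point x = corner_point y" by (cases x; cases y) auto
  qed (use l in auto)
  then obtain R' u' v' where last: "last l = (R', u', p, v')" using l(2) by (cases "last l") auto
  have la: "(R', u', p, v') \<in> arcs Q" using l(1,3) last by (metis last_in_set subsetD)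
  have v': "v' = first_nb p"
  proof (rule ccontr)
    assume "v' \<noteq> first_nb p"
    then obtain R'' w where b: "(R'', v', p, w) \<in> arcs Q" using arc_after[OF arc_nbs(2)[OF la]] by blast
    show False using bspec[OF l(5) b] last by simp
  qed
  have "\<not> around_point \<beta> (hd l)" if b: "\<beta> \<in> arcs Q" for \<beta>
  proof
    assume r: "around_point \<beta> (hd l)"
    obtain R1 u1 p1 v1 where e: "\<beta> = (R1, u1, p1, v1)" by (cases \<beta>) auto
    have "p1 = p \<and> v1 = last_nb p" using r unfolding l(2) e by auto
    then have "(R1, u1, p, last_nb p) \<in> arcs Q" using b e by simp
    from arc_nbs(4)[OF this] show False by simp
  qed
  then have "nontrivial_permitted_thread Q I l"
    unfolding permitted_thread_around permitted_path_around using l(1,3,4,5) by auto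
  then have "perm_at p (Nontrivial l)"
    unfolding perm_at_def using l(2) last v' tau_arc[OF a0] tau_arc[OF la] by (simp add: insert_commute)
  then show ?thesis ..
qed

text \<open>A non-trivial thread begins at the last neighbour of its corner point because it cannot
  be prolonged backwards, and uniqueness identifies it with the fan. For a trivial thread, an end
  with further diagonals has an arrow there and prescribes the sign; hence the other end is the one
  to which the thread belongs.\<close>

lemma permitted_thread_perm_at:
  assumes H: "permitted H"
  shows "\<exists>p\<in>MT. perm_at p H"
proof (cases H)
  case (Nontrivial l)
  then have l: "l \<noteq> []" "set l \<subseteq> arcs Q" "\<And>\<beta>. \<beta> \<in> arcs Q \<Longrightarrow> \<not> around_point \<beta> (hd l)"
    using H by (auto simp: permitted_thread_around permitted_path_around)
  obtain R u p v where h: "hd l = (R, u, p, v)" by (cases "hd l") auto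
  have a: "(R, u, p, v) \<in> arcs Q" using l h by (metis hd_in_set subsetD)
  have p: "p \<in> MT" using arc_nbs[OF a] by blast
  have "u = last_nb p"
  proof (rule ccontr)
    assume "u \<noteq> last_nb p"
    then obtain R' w where b: "(R', w, p, u) \<in> arcs Q" using arc_before[OF arc_nbs(1)[OF a]] by blast
    show False using l(3)[OF b] h by simp
  qed
  then have "thread_start Q H = {p, last_nb p}" "thread_sigma \<sigma> H = - \<tau> p (last_nb p)"
    using h Nontrivial tau_arc[OF a] by (auto simp: insert_commute)
  moreover obtain H' where H': "perm_at p H'" using perm_at_exists[OF p] by blast
  ultimately have "H = H'" using H by (intro permitted_thread_unique) (auto simp: perm_at_def)
  then show ?thesis using H' p by blast
next
  case (Trivial x s)
  then have x: "trivial_permitted_at Q I x" "s \<in> {-1, 1}"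
    "\<And>\<alpha>. \<alpha> \<in> out_arcs Q x \<Longrightarrow> s = - \<sigma> \<alpha>" "\<And>\<beta>. \<beta> \<in> in_arcs Q x \<Longrightarrow> s = \<epsilon> \<beta>"
    using H by auto
  have xT: "x \<in> T" using x(1) by (simp add: trivial_permitted_at_def)
  then obtain a b where ab: "x = {a, b}" "a \<noteq> b" by (elim T_elem)
  have key: "perm_at p H" if pq: "x = {p, q}" "nbs p = {q}" "s = \<tau> q p" for p q
  proof -
    have p: "p \<in> MT" using pq MT_iff by auto
    have m: "last_nb p = q" "first_nb p = q" using last_nb(1)[OF p] first_nb(1)[OF p] pq(2) by auto
    have "{p, q} \<in> T" using pq xT by simp
    then show ?thesis unfolding perm_at_def using H Trivial m pq tau_swap[of p q] by simp
  qed
  have nbm: "p \<in> MT" if "x = {p, q}" for p q using that xT MT_iff[of p] by (auto simp: nbs_def)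
  have sg: "s = \<tau> q p" if pq: "x = {p, q}" "nbs q \<noteq> {p}" for p q
  proof -
    have q: "q \<in> MT" "p \<in> nbs q" using nbm[of q p] pq xT by (auto simp: insert_commute nbs_def)
    have "last_nb q \<noteq> first_nb q" using fan_ends[OF q(1)] pq(2) q(2) by auto
    then have "p \<noteq> last_nb q \<or> p \<noteq> first_nb q" by auto
    then show ?thesis
    proof
      assume "p \<noteq> last_nb q"
      then obtain R u where a: "(R, u, q, p) \<in> arcs Q" using arc_before[OF q(2)] by blast
      then have "(R, u, q, p) \<in> in_arcs Q x" using pq by (simp add: in_arcs_def insert_commute)
      from x(4)[OF this] show ?thesis using tau_arc[OF a] by simp
    next
      assume "p \<noteq> first_nb q"
      then obtain R w where a: "(R, p, q, w) \<in> arcs Q" using arc_after[OF q(2)] by blast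
      then have "(R, p, q, w) \<in> out_arcs Q x" using pq by (simp add: out_arcs_def)
      from x(3)[OF this] show ?thesis using tau_arc[OF a] by simp
    qed
  qed
  have Tab: "{a, b} \<in> T" using xT ab by simp
  \<comment> \<open>Further diagonals at both ends would prescribe opposite signs.\<close>
  have one: "nbs a = {b} \<or> nbs b = {a}"
  proof (rule ccontr)
    assume "\<not> ?thesis"
    then have "s = \<tau> b a" "s = \<tau> a b" using sg[of a b] sg[of b a] ab by (auto simp: insert_commute)
    then show False using tau_swap[OF Tab] tau_pm[of a b] by auto
  qed
  have "\<exists>p q. x = {p, q} \<and> nbs p = {q} \<and> s = \<tau> q p"
  \<comment> \<open>If neither end has another diagonal the vertex has no arrows; of the two trivial
    threads that then exist, each sign belongs to one end.\<close>
  proof (cases "nbs a = {b} \<and> nbs b = {a}")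
    case True
    have "s = \<tau> b a \<or> s = \<tau> a b" using tau_swap[OF Tab] tau_pm[of a b] x(2) by auto
    then show ?thesis using True ab by (auto simp: insert_commute)
  next
    case False
    then consider "nbs a = {b}" "nbs b \<noteq> {a}" | "nbs b = {a}" "nbs a \<noteq> {b}" using one by blast
    then show ?thesis
    proof cases
      case 1
      then show ?thesis using sg[of a b] ab by blast
    next
      case 2
      have "x = {b, a}" using ab by (simp add: insert_commute)
      then show ?thesis using sg[of b a] 2 by blast
    qed
  qed
  then show ?thesis using key nbm by blast
qed

end

context signed_angulation
begin

subsection \<open>Forbidden threads are boundary pieces\<close>

text \<open>The end data link the thread to the fan at \<open>p\<close>, the start data to the fan
  at \<open>a\<close>. The length is given additively, so that no truncated subtraction of naturals
  occurs.\<close>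

definition forb_at :: "complex \<Rightarrow> complex \<Rightarrow> (complex set, corner) thread \<Rightarrow> bool" where
  "forb_at p a F \<longleftrightarrow> forbidden F \<and>
     thread_end Q F = {p, first_nb p} \<and> forbidden_epsilon \<epsilon> F = - \<tau> p (first_nb p) \<and>
     thread_start Q F = {a, last_nb a} \<and> thread_sigma \<sigma> F = \<tau> a (last_nb a) \<and>
     thread_length F + card {z \<in> M. btw p z a} = m"

text \<open>The sides of \<open>R\<close> from \<open>a\<close> round to \<open>p\<close> are
  exactly those in \<open>T\<close>, and each corner strictly between \<open>a\<close> and
  \<open>p\<close> contributes one arrow. With no such corner the only side in \<open>T\<close> is
  \<open>{a, p}\<close>, and the thread is trivial.\<close>

lemma forb_at_exists_aux:
  assumes pa: "ccw_next MT p a" and R: "R \<in> regions M T" and vp: "ccw_next R (first_nb p) p"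
  shows "\<exists>F. forb_at p a F"
proof -
  note RF = region_facts[OF R]
  note pts = piece_pts[OF con pa R vp]
  have aR: "a \<in> R" using next_in_region[OF con pa R vp] .
  have c2: "2 \<le> card R" using RF(4) by simp
  have "\<forall>z\<in>R. \<exists>q. ccw_next R z q" using ex_ccw_next[OF RF(2,3) c2] by blast
  then obtain nx where nx: "\<And>z. z \<in> R \<Longrightarrow> ccw_next R z (nx z)" by metis
  have nxR: "nx z \<in> R" if "z \<in> R" for z using ccw_next_neq[OF nx[OF that]] by blast
  have nx_eq: "q = nx z" if "ccw_next R z q" for z q
    using ccw_next_unique[OF RF(3) that nx] ccw_next_neq[OF that] by blast
  obtain zs where zs: "distinct zs" "set zs = {z \<in> R. btw a z p}" "successively (ccw_next R) (a # zs @ [p])"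
    using arc_walk[OF RF(2,3) aR pts(4) pts(3)[symmetric]] by blast
  have b: "last_nb a = nx a" "{a, nx a} \<in> T" using last_nb_next[OF con pa R vp nx[OF aR]] by blast+
  have len: "length zs + card {z \<in> M. btw p z a} = m"
    using card_pieces[OF con pa R vp] zs(1,2) distinct_card[of zs] by simp
  have no_prev: "{w, a} \<notin> T" if "ccw_next R w a" for w using prev_side_not_T[OF con pa R vp that] .
  have no_next: "{p, w} \<notin> T" if "ccw_next R p w" for w using next_side_not_T[OF con pa R vp that] .
  have tm: "\<tau> (first_nb p) p = - \<tau> p (first_nb p)" using tau_swap[of p "first_nb p"] pts(7) by (simp add: insert_commute)
  show ?thesis
  proof (cases "zs = []")
    case True
    then have ap: "ccw_next R a p" using zs(3) by simp
    have v: "first_nb p = a" using ccw_prev_unique[OF RF(3) vp ap] .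
    have nxa: "nx a = p" using nx_eq[OF ap] by simp
    have Tap: "{a, p} \<in> T" using pts(7) v by simp
    have no1: False if "(R', u, a, p) \<in> arcs Q" for R' u
    proof -
      have x: "R' \<in> regions M T" "ccw_next R' u a" "ccw_next R' a p" "{u, a} \<in> T" using that unfolding arcs_Q by blast+
      have "R' = R" using region_unique[OF x(1) R x(3) ap] .
      then show False using no_prev[of u] x by simp
    qed
    have no2: False if "(R', a, p, w) \<in> arcs Q" for R' w
    proof -
      have x: "R' \<in> regions M T" "ccw_next R' a p" "ccw_next R' p w" "{p, w} \<in> T" using that unfolding arcs_Q by blast+
      have "R' = R" using region_unique[OF x(1) R x(2) ap] .
      then show False using no_next[of w] x by simp
    qed
    have ni: "(R', u, a, p) \<notin> arcs Q" and no: "(R', a, p, w) \<notin> arcs Q" for R' u w using no1 no2 by blast+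
    note i = in_arcs_one_corner[OF refl ni] and o = out_arcs_one_corner[OF insert_commute no]
    have "trivial_forbidden_at Q I {a, p}"
      unfolding trivial_forbidden_at_def
    proof (intro conjI ballI)
      show "{a, p} \<in> verts Q" using Tap by simp
      show "card (in_arcs Q {a, p}) \<le> 1" "card (out_arcs Q {a, p}) \<le> 1" by (rule i(2), rule o(2))
      fix \<beta> \<gamma> assume "\<beta> \<in> in_arcs Q {a, p}" "\<gamma> \<in> out_arcs Q {a, p}"
      then obtain R1 u R2 w where bg: "\<beta> = (R1, u, p, a)" "\<beta> \<in> arcs Q" "\<gamma> = (R2, p, a, w)" "\<gamma> \<in> arcs Q"
        using i(1)[of \<beta>] o(1)[of \<gamma>] by blast
      have "head Q \<beta> = tail Q \<gamma>" unfolding bg by simp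
      moreover have "\<not> around_point \<beta> \<gamma>" using pts(3) unfolding bg by simp
      ultimately show "relation Q I \<beta> \<gamma>" using relation_around(2)[OF bg(2,4)] by blast
    qed
    moreover have "\<forall>\<gamma>\<in>out_arcs Q {a, p}. \<tau> a p = - \<sigma> \<gamma>"
    proof
      fix \<gamma> assume "\<gamma> \<in> out_arcs Q {a, p}"
      then obtain R' w where "\<gamma> = (R', p, a, w)" "(R', p, a, w) \<in> arcs Q" using o(1)[of \<gamma>] by blast
      then show "\<tau> a p = - \<sigma> \<gamma>" using tau_arc(2)[of R' p a w] by simp
    qed
    moreover have "\<forall>\<delta>\<in>in_arcs Q {a, p}. \<tau> a p = - \<epsilon> \<delta>"
    proof
      fix \<delta> assume "\<delta> \<in> in_arcs Q {a, p}"
      then obtain R' u where "\<delta> = (R', u, p, a)" "(R', u, p, a) \<in> arcs Q" using i(1)[of \<delta>] by blast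
      then show "\<tau> a p = - \<epsilon> \<delta>" using tau_arc(1)[of R' u p a] tau_swap[OF Tap] by simp
    qed
    moreover have "\<tau> a p \<in> {-1, 1}" by (rule tau_pm)
    ultimately have "forbidden (Trivial {a, p} (\<tau> a p))" by simp
    then have "forb_at p a (Trivial {a, p} (\<tau> a p))"
      unfolding forb_at_def using v b(1) nxa tm len True by (simp add: insert_commute)
    then show ?thesis ..
  next
    case False
    define k where "k = length zs"
    define ws where "ws = a # zs @ [p]"
    \<comment> \<open>An arrow is indexed by the corner before its corner point. Of the
      \<open>k + 2\<close> points from \<open>a\<close> to \<open>p\<close>, the last two start no
      arrow.\<close>
    define us where "us = take k ws"
    define f where "f u = (R, u, nx u, nx (nx u))" for u
    have k: "0 < k" using False by (simp add: k_def)
    have lw: "length ws = k + 2" by (simp add: ws_def k_def)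
    have ws0: "ws ! 0 = a" and wsk: "ws ! Suc k = p" and wsz: "\<And>i. i < k \<Longrightarrow> ws ! Suc i \<in> set zs"
      by (auto simp: ws_def k_def nth_append)
    have step: "ccw_next R (ws ! i) (ws ! Suc i)" if "i \<le> k" for i
      using zs(3) that lw unfolding ws_def[symmetric] by (simp add: successively_conv_nth)
    have wsR: "ws ! i \<in> R" if "i \<le> k" for i using ccw_next_neq[OF step[OF that]] by blast
    have nxw: "nx (ws ! i) = ws ! Suc i" if "i \<le> k" for i using nx_eq[OF step[OF that]] by simp
    have "distinct ws" unfolding ws_def using zs(1,2) pts(3) btw_distinct by auto
    have inT: "{ws ! i, ws ! Suc i} \<in> T" if "i \<le> k" for i
    proof (cases i)
      case 0
      then show ?thesis using b(2) nxw[of 0] ws0 by simp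
    next
      case (Suc j)
      then have "ws ! i \<in> set zs" using wsz[of j] that by simp
      then have z: "btw a (ws ! i) p" using zs(2) by blast
      then have "ws ! i \<noteq> p" "\<not> btw p (ws ! i) a" using btw_distinct[OF z] btw_asym[OF z] by blast+
      then show ?thesis using inner_side[OF con pa R vp step[OF that]] by blast
    qed
    have us_nth: "us ! i = ws ! i" if "i < k" for i using that by (simp add: us_def)
    have lu: "length us = k" using lw by (simp add: us_def)
    have fw: "f (ws ! i) = (R, ws ! i, ws ! Suc i, ws ! Suc (Suc i))" if "i < k" for i
      using nxw[of i] nxw[of "Suc i"] that by (simp add: f_def)
    have arc: "(R, ws ! i, ws ! Suc i, ws ! Suc (Suc i)) \<in> arcs Q" if "i < k" for i
      unfolding arcs_Q using R step[of i] step[of "Suc i"] inT[of i] inT[of "Suc i"] that by simp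
    let ?l = "map f us"
    have ln: "?l ! i = (R, ws ! i, ws ! Suc i, ws ! Suc (Suc i))" if "i < k" for i
      using that lu us_nth fw by simp
    have ll: "length ?l = k" using lu by simp
    have "us \<noteq> []" "?l \<noteq> []" using lu k by auto
    have hdl: "hd ?l = (R, a, nx a, nx (nx a))"
      using ln[of 0] k \<open>?l \<noteq> []\<close> ws0 nxw[of 0] nxw[of 1] by (simp add: hd_conv_nth)
    obtain j where j: "k = Suc j" using k by (cases k) auto
    have "ccw_next R (ws ! k) p" using step[of k] wsk by simp
    then have wk: "ws ! k = first_nb p" using ccw_prev_unique[OF RF(3) vp] by simp
    have lastl: "last ?l = (R, ws ! j, first_nb p, p)"
      using ln[of j] j \<open>?l \<noteq> []\<close> ll wk wsk by (simp add: last_conv_nth)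
    have setl: "set ?l \<subseteq> arcs Q"
    proof
      fix x assume "x \<in> set ?l"
      then obtain i where "i < k" "x = ?l ! i" using ll unfolding in_set_conv_nth by auto
      then show "x \<in> arcs Q" using ln[of i] arc[of i] by simp
    qed
    have "distinct us" using \<open>distinct ws\<close> by (simp add: us_def)
    then have dl: "distinct ?l" by (simp add: distinct_map f_def inj_on_def)
    have succ: "successively around_region ?l"
      unfolding successively_conv_nth
    proof (intro allI impI)
      fix i assume "Suc i < length ?l"
      then show "around_region (?l ! i) (?l ! Suc i)" using ln[of i] ln[of "Suc i"] ll by simp
    qed
    have fp: "forbidden_path Q I ?l"
      unfolding forbidden_path_around using \<open>?l \<noteq> []\<close> setl dl succ by blast
    have "nontrivial_forbidden_thread Q I ?l"
      unfolding forbidden_thread_around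
    proof (intro conjI ballI fp)
      fix \<beta> assume \<beta>: "\<beta> \<in> arcs Q"
      show "\<not> around_region \<beta> (hd ?l)"
      proof
        assume ar: "around_region \<beta> (hd ?l)"
        obtain R1 u1 p1 v1 where e: "\<beta> = (R1, u1, p1, v1)" by (cases \<beta>) auto
        then have "R1 = R" "p1 = a" using ar hdl by auto
        then have "ccw_next R u1 a" "{u1, a} \<in> T" using \<beta> unfolding e arcs_Q by blast+
        then show False using no_prev by blast
      qed
      show "\<not> around_region (last ?l) \<beta>"
      proof
        assume ar: "around_region (last ?l) \<beta>"
        obtain R1 u1 p1 v1 where e: "\<beta> = (R1, u1, p1, v1)" by (cases \<beta>) auto
        then have "R1 = R" "p1 = p" using ar lastl by auto
        then have "ccw_next R p v1" "{p, v1} \<in> T" using \<beta> unfolding e arcs_Q by blast+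
        then show False using no_next by blast
      qed
    qed
    moreover have "thread_start Q (Nontrivial ?l) = {a, last_nb a}" using hdl b(1) by simp
    moreover have "thread_sigma \<sigma> (Nontrivial ?l) = \<tau> a (last_nb a)"
    proof -
      have "(R, a, nx a, nx (nx a)) \<in> arcs Q" using setl \<open>?l \<noteq> []\<close> hdl by (metis hd_in_set subsetD)
      from tau_arc(2)[OF this] show ?thesis using hdl b(1) tau_swap[OF b(2)] by simp
    qed
    moreover have "thread_end Q (Nontrivial ?l) = {p, first_nb p}" using lastl by (simp add: insert_commute)
    moreover have "forbidden_epsilon \<epsilon> (Nontrivial ?l) = - \<tau> p (first_nb p)"
    proof -
      have "(R, ws ! j, first_nb p, p) \<in> arcs Q" using setl \<open>?l \<noteq> []\<close> lastl by (metis last_in_set subsetD)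
      from tau_arc(1)[OF this] show ?thesis using lastl tm by simp
    qed
    moreover have "thread_length (Nontrivial ?l) + card {z \<in> M. btw p z a} = m"
      using len lu by (simp add: k_def)
    ultimately have "forb_at p a (Nontrivial ?l)" unfolding forb_at_def forbidden_thread.simps by blast
    then show ?thesis ..
  qed
qed

lemma forb_at_exists:
  assumes "ccw_next MT p a"
  shows "\<exists>F. forb_at p a F"
proof -
  have "p \<in> MT" using ccw_next_neq[OF assms] by blast
  then have "{first_nb p, p} \<in> T" using T_first_nb by (simp add: insert_commute)
  then obtain R where "R \<in> regions M T" "ccw_next R (first_nb p) p" using region_exists[OF card_M] by blast
  then show ?thesis using forb_at_exists_aux[OF assms] by blast
qed

subsection \<open>The run of the algorithm\<close>

definition fan :: "complex \<Rightarrow> (complex set, corner) thread" where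
  "fan p = (SOME H. perm_at p H)"

definition nxt :: "complex \<Rightarrow> complex" where "nxt p = (SOME q. ccw_next MT p q)"

definition border :: "complex \<Rightarrow> (complex set, corner) thread" where
  "border p = (SOME F. forb_at p (nxt p) F)"

lemma fan: "p \<in> MT \<Longrightarrow> perm_at p (fan p)"
  unfolding fan_def using someI_ex[OF perm_at_exists] .

lemma nxt:
  assumes "p \<in> MT" shows "ccw_next MT p (nxt p)"
  unfolding nxt_def using someI_ex[OF ex_ccw_next[OF MT_sub(2,3) card_MT assms]] .

lemma nxt_MT: "p \<in> MT \<Longrightarrow> nxt p \<in> MT"
  using ccw_next_neq[OF nxt] by blast

lemma border: "p \<in> MT \<Longrightarrow> forb_at p (nxt p) (border p)"
  unfolding border_def using someI_ex[OF forb_at_exists[OF nxt]] .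

lemma fan_eqI:
  assumes "permitted H" "p \<in> MT" "thread_start Q H = {p, last_nb p}" "thread_sigma \<sigma> H = - \<tau> p (last_nb p)"
  shows "H = fan p"
  using permitted_thread_unique[OF assms(1)] fan[OF assms(2)] assms(3,4) unfolding perm_at_def by simp

lemma permitted_thread_fan:
  assumes "permitted H" shows "\<exists>p\<in>MT. H = fan p"
proof -
  obtain p where p: "p \<in> MT" "perm_at p H" using permitted_thread_perm_at[OF assms] by blast
  then have "H = fan p" using fan_eqI[OF assms p(1)] unfolding perm_at_def by blast
  then show ?thesis using p(1) by blast
qed

lemma fan_inj: "inj_on fan MT"
proof (rule inj_onI)
  fix p q assume p: "p \<in> MT" and q: "q \<in> MT" and eq: "fan p = fan q"
  have "{p, last_nb p} = {q, last_nb q}" "- \<tau> p (last_nb p) = - \<tau> q (last_nb q)"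
    using fan[OF p] fan[OF q] eq unfolding perm_at_def by simp_all
  then show "p = q" using tau_inj[OF T_last_nb[OF p]] by simp
qed

text \<open>Stated as equivalences, so that the same facts identify a given run and build
  one.\<close>

lemma run_step:
  assumes p: "p \<in> MT"
  shows "forbidden F \<and> thread_end Q F = thread_end Q (fan p) \<and>
      forbidden_epsilon \<epsilon> F = - permitted_epsilon \<epsilon> (fan p) \<longleftrightarrow> F = border p"
    and "permitted H \<and> thread_start Q H = thread_start Q (border p) \<and>
      thread_sigma \<sigma> H = - thread_sigma \<sigma> (border p) \<longleftrightarrow> H = fan (nxt p)"
proof -
  have P: "permitted (fan p)" "thread_end Q (fan p) = {p, first_nb p}" "permitted_epsilon \<epsilon> (fan p) = \<tau> p (first_nb p)"
    using fan[OF p] unfolding perm_at_def by auto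
  have B: "forbidden (border p)" "thread_end Q (border p) = {p, first_nb p}"
    "forbidden_epsilon \<epsilon> (border p) = - \<tau> p (first_nb p)" "thread_start Q (border p) = {nxt p, last_nb (nxt p)}"
    "thread_sigma \<sigma> (border p) = \<tau> (nxt p) (last_nb (nxt p))"
    using border[OF p] unfolding forb_at_def by auto
  have N: "permitted (fan (nxt p))" "thread_start Q (fan (nxt p)) = {nxt p, last_nb (nxt p)}"
    "thread_sigma \<sigma> (fan (nxt p)) = - \<tau> (nxt p) (last_nb (nxt p))"
    using fan[OF nxt_MT[OF p]] unfolding perm_at_def by auto
  show "forbidden F \<and> thread_end Q F = thread_end Q (fan p) \<and>
      forbidden_epsilon \<epsilon> F = - permitted_epsilon \<epsilon> (fan p) \<longleftrightarrow> F = border p"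
  proof
    assume a: "forbidden F \<and> thread_end Q F = thread_end Q (fan p) \<and>
      forbidden_epsilon \<epsilon> F = - permitted_epsilon \<epsilon> (fan p)"
    then have "thread_end Q F = thread_end Q (border p)" "forbidden_epsilon \<epsilon> F = forbidden_epsilon \<epsilon> (border p)"
      using P B by simp_all
    with a B(1) show "F = border p" using forbidden_thread_unique by blast
  next
    assume "F = border p"
    then show "forbidden F \<and> thread_end Q F = thread_end Q (fan p) \<and>
      forbidden_epsilon \<epsilon> F = - permitted_epsilon \<epsilon> (fan p)" using P B by simp
  qed
  show "permitted H \<and> thread_start Q H = thread_start Q (border p) \<and>
      thread_sigma \<sigma> H = - thread_sigma \<sigma> (border p) \<longleftrightarrow> H = fan (nxt p)"
  proof
    assume a: "permitted H \<and> thread_start Q H = thread_start Q (border p) \<and>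
      thread_sigma \<sigma> H = - thread_sigma \<sigma> (border p)"
    then have "thread_start Q H = {nxt p, last_nb (nxt p)}" "thread_sigma \<sigma> H = - \<tau> (nxt p) (last_nb (nxt p))"
      using B by simp_all
    with a show "H = fan (nxt p)" using fan_eqI[OF _ nxt_MT[OF p]] by blast
  next
    assume "H = fan (nxt p)"
    then show "permitted H \<and> thread_start Q H = thread_start Q (border p) \<and>
      thread_sigma \<sigma> H = - thread_sigma \<sigma> (border p)" using N B by simp
  qed
qed

lemma nxt_orbit_MT: "p \<in> MT \<Longrightarrow> (nxt ^^ i) p \<in> MT"
  by (induction i) (auto intro: nxt_MT)

lemma nxt_orbit:
  assumes p: "p \<in> MT"
  shows "bij_betw (\<lambda>i. (nxt ^^ i) p) {..<card MT} MT" "(nxt ^^ card MT) p = p"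
proof -
  obtain ws where ws: "ws \<noteq> []" "hd ws = p" "distinct ws" "set ws = MT" "successively (ccw_next MT) ws"
    "ccw_next MT (last ws) p" using region_list[OF MT_sub(2,3) card_MT p] by blast
  have len: "length ws = card MT" using distinct_card[OF ws(3)] ws(4) by simp
  have nx: "nxt x = y" if "ccw_next MT x y" for x y
    using ccw_next_unique[OF MT_sub(3) nxt that] ccw_next_neq[OF that] by blast
  have it: "(nxt ^^ i) p = ws ! i" if "i < length ws" for i
    using that
  proof (induction i)
    case 0
    then show ?case using ws(1,2) by (simp add: hd_conv_nth)
  next
    case (Suc i)
    then have "ccw_next MT (ws ! i) (ws ! Suc i)" using ws(5) by (simp add: successively_conv_nth)
    then show ?case using Suc nx by simp
  qed
  have "bij_betw ((!) ws) {..<card MT} MT" using bij_betw_nth[OF ws(3)] len ws(4) by simp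
  moreover have "bij_betw (\<lambda>i. (nxt ^^ i) p) {..<card MT} MT \<longleftrightarrow> bij_betw ((!) ws) {..<card MT} MT"
    by (rule bij_betw_cong) (use it len in simp)
  ultimately show "bij_betw (\<lambda>i. (nxt ^^ i) p) {..<card MT} MT" by blast
  obtain n where n: "length ws = Suc n" using ws(1) by (cases ws) auto
  then have last: "(nxt ^^ n) p = last ws" using it[of n] ws(1) by (simp add: last_conv_nth)
  have cn: "card MT = Suc n" using len n by simp
  show "(nxt ^^ card MT) p = p" unfolding cn using nx[OF ws(6)] last by simp
qed

lemma nxt_return:
  assumes p: "p \<in> MT" and n: "1 \<le> n" "(nxt ^^ n) p = p" "\<And>i. 0 < i \<Longrightarrow> i < n \<Longrightarrow> (nxt ^^ i) p \<noteq> p"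
  shows "n = card MT"
proof (rule ccontr)
  assume "n \<noteq> card MT"
  then consider "n < card MT" | "card MT < n" by linarith
  then show False
  proof cases
    case 1
    have "inj_on (\<lambda>i. (nxt ^^ i) p) {..<card MT}" using nxt_orbit(1)[OF p] by (simp add: bij_betw_def)
    then have "n = 0" using inj_onD[of "\<lambda>i. (nxt ^^ i) p" "{..<card MT}" n 0] 1 n(2) by simp
    then show False using n(1) by simp
  next
    case 2
    then show False using n(3)[of "card MT"] nxt_orbit(2)[OF p] card_MT by simp
  qed
qed

text \<open>Any run starts at some fan and then follows \<open>nxt\<close>. Since \<open>fan\<close>
  is injective on \<open>MT\<close>, the first return of the threads is the first return of the
  points, after \<open>card MT\<close> steps, and the recorded data do not depend on the starting
  point.\<close>

lemma ag_recorded_iff: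
  "ag_recorded Q I \<sigma> \<epsilon> n q X \<longleftrightarrow>
     n = card MT \<and> q = (\<Sum>p\<in>MT. thread_length (border p)) \<and> X = fan ` MT"
proof -
  have vals: "(\<lambda>i. fan ((nxt ^^ i) p)) ` {..<card MT} = fan ` MT"
    "(\<Sum>i<card MT. thread_length (border ((nxt ^^ i) p))) = (\<Sum>p\<in>MT. thread_length (border p))"
    if p: "p \<in> MT" for p
  proof -
    have "(\<lambda>i. (nxt ^^ i) p) ` {..<card MT} = MT" using nxt_orbit(1)[OF p] by (simp add: bij_betw_def)
    then show "(\<lambda>i. fan ((nxt ^^ i) p)) ` {..<card MT} = fan ` MT" by (metis image_image)
    show "(\<Sum>i<card MT. thread_length (border ((nxt ^^ i) p))) = (\<Sum>p\<in>MT. thread_length (border p))"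
      by (rule sum.reindex_bij_betw[OF nxt_orbit(1)[OF p]])
  qed
  \<comment> \<open>The recorded sum has indices from 1 to \<open>n\<close>, the orbit has 0 to
    \<open>n - 1\<close>; the condition \<open>F n = F 0\<close> reconciles them.\<close>
  have shift: "(\<Sum>i = 1..n. g i) = (\<Sum>i<n. g i)" if "g n = g 0" for g :: "nat \<Rightarrow> nat" and n
  proof -
    have "(\<Sum>i = 1..n. g i) = (\<Sum>i<n. g (Suc i))" by (simp add: sum.atLeast1_atMost_eq)
    moreover have "g 0 + (\<Sum>i<n. g (Suc i)) = (\<Sum>i<n. g i) + g n"
      using sum.lessThan_Suc_shift[of g n] by simp
    ultimately show ?thesis using that by simp
  qed
  show ?thesis
  proof
    assume "ag_recorded Q I \<sigma> \<epsilon> n q X"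
    then obtain H F where run: "ag_run Q I \<sigma> \<epsilon> n H F" and X: "X = H ` {..<n}"
      and q: "q = (\<Sum>i = 1..n. thread_length (F i))" unfolding ag_recorded_def by blast
    have n1: "1 \<le> n" and H0: "permitted (H 0)" and Hn: "H n = H 0" and Fn: "F n = F 0"
      and Hi: "\<And>i. 0 < i \<Longrightarrow> i < n \<Longrightarrow> H i \<noteq> H 0"
      using run unfolding ag_run_def by blast+
    have st: "forbidden (F i) \<and> thread_end Q (F i) = thread_end Q (H i) \<and>
        forbidden_epsilon \<epsilon> (F i) = - permitted_epsilon \<epsilon> (H i)"
      "permitted (H (Suc i)) \<and> thread_start Q (H (Suc i)) = thread_start Q (F i) \<and>
        thread_sigma \<sigma> (H (Suc i)) = - thread_sigma \<sigma> (F i)" if "i < n" for i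
      using run that unfolding ag_run_def by blast+
    obtain p where p: "p \<in> MT" "H 0 = fan p" using permitted_thread_fan[OF H0] by blast
    have HF: "H i = fan ((nxt ^^ i) p) \<and> (i < n \<longrightarrow> F i = border ((nxt ^^ i) p))" if "i \<le> n" for i
      using that
    proof (induction i)
      case 0
      have "F 0 = border p" if "0 < n" using st(1)[OF that] run_step(1)[OF p(1)] p(2) by simp
      then show ?case using p by simp
    next
      case (Suc i)
      note o = nxt_orbit_MT[OF p(1), of i]
      have i: "i < n" "H i = fan ((nxt ^^ i) p)" "F i = border ((nxt ^^ i) p)" using Suc by auto
      have "H (Suc i) = fan (nxt ((nxt ^^ i) p))" using st(2)[OF i(1)] run_step(2)[OF o] i(3) by simp
      then have h: "H (Suc i) = fan ((nxt ^^ Suc i) p)" by simp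
      note o' = nxt_orbit_MT[OF p(1), of "Suc i"]
      have "F (Suc i) = border ((nxt ^^ Suc i) p)" if "Suc i < n"
        by (rule iffD1[OF run_step(1)[OF o'] st(1)[OF that, unfolded h]])
      then show ?case using h by blast
    qed
    have inj: "(nxt ^^ i) p = p \<longleftrightarrow> H i = H 0" if "i \<le> n" for i
      using HF[OF that] p inj_on_eq_iff[OF fan_inj nxt_orbit_MT[OF p(1)] p(1)] by simp
    have n: "n = card MT"
    proof (rule nxt_return[OF p(1) n1])
      show "(nxt ^^ n) p = p" using inj[of n] Hn by simp
      show "(nxt ^^ i) p \<noteq> p" if "0 < i" "i < n" for i using inj[of i] Hi[OF that] that by simp
    qed
    have "X = (\<lambda>i. fan ((nxt ^^ i) p)) ` {..<card MT}" unfolding X n using HF n by (intro image_cong) auto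
    moreover have "q = (\<Sum>i<n. thread_length (F i))" unfolding q using shift[of "\<lambda>i. thread_length (F i)" n] Fn by simp
    moreover have "\<dots> = (\<Sum>i<card MT. thread_length (border ((nxt ^^ i) p)))" unfolding n using HF n by (intro sum.cong) auto
    ultimately show "n = card MT \<and> q = (\<Sum>p\<in>MT. thread_length (border p)) \<and> X = fan ` MT"
      using n vals[OF p(1)] by simp
  next
    assume a: "n = card MT \<and> q = (\<Sum>p\<in>MT. thread_length (border p)) \<and> X = fan ` MT"
    obtain p where p: "p \<in> MT" using card_MT by fastforce
    define H where "H i = fan ((nxt ^^ i) p)" for i
    define F where "F i = border ((nxt ^^ i) p)" for i
    have "ag_run Q I \<sigma> \<epsilon> n H F"
      unfolding ag_run_def
    proof (intro conjI allI impI)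
      show "1 \<le> n" using a card_MT by simp
      show "permitted (H 0)" using fan[OF p] by (simp add: H_def perm_at_def)
      show "H n = H 0" "F n = F 0" using nxt_orbit(2)[OF p] a by (simp_all add: H_def F_def)
      fix i
      show "H i \<noteq> H 0" if "0 < i \<and> i < n"
      proof
        assume "H i = H 0"
        then have "(nxt ^^ i) p = (nxt ^^ 0) p" using inj_on_eq_iff[OF fan_inj nxt_orbit_MT[OF p] p] by (simp add: H_def)
        moreover have "inj_on (\<lambda>i. (nxt ^^ i) p) {..<card MT}" using nxt_orbit(1)[OF p] by (simp add: bij_betw_def)
        ultimately show False using that a inj_onD[of "\<lambda>i. (nxt ^^ i) p" "{..<card MT}" i 0] by simp
      qed
      note o = nxt_orbit_MT[OF p, of i]
      have "F i = border ((nxt ^^ i) p)" "H (Suc i) = fan (nxt ((nxt ^^ i) p))" by (simp_all add: F_def H_def)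
      then have 1: "forbidden (F i) \<and> thread_end Q (F i) = thread_end Q (H i) \<and>
          forbidden_epsilon \<epsilon> (F i) = - permitted_epsilon \<epsilon> (H i)"
        and 2: "permitted (H (Suc i)) \<and> thread_start Q (H (Suc i)) = thread_start Q (F i) \<and>
          thread_sigma \<sigma> (H (Suc i)) = - thread_sigma \<sigma> (F i)"
        using run_step(1)[OF o, of "F i"] run_step(2)[OF o, of "H (Suc i)"] by (simp_all add: H_def)
      show "forbidden (F i)" "thread_end Q (F i) = thread_end Q (H i)"
        "forbidden_epsilon \<epsilon> (F i) = - permitted_epsilon \<epsilon> (H i)" using 1 by auto
      show "permitted (H (Suc i))" "thread_start Q (H (Suc i)) = thread_start Q (F i)"
        "thread_sigma \<sigma> (H (Suc i)) = - thread_sigma \<sigma> (F i)" using 2 by auto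
    qed
    moreover have "X = H ` {..<n}" using a vals(1)[OF p] by (simp add: H_def)
    moreover have "q = (\<Sum>i = 1..n. thread_length (F i))"
    proof -
      have "(\<Sum>i = 1..n. thread_length (F i)) = (\<Sum>i<n. thread_length (F i))"
        by (rule shift) (use nxt_orbit(2)[OF p] a in \<open>simp add: F_def\<close>)
      then show ?thesis using a vals(2)[OF p] by (simp add: F_def)
    qed
    ultimately show "ag_recorded Q I \<sigma> \<epsilon> n q X" unfolding ag_recorded_def by blast
  qed
qed

subsection \<open>Relation cycles and internal polygons\<close>

text \<open>All arrows lie in one polygon. The set \<open>U\<close> of their first points is
  non-empty and closed under the successor in that polygon, hence contains all its corners; so every
  side is in \<open>T\<close> and there is one arrow per corner.\<close>

lemma relation_cycle_region:
  assumes rc: "relation_cycle Q I l"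
  shows "l \<noteq> []" "fst (hd l) \<in> regions M T" "sides (fst (hd l)) \<subseteq> T"
    "set l = {\<alpha> \<in> arcs Q. fst \<alpha> = fst (hd l)}" "length l = m + 2"
proof -
  have l: "l \<noteq> []" "set l \<subseteq> arcs Q" "distinct l" "successively around_region l" "around_region (last l) (hd l)"
    using rc unfolding relation_cycle_around forbidden_path_around by blast+
  show "l \<noteq> []" by (rule l(1))
  define R where "R = fst (hd l)"
  have fst_R: "fst \<alpha> = R" if "\<alpha> \<in> set l" for \<alpha>
    unfolding R_def
  proof (rule successively_const[OF l(4) _ that])
    fix x y :: corner assume "around_region x y"
    then show "fst x = fst y" by (cases x; cases y) auto
  qed
  have hd_in: "hd l \<in> set l" using l(1) by simp
  obtain u0 p0 v0 where h: "hd l = (R, u0, p0, v0)" using R_def by (cases "hd l") auto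
  have ha: "(R, u0, p0, v0) \<in> arcs Q" using h hd_in l(2) by auto
  then have R: "R \<in> regions M T" unfolding arcs_Q by blast
  then show "fst (hd l) \<in> regions M T" by (simp add: R_def)
  note RF = region_facts[OF R]
  define U where "U = {u. \<exists>p v. (R, u, p, v) \<in> set l}"
  have next_in: "\<exists>\<beta>\<in>set l. around_region \<alpha> \<beta>" if al: "\<alpha> \<in> set l" for \<alpha>
  proof -
    obtain i where i: "i < length l" "\<alpha> = l ! i" using al by (auto simp: in_set_conv_nth)
    show ?thesis
    proof (cases "Suc i < length l")
      case True
      then have "around_region (l ! i) (l ! Suc i)" using l(4) by (simp add: successively_conv_nth)
      then show ?thesis using i True nth_mem by blast
    next
      case False
      then have "i = length l - 1" using i(1) by simp
      then have "\<alpha> = last l" using i l(1) by (simp add: last_conv_nth)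
      then show ?thesis using l(5) hd_in by blast
    qed
  qed
  have closed: "y \<in> U" if x: "x \<in> U" and xy: "ccw_next R x y" for x y
  proof -
    obtain p v where a: "(R, x, p, v) \<in> set l" using x unfolding U_def by blast
    then have "ccw_next R x p" using l(2) arcs_Q by blast
    then have p: "p = y" using ccw_next_unique[OF RF(3) _ xy] by blast
    obtain \<beta> where b: "\<beta> \<in> set l" "around_region (R, x, p, v) \<beta>" using next_in[OF a] by blast
    obtain w where "\<beta> = (R, p, v, w)" using b(2) by (cases \<beta>) auto
    then show ?thesis using b(1) p unfolding U_def by blast
  qed
  have u0: "u0 \<in> U" unfolding U_def using h hd_in by auto
  have u0R: "u0 \<in> R" using ha ccw_next_neq unfolding arcs_Q by blast
  obtain ws where ws: "ws \<noteq> []" "hd ws = u0" "set ws = R" "successively (ccw_next R) ws"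
    using region_list[OF RF(2,3) _ u0R] RF(4) by auto
  have "set ws \<subseteq> U"
    by (rule successively_closed[OF ws(4,1)]) (use ws(2) u0 closed in simp_all)
  then have RU: "R \<subseteq> U" using ws(3) by simp
  have UR: "U \<subseteq> R"
  proof
    fix u assume "u \<in> U"
    then obtain p v where "(R, u, p, v) \<in> set l" unfolding U_def by blast
    then have "ccw_next R u p" using l(2) arcs_Q by blast
    then show "u \<in> R" using ccw_next_neq by blast
  qed
  have "sides R \<subseteq> T"
  proof
    fix e assume "e \<in> sides R"
    then obtain c d where cd: "e = {c, d}" "ccw_next R c d" by (elim sidesE)
    then have "c \<in> U" using ccw_next_neq[OF cd(2)] RU by blast
    then obtain p v where "(R, c, p, v) \<in> set l" unfolding U_def by blast
    then have "ccw_next R c p" "{c, p} \<in> T" using l(2) arcs_Q by blast+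
    then show "e \<in> T" using cd ccw_next_unique[OF RF(3) cd(2)] by simp
  qed
  then show "sides (fst (hd l)) \<subseteq> T" by (simp add: R_def)
  have same: "(R, u, p, v) = (R, u, p', v')" if "(R, u, p, v) \<in> arcs Q" "(R, u, p', v') \<in> arcs Q" for u p v p' v'
  proof -
    have n: "ccw_next R u p" "ccw_next R u p'" "ccw_next R p v" "ccw_next R p' v'" using that unfolding arcs_Q by blast+
    have "p = p'" by (rule ccw_next_unique[OF RF(3) n(1,2)])
    then show ?thesis using ccw_next_unique[OF RF(3) n(3)] n(4) by simp
  qed
  have set_l: "set l = {\<alpha> \<in> arcs Q. fst \<alpha> = R}"
  proof
    show "set l \<subseteq> {\<alpha> \<in> arcs Q. fst \<alpha> = R}" using l(2) fst_R by blast
    show "{\<alpha> \<in> arcs Q. fst \<alpha> = R} \<subseteq> set l"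
    proof
      fix \<alpha> assume "\<alpha> \<in> {\<alpha> \<in> arcs Q. fst \<alpha> = R}"
      then obtain u p v where a: "\<alpha> = (R, u, p, v)" "(R, u, p, v) \<in> arcs Q" by (cases \<alpha>) auto
      then have "u \<in> U" using RU ccw_next_neq unfolding arcs_Q by blast
      then obtain p' v' where b: "(R, u, p', v') \<in> set l" unfolding U_def by blast
      then have "(R, u, p', v') \<in> arcs Q" using l(2) by blast
      from same[OF a(2) this] show "\<alpha> \<in> set l" using b a(1) by simp
    qed
  qed
  then show "set l = {\<alpha> \<in> arcs Q. fst \<alpha> = fst (hd l)}" by (simp add: R_def)
  let ?g = "\<lambda>(R :: complex set, u :: complex, p :: complex, v :: complex). u"
  have "inj_on ?g (set l)"
  proof (rule inj_onI)
    fix x y assume xy: "x \<in> set l" "y \<in> set l" "?g x = ?g y"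
    obtain u p v where x: "x = (R, u, p, v)" using fst_R[OF xy(1)] by (cases x) auto
    obtain u' p' v' where y: "y = (R, u', p', v')" using fst_R[OF xy(2)] by (cases y) auto
    have "u' = u" using xy(3) x y by simp
    then show "x = y" using same[of u p v p' v'] xy(1,2) x y l(2) by auto
  qed
  then have "card (?g ` set l) = card (set l)" by (rule card_image)
  moreover have "?g ` set l = U"
  proof
    show "?g ` set l \<subseteq> U"
    proof
      fix u assume "u \<in> ?g ` set l"
      then obtain x where x: "x \<in> set l" "u = ?g x" by blast
      obtain u' p v where "x = (R, u', p, v)" using fst_R[OF x(1)] by (cases x) auto
      then show "u \<in> U" using x unfolding U_def by auto
    qed
    show "U \<subseteq> ?g ` set l" unfolding U_def by force
  qed
  ultimately have "card (set l) = card R" using RU UR by simp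
  then show "length l = m + 2" using distinct_card[OF l(3)] card_region[OF R] by simp
qed

lemma relation_cycle_exists:
  assumes R: "R \<in> regions M T" and s: "sides R \<subseteq> T"
  shows "\<exists>l. relation_cycle Q I l \<and> fst (hd l) = R"
proof -
  note RF = region_facts[OF R]
  have c2: "2 \<le> card R" using RF(4) by simp
  have "\<forall>z\<in>R. \<exists>q. ccw_next R z q" using ex_ccw_next[OF RF(2,3) c2] by blast
  then obtain nx where nx: "\<And>z. z \<in> R \<Longrightarrow> ccw_next R z (nx z)" by metis
  have nxR: "nx z \<in> R" if "z \<in> R" for z using ccw_next_neq[OF nx[OF that]] by blast
  have nx_eq: "nx z = q" if "ccw_next R z q" for z q
    using ccw_next_unique[OF RF(3) nx that] ccw_next_neq[OF that] by blast
  have sT: "{z, nx z} \<in> T" if "z \<in> R" for z using nx[OF that] s sides_iff by blast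
  obtain a where a: "a \<in> R" using RF(4) by fastforce
  obtain ws where ws: "ws \<noteq> []" "hd ws = a" "distinct ws" "set ws = R" "successively (ccw_next R) ws" "ccw_next R (last ws) a"
    using region_list[OF RF(2,3) c2 a] by blast
  define f where "f u = (R, u, nx u, nx (nx u))" for u
  have farc: "f u \<in> arcs Q" if "u \<in> R" for u
    unfolding f_def arcs_Q using R nx[OF that] nx[OF nxR[OF that]] sT[OF that] sT[OF nxR[OF that]] by simp
  have step: "around_region (f u) (f w)" if "ccw_next R u w" for u w
    using nx_eq[OF that] by (simp add: f_def)
  have "relation_cycle Q I (map f ws)"
    unfolding relation_cycle_around forbidden_path_around
  proof (intro conjI)
    show "map f ws \<noteq> []" using ws(1) by simp
    show "set (map f ws) \<subseteq> arcs Q" using farc ws(4) by auto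
    show "distinct (map f ws)" using ws(3) by (simp add: distinct_map f_def inj_on_def)
    show "successively around_region (map f ws)"
      unfolding successively_map by (rule successively_mono[OF ws(5)]) (rule step)
    show "around_region (last (map f ws)) (hd (map f ws))"
      using step[OF ws(6)] ws(1,2) by (simp add: last_map hd_map)
  qed
  moreover have "fst (hd (map f ws)) = R" using ws(1) by (simp add: hd_map f_def)
  ultimately show ?thesis by blast
qed

lemma relation_cycle_rotate1:
  assumes "relation_cycle Q I l"
  shows "relation_cycle Q I (rotate1 l) \<and> fst (hd (rotate1 l)) = fst (hd l)"
proof -
  have l: "l \<noteq> []" "set l \<subseteq> arcs Q" "distinct l" "successively around_region l" "around_region (last l) (hd l)"
    using assms unfolding relation_cycle_around forbidden_path_around by blast+
  obtain x xs where x: "l = x # xs" using l(1) by (cases l) auto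
  show ?thesis
  proof (cases "xs = []")
    case True
    then show ?thesis using assms x by simp
  next
    case False
    have s: "around_region x (hd xs)" "successively around_region xs"
      using l(4) False unfolding x by (simp_all add: successively_Cons)
    have e: "around_region (last xs) x" using l(5) False unfolding x by simp
    have "fst (hd xs) = fst x" using s(1) by (cases x; cases "hd xs") auto
    moreover have "relation_cycle Q I (rotate1 l)"
      unfolding relation_cycle_around forbidden_path_around
      using l(2,3) s e False unfolding x by (auto simp: successively_append_iff)
    ultimately show ?thesis using x False by simp
  qed
qed

lemma relation_cycle_rotate:
  assumes "relation_cycle Q I l"
  shows "relation_cycle Q I (rotate i l) \<and> fst (hd (rotate i l)) = fst (hd l)"
proof (induction i)
  case (Suc i)
  have "rotate (Suc i) l = rotate1 (rotate i l)" by (simp add: rotate_def)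
  then show ?case using relation_cycle_rotate1[of "rotate i l"] Suc by simp
qed (use assms in simp)

text \<open>Cycles around the same polygon use the same arrows. After a rotation they begin with the
  same one, and the successor of an arrow around a polygon is unique.\<close>

lemma relation_cycle_class:
  assumes rc: "relation_cycle Q I l"
  shows "range (\<lambda>i. rotate i l) = {l'. relation_cycle Q I l' \<and> fst (hd l') = fst (hd l)}"
proof
  show "range (\<lambda>i. rotate i l) \<subseteq> {l'. relation_cycle Q I l' \<and> fst (hd l') = fst (hd l)}"
    using relation_cycle_rotate[OF rc] by auto
  show "{l'. relation_cycle Q I l' \<and> fst (hd l') = fst (hd l)} \<subseteq> range (\<lambda>i. rotate i l)"
  proof
    fix l' assume "l' \<in> {l'. relation_cycle Q I l' \<and> fst (hd l') = fst (hd l)}"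
    then have l': "relation_cycle Q I l'" "fst (hd l') = fst (hd l)" by auto
    note c = relation_cycle_region[OF rc] and c' = relation_cycle_region[OF l'(1)]
    have "set l' = set l" using c(4) c'(4) l'(2) by simp
    then have "hd l' \<in> set l" using hd_in_set[OF c'(1)] by (simp only:)
    then obtain i where i: "i < length l" "l ! i = hd l'" by (auto simp: in_set_conv_nth)
    let ?r = "rotate i l"
    have r: "relation_cycle Q I ?r" using relation_cycle_rotate[OF rc] by blast
    have hd: "hd ?r = hd l'" using i c(1) by (simp add: hd_rotate_conv_nth)
    have sr: "successively around_region ?r" "set ?r \<subseteq> arcs Q" "?r \<noteq> []"
      and sl': "successively around_region l'" "set l' \<subseteq> arcs Q"
      using r l'(1) unfolding relation_cycle_around forbidden_path_around by blast+
    have len: "length ?r = length l'" using c(5) c'(5) by simp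
    have "?r = take (length ?r) l'"
    proof (rule successively_functional_prefix[OF sr(1) sl'(1) sr(3) c'(1) hd])
      show "length ?r \<le> length l'" using len by simp
      fix a b d assume m: "a \<in> set ?r" "b \<in> set ?r" "d \<in> set l'" "around_region a b" "around_region a d"
      then have "a \<in> arcs Q" "b \<in> arcs Q" "d \<in> arcs Q" using sr(2) sl'(2) by blast+
      then show "b = d" using around_region_unique(1) m(4,5) by blast
    qed
    then have "?r = l'" using len by simp
    then show "l' \<in> range (\<lambda>i. rotate i l)" by blast
  qed
qed

lemma card_relation_cycle_classes:
  "card (relation_cycle_classes Q I n) = (if n = m + 2 then card (internal_gons m M T) else 0)"
proof -
  let ?f = "\<lambda>R. {l. relation_cycle Q I l \<and> fst (hd l) = R}"
  have int: "internal_gons m M T = {R \<in> regions M T. sides R \<subseteq> T}"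
    by (simp add: internal_gons_def gons_eq)
  have eq: "relation_cycle_classes Q I n = (if n = m + 2 then ?f ` internal_gons m M T else {})"
  proof (rule Set.set_eqI)
    fix X
    have e: "X = range (\<lambda>i. rotate i l) \<and> relation_cycle Q I l \<and> length l = n \<longleftrightarrow>
        X = ?f (fst (hd l)) \<and> relation_cycle Q I l \<and> length l = n" for l
      using relation_cycle_class[of l] by (cases "relation_cycle Q I l") simp_all
    have "X \<in> relation_cycle_classes Q I n \<longleftrightarrow>
        (\<exists>l. X = range (\<lambda>i. rotate i l) \<and> relation_cycle Q I l \<and> length l = n)"
      unfolding relation_cycle_classes_def by simp
    also have "\<dots> \<longleftrightarrow> (\<exists>l. X = ?f (fst (hd l)) \<and> relation_cycle Q I l \<and> length l = n)"
      by (simp only: e)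
    also have "\<dots> \<longleftrightarrow> n = m + 2 \<and> (\<exists>l. X = ?f (fst (hd l)) \<and> relation_cycle Q I l)"
      using relation_cycle_region(5) by blast
    also have "\<dots> \<longleftrightarrow> n = m + 2 \<and> X \<in> ?f ` internal_gons m M T"
      unfolding int using relation_cycle_region(2,3) relation_cycle_exists by blast
    finally show "X \<in> relation_cycle_classes Q I n \<longleftrightarrow> X \<in> (if n = m + 2 then ?f ` internal_gons m M T else {})"
      by simp
  qed
  have "inj_on ?f (internal_gons m M T)"
  proof (rule inj_onI)
    fix R R' assume R: "R \<in> internal_gons m M T" "R' \<in> internal_gons m M T" "?f R = ?f R'"
    then obtain l where "relation_cycle Q I l" "fst (hd l) = R" using relation_cycle_exists unfolding int by blast
    then have "l \<in> ?f R'" using R(3) by blast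
    then show "R = R'" using \<open>fst (hd l) = R\<close> by simp
  qed
  then show ?thesis unfolding eq by (simp add: card_image)
qed

subsection \<open>Boundary pieces\<close>

lemma boundary_pieces_nxt: "boundary_pieces M T = (\<lambda>p. ccw_arc p (nxt p)) ` MT"
proof -
  have "ccw_next MT p q \<longleftrightarrow> p \<in> MT \<and> q = nxt p" for p q
    using nxt[of p] ccw_next_unique[OF MT_sub(3), of p q "nxt p"] ccw_next_neq[of MT p q] by blast
  then show ?thesis unfolding boundary_pieces_def MT_def[symmetric] by auto
qed

lemma piece_weight_nxt:
  assumes p: "p \<in> MT"
  shows "piece_weight M T (ccw_arc p (nxt p)) = card {z \<in> M. btw p z (nxt p)}"
proof -
  note n = nxt[OF p, unfolded ccw_next_btw[OF MT_sub(3)]]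
  have M: "p \<in> M" "nxt p \<in> M" using n MT_sub by blast+
  have "M \<inter> ccw_arc p (nxt p) - MT = {z \<in> M. btw p z (nxt p)}"
  proof (rule Set.set_eqI)
    fix z
    have d: "btw p z (nxt p) \<Longrightarrow> z \<notin> MT" using n by blast
    have i: "z \<in> M \<inter> ccw_arc p (nxt p) \<longleftrightarrow> z \<in> M \<and> (z = p \<or> z = nxt p \<or> btw p z (nxt p))"
      using in_cut[OF onS M] n by blast
    show "z \<in> M \<inter> ccw_arc p (nxt p) - MT \<longleftrightarrow> z \<in> {z \<in> M. btw p z (nxt p)}"
      unfolding Diff_iff i using d n by blast
  qed
  then show ?thesis by (simp add: piece_weight_def MT_def[symmetric])
qed

text \<open>A coincidence would need \<open>MT = {p, q}\<close> with both arcs meeting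
  \<open>M\<close> in the same points, but a diagonal has marked points strictly on each side. Hence
  the sum over boundary pieces is a sum over \<open>MT\<close>.\<close>

lemma piece_inj: "inj_on (\<lambda>p. ccw_arc p (nxt p)) MT"
proof (rule inj_onI, rule ccontr)
  fix p q assume p: "p \<in> MT" and q: "q \<in> MT" and eq: "ccw_arc p (nxt p) = ccw_arc q (nxt q)" and ne: "p \<noteq> q"
  have "{p, nxt p} = {q, nxt q}" using nxt[OF p] nxt[OF q] eq unfolding ccw_next_def by simp
  then have n: "nxt p = q" "nxt q = p" using ne by (auto simp: doubleton_eq_iff)
  have pq: "ccw_next MT p q" "ccw_next MT q p" using nxt[OF p] nxt[OF q] n by simp_all
  have "z = p \<or> z = q" if "z \<in> MT" for z
    using btw_cases_in[OF MT_sub(3) p q that ne] pq that unfolding ccw_next_btw[OF MT_sub(3)] by blast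
  moreover have "p \<in> nbs (last_nb p)" using last_nb(1)[OF p] nbs_sym by simp
  then have "last_nb p \<in> MT" using MT_iff by blast
  moreover have "last_nb p \<noteq> p" using T_in[OF T_last_nb[OF p]] by auto
  ultimately have "{p, q} \<in> diagonals M" using T_last_nb[OF p] diag by auto
  then obtain x where x: "x \<in> M" "btw p x q" using diagonals_btw[OF onS] by blast
  have M: "p \<in> M" "q \<in> M" using p q MT_sub by blast+
  have "x \<in> piece M p q" using in_cut[OF onS M ne] x by blast
  then have "x \<in> piece M q p" using eq n by simp
  then have "x = q \<or> x = p \<or> btw q x p" using in_cut[OF onS M(2,1) ne[symmetric]] by blast
  then show False using x(2) btw_distinct[OF x(2)] btw_asym[OF x(2)] by blast
qed

lemma sum_border:
  "int (\<Sum>p\<in>MT. thread_length (border p)) = (\<Sum>\<bb>\<in>boundary_pieces M T. int m - int (piece_weight M T \<bb>))"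
proof -
  have "int (thread_length (border p)) = int m - int (piece_weight M T (ccw_arc p (nxt p)))" if "p \<in> MT" for p
    using border[OF that] piece_weight_nxt[OF that] unfolding forb_at_def by linarith
  then show ?thesis
    unfolding boundary_pieces_nxt sum.reindex[OF piece_inj] by simp
qed

lemma AG_eq:
  "AG Q I \<sigma> \<epsilon> = (\<lambda>x. indicator {(card (incident_points M T), \<Sum>p\<in>MT. thread_length (border p))} x
     + card (internal_gons m M T) * indicator {(0, m + 2)} x)"
proof (rule ext)
  fix x :: "nat \<times> nat"
  obtain n q where x: "x = (n, q)" by (cases x) auto
  have "{X. ag_recorded Q I \<sigma> \<epsilon> n q X} =
      (if (n, q) = (card MT, \<Sum>p\<in>MT. thread_length (border p)) then {fan ` MT} else {})"
    unfolding ag_recorded_iff by auto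
  then have "card {X. ag_recorded Q I \<sigma> \<epsilon> n q X} = indicator {(card MT, \<Sum>p\<in>MT. thread_length (border p))} x"
    by (simp add: x indicator_def)
  moreover have "(if n = 0 then card (relation_cycle_classes Q I q) else 0) =
      card (internal_gons m M T) * indicator {(0, m + 2)} x"
    by (simp add: x indicator_def card_relation_cycle_classes)
  ultimately show "AG Q I \<sigma> \<epsilon> x = indicator {(card (incident_points M T), \<Sum>p\<in>MT. thread_length (border p))} x
     + card (internal_gons m M T) * indicator {(0, m + 2)} x"
    by (simp add: AG_def x MT_def)
qed

end

theorem theorem16:
  fixes m :: nat
    and M :: "complex set"
    and T :: "complex set set"
    and Q :: "(complex set, corner) pre_digraph"
    and I :: "(complex set \<times> corner list \<Rightarrow> 'k::alg_closed_field) set"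
    and \<sigma> \<epsilon> :: "corner \<Rightarrow> int"
  assumes "m \<ge> 1"
    and "finite M" and "M \<subseteq> sphere 0 1"
    and "angulation m M T"
    and "Q = angulation_quiver m M T"
    and "I = angulation_ideal m M T"
    and "Digraph_Component.connected Q"
    and "sign_functions Q I \<sigma> \<epsilon>"
  shows "\<exists>b. int b = (\<Sum>\<bb> \<in> boundary_pieces M T. int m - int (piece_weight M T \<bb>)) \<and>
    AG Q I \<sigma> \<epsilon> =
      (\<lambda>x. indicator {(card (incident_points M T), b)} x
         + card (internal_gons m M T) * indicator {(0, m + 2)} x)"
proof -
  \<comment> \<open>Connectedness includes that the quiver has a vertex, so \<open>T\<close>
    contains a diagonal.\<close>
  have "verts Q \<noteq> {}"
    using assms(7) by (simp add: Digraph_Component.connected_def strongly_connected_def)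
  then have T: "T \<noteq> {}" by (simp add: assms(5) angulation_quiver_def)
  note facts = angulation_facts[OF assms(1-4) T]
  interpret signed_angulation M T m Q I \<sigma> \<epsilon>
    by (rule signed_angulation.intro, rule polygon_angulation.intro[OF facts(1)],
        unfold_locales) (use assms T facts in auto)
  show ?thesis using sum_border AG_eq by blast
qed

end
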